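(* Let $s\in\mathbb{N}$, $m\geq 2$, and let $f_1,\ldots,f_m\in\mathbb{Z}[x_1,\ldots,x_s]$ be non-zero polynomials that do not have a common factor of degree $>0$. For $n\in\mathbb{N}$ let $\mathbf{U}_n^{(s)}=(U_{n,1},\ldots,U_{n,s})$ be uniformly distributed on $\{1,\ldots,n\}^s$. Then the series $$\sum_{p\in\mathcal{P}}\log p\,\min_{i=1,\ldots,m}\lambda_p\big(f_i(\mathcal{V}_1,\ldots,\mathcal{V}_s)\big)$$ converges almost surely. Define the random variable $G_{f_1,\ldots,f_m}$ by $$\log G_{f_1,\ldots,f_m}=\sum_{p\in\mathcal{P}}\log p\,\min_{i=1,\ldots,m}\lambda_p\big(f_i(\mathcal{V}_1,\ldots,\mathcal{V}_s)\big).$$ Then $G_{f_1,\ldots,f_m}$ takes values in $\mathbb{N}$ and $$\mathrm{GCD}\big(f_1(\mathbf{U}_n^{(s)}),\ldots,f_m(\mathbf{U}_n^{(s)})\big)\longrightarrow G_{f_1,\ldots,f_m}\quad\text{in distribution as } n\to\infty.$$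
   Context: $\mathcal{P}$ is the set of primes. For $p\in\mathcal{P}$, $\mathbb{Z}_p$ is the ring of $p$-adic integers, each element written uniquely as $\sum_{k\ge0}a_kp^k$ with $a_k\in\{0,\ldots,p-1\}$. $\widehat{\mathbb{Z}}=\prod_{p\in\mathcal{P}}\mathbb{Z}_p$ (componentwise ring operations, product topology). Let $V_p=\sum_{k\ge0}u_{k,p}p^k$ where all $u_{k,p}$ ($k\ge0$, $p\in\mathcal{P}$) are independent and uniform on $\{0,\ldots,p-1\}$, so $V_p$ has the Haar probability measure $\mu_p$ on $\mathbb{Z}_p$, and put $\mathcal{V}=(V_p)_{p\in\mathcal{P}}\in\widehat{\mathbb{Z}}$; $\mathcal{V}_1,\ldots,\mathcal{V}_s$ are independent copies of $\mathcal{V}$, and polynomials with integer coefficients are evaluated in the ring $\widehat{\mathbb{Z}}$. For $x\in\widehat{\mathbb{Z}}$ with $p$-th component $\sum_k a_{k,p}p^k$, $\lambda_p(x)=\inf\{k\ge0:a_{k,p}>0\}$ (so $\lambda_p(0)=+\infty$). For a multiset $A$ of integers, $\mathrm{GCD}(A)$ is the greatest common divisor of the absolute values, with the convention $\mathrm{GCD}(A):=\mathrm{GCD}(A\setminus\{0\})$ if $0\in A$. *)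

theory Defs
  imports
    "HOL-Probability.Probability"
    "HOL-Library.Poly_Mapping"
    "HOL-Library.Multiset"
    "HOL-Computational_Algebra.Primes"
    "HOL-Algebra.Ring"
begin

text \<open>
  A monomial is a finitely supported exponent vector, and a polynomial a finitely supported family
  of coefficients; multiplication on \<^typ>\<open>(nat \<Rightarrow>\<^sub>0 nat) \<Rightarrow>\<^sub>0 int\<close> is convolution. The variables are
  indexed from \<open>0\<close>, so \<open>int_polys s\<close> is $Z[x_0, ..., x_{s-1}]$.
\<close>

type_synonym int_mpoly = "(nat \<Rightarrow>\<^sub>0 nat) \<Rightarrow>\<^sub>0 int"

definition int_polys :: "nat \<Rightarrow> int_mpoly set" where
  "int_polys s = {f. \<forall>\<alpha>\<in>Poly_Mapping.keys f. Poly_Mapping.keys \<alpha> \<subseteq> {..<s}}"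

definition monom_degree :: "(nat \<Rightarrow>\<^sub>0 nat) \<Rightarrow> nat" where
  "monom_degree \<alpha> = (\<Sum>j\<in>Poly_Mapping.keys \<alpha>. Poly_Mapping.lookup \<alpha> j)"

definition total_degree :: "int_mpoly \<Rightarrow> nat" where
  "total_degree f = Max (insert 0 (monom_degree ` Poly_Mapping.keys f))"

definition eval_int :: "int_mpoly \<Rightarrow> (nat \<Rightarrow> int) \<Rightarrow> int" where
  "eval_int f x = (\<Sum>\<alpha>\<in>Poly_Mapping.keys f. Poly_Mapping.lookup f \<alpha> * (\<Prod>j\<in>Poly_Mapping.keys \<alpha>. x j ^ Poly_Mapping.lookup \<alpha> j))"

definition eval_ring :: "('a, 'b) ring_scheme \<Rightarrow> int_mpoly \<Rightarrow> (nat \<Rightarrow> 'a) \<Rightarrow> 'a" where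
  "eval_ring R f x =
     (\<Oplus>\<^bsub>R\<^esub>\<alpha>\<in>Poly_Mapping.keys f.
        [Poly_Mapping.lookup f \<alpha>] \<cdot>\<^bsub>R\<^esub> (\<Otimes>\<^bsub>R\<^esub>j\<in>Poly_Mapping.keys \<alpha>. x j [^]\<^bsub>R\<^esub> Poly_Mapping.lookup \<alpha> j))"

text \<open>
  The $p$-adic integers as the inverse limit of the rings of residues modulo \<open>p ^ n\<close>: the value
  \<open>x n\<close> is the canonical representative of the residue of \<open>x\<close> modulo \<open>p ^ n\<close>.
\<close>

definition padic_int :: "nat \<Rightarrow> (nat \<Rightarrow> int) ring" where
  "padic_int p =
     \<lparr>carrier = {x. \<forall>n. x n \<in> {0..<int p ^ n} \<and> x (Suc n) mod int p ^ n = x n},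
      mult = (\<lambda>x y n. (x n * y n) mod int p ^ n),
      one = (\<lambda>n. 1 mod int p ^ n),
      zero = (\<lambda>n. 0),
      add = (\<lambda>x y n. (x n + y n) mod int p ^ n)\<rparr>"

text \<open>
  \<open>padic_of_digits p a\<close> is the sum of the series with terms \<open>a k * p ^ k\<close>, whose residue modulo
  \<open>p ^ n\<close> is its \<open>n\<close>-th partial sum; \<open>padic_digit p x k\<close> is the coefficient of \<open>p ^ k\<close> in the
  expansion of \<open>x\<close>.
\<close>

definition padic_of_digits :: "nat \<Rightarrow> (nat \<Rightarrow> nat) \<Rightarrow> (nat \<Rightarrow> int)" where
  "padic_of_digits p a = (\<lambda>n. \<Sum>k<n. int (a k) * int p ^ k)"

definition padic_digit :: "nat \<Rightarrow> (nat \<Rightarrow> int) \<Rightarrow> nat \<Rightarrow> nat" where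
  "padic_digit p x k = nat (x (Suc k) div int p ^ k)"

definition Zhat :: "(nat \<Rightarrow> nat \<Rightarrow> int) ring" where
  "Zhat =
     \<lparr>carrier = (\<Pi>\<^sub>E p\<in>{p. prime p}. carrier (padic_int p)),
      mult = (\<lambda>x y. \<lambda>p\<in>{p. prime p}. x p \<otimes>\<^bsub>padic_int p\<^esub> y p),
      one = (\<lambda>p\<in>{p. prime p}. \<one>\<^bsub>padic_int p\<^esub>),
      zero = (\<lambda>p\<in>{p. prime p}. \<zero>\<^bsub>padic_int p\<^esub>),
      add = (\<lambda>x y. \<lambda>p\<in>{p. prime p}. x p \<oplus>\<^bsub>padic_int p\<^esub> y p)\<rparr>"

definition Zhat_of_digits :: "(nat \<Rightarrow> nat \<Rightarrow> nat) \<Rightarrow> (nat \<Rightarrow> nat \<Rightarrow> int)" where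
  "Zhat_of_digits a = (\<lambda>p\<in>{p. prime p}. padic_of_digits p (\<lambda>k. a k p))"

definition lambda_p :: "nat \<Rightarrow> (nat \<Rightarrow> nat \<Rightarrow> int) \<Rightarrow> enat" where
  "lambda_p p x = (INF k\<in>{k. padic_digit p (x p) k > 0}. enat k)"

definition log_G_term :: "nat \<Rightarrow> (nat \<Rightarrow> int_mpoly) \<Rightarrow> (nat \<Rightarrow> nat \<Rightarrow> nat \<Rightarrow> int) \<Rightarrow> nat \<Rightarrow> ereal" where
  "log_G_term m f v p =
     ereal (ln (real p)) * ereal_of_enat (MIN i\<in>{..<m}. lambda_p p (eval_ring Zhat (f i) v))"

text \<open>Where the series diverges, \<open>real_of_ereal\<close> gives \<open>limit_G\<close> the irrelevant value \<open>1\<close>.\<close>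

definition limit_G :: "nat \<Rightarrow> (nat \<Rightarrow> int_mpoly) \<Rightarrow> (nat \<Rightarrow> nat \<Rightarrow> nat \<Rightarrow> int) \<Rightarrow> real" where
  "limit_G m f v = exp (real_of_ereal (\<Sum>\<^sub>\<infinity>p\<in>{p. prime p}. log_G_term m f v p))"

text \<open>If \<open>A\<close> has no non-zero member, the result is \<open>Gcd {} = 0\<close>.\<close>

definition gcd_nonzero :: "int multiset \<Rightarrow> int" where
  "gcd_nonzero A = Gcd (abs ` (set_mset A - {0}))"

lemma padic_int_cring:
  assumes "p > 0"
  shows "cring (padic_int p)"
proof -
  have pos: "int p ^ n > 0" for n using assms by simp
  have down: "(a mod int p ^ Suc n) mod int p ^ n = a mod int p ^ n" for a n
    by (simp add: mod_mod_cancel)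
  have addc: "((a mod int p ^ Suc n) mod int p ^ n) = b mod int p ^ n"
    if "a mod int p ^ n = b mod int p ^ n" for a b n
    using that down by simp
  have cadd: "(x (Suc n) + y (Suc n)) mod int p ^ n = (x n + y n) mod int p ^ n"
    if "x (Suc n) mod int p ^ n = x n" "y (Suc n) mod int p ^ n = y n" for x y :: "nat \<Rightarrow> int" and n
    using that by (metis mod_add_eq)
  have cmult: "(x (Suc n) * y (Suc n)) mod int p ^ n = (x n * y n) mod int p ^ n"
    if "x (Suc n) mod int p ^ n = x n" "y (Suc n) mod int p ^ n = y n" for x y :: "nat \<Rightarrow> int" and n
    using that by (metis mod_mult_eq)
  show ?thesis
  proof (rule cringI)
    show "abelian_group (padic_int p)"
    proof (rule abelian_groupI)
      fix x assume x: "x \<in> carrier (padic_int p)"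
      let ?y = "\<lambda>n. (- x n) mod int p ^ n"
      have "?y \<in> carrier (padic_int p)"
        using x pos addc unfolding padic_int_def
        by (auto simp del: power_Suc) (metis mod_minus_eq)
      moreover have "?y \<oplus>\<^bsub>padic_int p\<^esub> x = \<zero>\<^bsub>padic_int p\<^esub>"
        by (auto simp: padic_int_def fun_eq_iff mod_add_left_eq)
      ultimately show "\<exists>y\<in>carrier (padic_int p). y \<oplus>\<^bsub>padic_int p\<^esub> x = \<zero>\<^bsub>padic_int p\<^esub>"
        by blast
    qed (use pos in \<open>auto simp: padic_int_def fun_eq_iff mod_add_left_eq mod_add_right_eq
          ac_simps down addc cadd simp del: power_Suc\<close>)
    show "comm_monoid (padic_int p)"
    proof (rule comm_monoidI)
      show "\<one>\<^bsub>padic_int p\<^esub> \<in> carrier (padic_int p)"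
        using pos by (auto simp: padic_int_def down simp del: power_Suc)
    qed (use pos in \<open>auto simp: padic_int_def fun_eq_iff mod_mult_left_eq mod_mult_right_eq
          ac_simps down addc cmult simp del: power_Suc\<close>)
  qed (auto simp: padic_int_def fun_eq_iff mod_simps algebra_simps)
qed

lemma Zhat_cring: "cring Zhat"
proof -
  have R: "cring (padic_int p)" if "prime p" for p
    using that padic_int_cring prime_gt_0_nat by blast
  have A: "abelian_group (padic_int p)" if "prime p" for p
    using R[OF that] by (simp add: cring_def ring.is_abelian_group)
  have AM: "abelian_monoid (padic_int p)" if "prime p" for p
    using A[OF that] by (rule abelian_group.axioms)
  have M: "Group.comm_monoid (padic_int p)" if "prime p" for p
    using R[OF that] by (simp add: cring_def)
  have MM: "Group.monoid (padic_int p)" if "prime p" for p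
    using M[OF that] by (rule comm_monoid.axioms)
  have eqI: "x = y" if "x \<in> carrier Zhat" "y \<in> carrier Zhat" "\<And>p. prime p \<Longrightarrow> x p = y p" for x y
    by (rule PiE_ext[where k = "{p. prime p}" and s = "\<lambda>p. carrier (padic_int p)"])
       (use that in \<open>simp_all add: Zhat_def\<close>)
  have comp: "x p \<in> carrier (padic_int p)" if "x \<in> carrier Zhat" "prime p" for x p
    using that by (auto simp: Zhat_def)
  have addc: "x \<oplus>\<^bsub>Zhat\<^esub> y \<in> carrier Zhat" if "x \<in> carrier Zhat" "y \<in> carrier Zhat" for x y
    using that AM by (auto simp: Zhat_def abelian_monoid.a_closed PiE_iff)
  have multc: "x \<otimes>\<^bsub>Zhat\<^esub> y \<in> carrier Zhat" if "x \<in> carrier Zhat" "y \<in> carrier Zhat" for x y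
    using that MM by (auto simp: Zhat_def monoid.m_closed PiE_iff)
  have zeroc: "\<zero>\<^bsub>Zhat\<^esub> \<in> carrier Zhat"
    using AM by (auto simp: Zhat_def abelian_monoid.zero_closed)
  have onec: "\<one>\<^bsub>Zhat\<^esub> \<in> carrier Zhat"
    using MM by (auto simp: Zhat_def monoid.one_closed)
  have at: "(x \<oplus>\<^bsub>Zhat\<^esub> y) p = x p \<oplus>\<^bsub>padic_int p\<^esub> y p" "(x \<otimes>\<^bsub>Zhat\<^esub> y) p = x p \<otimes>\<^bsub>padic_int p\<^esub> y p"
    "\<zero>\<^bsub>Zhat\<^esub> p = \<zero>\<^bsub>padic_int p\<^esub>" "\<one>\<^bsub>Zhat\<^esub> p = \<one>\<^bsub>padic_int p\<^esub>" if "prime p" for x y p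
    using that by (auto simp: Zhat_def)
  show ?thesis
  proof (rule cringI)
    show "abelian_group Zhat"
    proof (rule abelian_groupI)
      fix x assume x: "x \<in> carrier Zhat"
      let ?y = "\<lambda>p\<in>{p. prime p}. \<ominus>\<^bsub>padic_int p\<^esub> x p"
      have y: "?y \<in> carrier Zhat"
        using x A by (auto simp: Zhat_def PiE_iff intro!: abelian_group.a_inv_closed)
      moreover have "?y \<oplus>\<^bsub>Zhat\<^esub> x = \<zero>\<^bsub>Zhat\<^esub>"
        by (rule eqI) (use x y addc zeroc comp A in \<open>auto simp: at abelian_group.l_neg\<close>)
      ultimately show "\<exists>y\<in>carrier Zhat. y \<oplus>\<^bsub>Zhat\<^esub> x = \<zero>\<^bsub>Zhat\<^esub>" by blast
    qed (auto intro!: eqI addc zeroc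
           simp: at comp abelian_monoid.l_zero[OF AM] abelian_monoid.a_assoc[OF AM]
             abelian_monoid.a_comm[OF AM])
    show "Group.comm_monoid Zhat"
      by (rule comm_monoidI)
         (auto intro!: eqI multc onec
           simp: at comp monoid.l_one[OF MM] monoid.m_assoc[OF MM] comm_monoid.m_comm[OF M])
  next
    fix x y z assume "x \<in> carrier Zhat" "y \<in> carrier Zhat" "z \<in> carrier Zhat"
    thus "(x \<oplus>\<^bsub>Zhat\<^esub> y) \<otimes>\<^bsub>Zhat\<^esub> z = x \<otimes>\<^bsub>Zhat\<^esub> z \<oplus>\<^bsub>Zhat\<^esub> y \<otimes>\<^bsub>Zhat\<^esub> z"
      by (intro eqI addc multc) (auto simp: at comp ring.ring_simprules(13)[OF cring.axioms(1)[OF R]])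
  qed
qed

lemma padic_of_digits_bij:
  assumes "p > 0"
  shows "bij_betw (padic_of_digits p) {a. \<forall>k. a k < p} (carrier (padic_int p))"
    and "\<And>x. x \<in> carrier (padic_int p) \<Longrightarrow> padic_of_digits p (padic_digit p x) = x"
    and "\<And>a. (\<And>k. a k < p) \<Longrightarrow> padic_digit p (padic_of_digits p a) = a"
proof -
  have pos: "int p ^ n > 0" for n using assms by simp
  have bnd: "padic_of_digits p a n \<in> {0..<int p ^ n}" if a: "\<And>k. a k < p" for a n
  proof (induction n)
    case 0 show ?case by (simp add: padic_of_digits_def)
  next
    case (Suc n)
    have "int (a n) \<le> int p - 1" using a[of n] by simp
    hence "int (a n) * int p ^ n \<le> (int p - 1) * int p ^ n"
      using pos[of n] by (intro mult_right_mono) auto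
    moreover have "0 \<le> int (a n) * int p ^ n" by simp
    ultimately show ?case using Suc by (auto simp: padic_of_digits_def algebra_simps)
  qed
  have step: "padic_of_digits p a (Suc n) = padic_of_digits p a n + int (a n) * int p ^ n" for a n
    by (simp add: padic_of_digits_def)
  have into: "padic_of_digits p a \<in> carrier (padic_int p)" if a: "\<And>k. a k < p" for a
    using bnd[OF a] step[of a] unfolding padic_int_def by auto
  have dig: "padic_digit p x k < p" if "x \<in> carrier (padic_int p)" for x k
  proof -
    have "x (Suc k) \<ge> 0" "x (Suc k) < int p * int p ^ k"
      using that by (auto simp: padic_int_def dest!: spec[of _ "Suc k"])
    moreover have "x (Suc k) div int p ^ k * int p ^ k \<le> x (Suc k)"
      using pos_mod_sign[OF pos[of k], of "x (Suc k)"] div_mult_mod_eq[of "x (Suc k)" "int p ^ k"]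
      by linarith
    ultimately have "x (Suc k) div int p ^ k * int p ^ k < int p * int p ^ k"
      by linarith
    hence "x (Suc k) div int p ^ k < int p"
      using pos[of k] by (simp only: mult_less_cancel_right_pos)
    thus ?thesis using assms by (simp add: padic_digit_def nat_less_iff)
  qed
  show 1: "padic_of_digits p (padic_digit p x) = x" if x: "x \<in> carrier (padic_int p)" for x
  proof
    fix n show "padic_of_digits p (padic_digit p x) n = x n"
    proof (induction n)
      case 0
      have "x 0 \<in> {0..<int p ^ 0}" using x unfolding padic_int_def by (simp only: partial_object.simps) blast
      thus ?case by (simp add: padic_of_digits_def)
    next
      case (Suc n)
      have "x (Suc n) \<in> {0..<int p ^ Suc n}" "x (Suc n) mod int p ^ n = x n"
        using x unfolding padic_int_def by (simp only: partial_object.simps, blast)+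
      moreover from this have "x (Suc n) div int p ^ n \<ge> 0"
        using pos[of n] by (simp add: pos_imp_zdiv_nonneg_iff)
      ultimately have "x n + int (padic_digit p x n) * int p ^ n = x (Suc n)"
        using div_mult_mod_eq[of "x (Suc n)" "int p ^ n"] unfolding padic_digit_def
        by (simp only: nat_0_le int_nat_eq if_True)
      thus ?case using Suc step[of "padic_digit p x" n] by simp
    qed
  qed
  show 2: "padic_digit p (padic_of_digits p a) = a" if a: "\<And>k. a k < p" for a
  proof
    fix k
    show "padic_digit p (padic_of_digits p a) k = a k"
      using bnd[of a k, OF a] pos[of k] by (simp add: padic_digit_def step)
  qed
  show "bij_betw (padic_of_digits p) {a. \<forall>k. a k < p} (carrier (padic_int p))"
    by (rule bij_betw_byWitness[where f' = "padic_digit p"])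
       (use 1 2 into dig in \<open>auto simp: image_subset_iff\<close>)
qed

end

theory Submission
  imports Defs "HOL-Computational_Algebra.Polynomial" "HOL-Number_Theory.Cong"
begin

text \<open>
  Write $D(x)$ for the greatest common divisor of the values $f_i(x)$. For finitely many primes and a
  fixed exponent \<open>K\<close>, the residues of a uniform point of $\{1,\ldots,n\}^s$ modulo the \<open>p ^ K\<close> are
  asymptotically distributed like those of the Haar-random point (Chinese remainder theorem), so the
  part of $D$ visible in these residues converges in distribution. Two tail estimates, uniform in \<open>n\<close>,
  allow passing to $D$ itself: \<open>p ^ K\<close> rarely divides $f_0(x)$ for large \<open>K\<close>, and few \<open>x\<close> admit any
  prime \<open>p > N\<close> dividing $D(x)$.

  The second estimate is an induction on \<open>s\<close>. By Gauss's lemma some nonzero polynomial \<open>R\<close> in the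
  first $s - 1$ variables lies in the ideal of the $f_i$, so \<open>p\<close> divides $R(x')$. Unless \<open>p\<close> divides
  all coefficients of all $f_i(x', \cdot)$, which is the induction hypothesis for the coefficient
  family, the last coordinate is confined to few residue classes modulo \<open>p\<close>. For $p \leq n$ the two
  conditions together have density $O(1/p^2)$; for $p > n$ only boundedly many primes divide the
  nonzero integer $R(x')$, and each leaves boundedly many choices of the last coordinate. The same
  bounds pass to the limit and show that almost surely only finitely many primes contribute to the
  series, each with a finite exponent.
\<close>

section \<open>Gauss's lemma for subrings of an integral domain\<close>

text \<open>All the rings Z[x_0, ..., x_{s-1}] live in the one type \<open>int_mpoly\<close>, as the
  subsets \<open>int_polys s\<close>, and divisibility and primality are relative to a subset: the
  cofactor has to lie in it. An induction on \<open>s\<close> can then pass from ring to ring within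
  one type.

  The polynomial \<open>R\<close> is taken from an ideal rather than as a resultant of two members,
  because any two of the polynomials may share a factor although the whole family does not.

  A common integer factor is allowed, and leading coefficients may vanish modulo p. The counting
  bounds therefore carry a fixed nonzero integer \<open>a\<close> as an exceptional modulus, while
  their other constants depend on the polynomial alone, not on p or n.

  A residue class modulo p meets {1..n} in n/p points up to an error of 1. This error is absorbed by
  n/p only if p is at most n; for larger primes it dominates, and the number of primes has to be
  bounded instead, through the polynomial growth of \<open>R\<close>.\<close>

definition dvd_in :: "'r::idom set \<Rightarrow> 'r \<Rightarrow> 'r \<Rightarrow> bool" where
  "dvd_in A a b \<longleftrightarrow> (\<exists>c\<in>A. b = a * c)"

definition prime_in :: "'r::idom set \<Rightarrow> 'r \<Rightarrow> bool" where
  "prime_in A q \<longleftrightarrow> q \<in> A \<and> q \<noteq> 0 \<and> \<not> dvd_in A q 1 \<and>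
     (\<forall>a\<in>A. \<forall>b\<in>A. dvd_in A q (a * b) \<longrightarrow> dvd_in A q a \<or> dvd_in A q b)"

definition polys_over :: "'r::zero set \<Rightarrow> 'r poly set" where
  "polys_over A = {P. \<forall>k. coeff P k \<in> A}"

lemma smult_left_cancel: "(c :: 'r::idom) \<noteq> 0 \<Longrightarrow> smult c P = smult c Q \<Longrightarrow> P = Q"
  by (simp add: poly_eq_iff)

locale subring_of_idom =
  fixes A :: "'r::idom set"
  assumes zero_in [simp, intro]: "0 \<in> A"
    and one_in [simp, intro]: "1 \<in> A"
    and add_in [intro]: "\<And>a b. a \<in> A \<Longrightarrow> b \<in> A \<Longrightarrow> a + b \<in> A"
    and uminus_in [intro]: "\<And>a. a \<in> A \<Longrightarrow> - a \<in> A"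
    and mult_in [intro]: "\<And>a b. a \<in> A \<Longrightarrow> b \<in> A \<Longrightarrow> a * b \<in> A"
begin

lemma diff_in [intro]: "a \<in> A \<Longrightarrow> b \<in> A \<Longrightarrow> a - b \<in> A"
  using add_in[of a "- b"] uminus_in by simp

lemma sum_in: "(\<And>i. i \<in> I \<Longrightarrow> g i \<in> A) \<Longrightarrow> sum g I \<in> A"
  by (induction I rule: infinite_finite_induct) auto

lemma dvd_in_add: "dvd_in A a b \<Longrightarrow> dvd_in A a c \<Longrightarrow> dvd_in A a (b + c)"
  unfolding dvd_in_def by (metis add_in distrib_left)

lemma dvd_in_uminus: "dvd_in A a b \<Longrightarrow> dvd_in A a (- b)"
  unfolding dvd_in_def by (metis uminus_in mult_minus_right)

lemma dvd_in_diff: "dvd_in A a b \<Longrightarrow> dvd_in A a c \<Longrightarrow> dvd_in A a (b - c)"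
  using dvd_in_add[of a b "- c"] dvd_in_uminus by simp

lemma dvd_in_zero [simp]: "dvd_in A a 0"
  unfolding dvd_in_def by (rule bexI[of _ 0]) auto

lemma dvd_in_refl [simp]: "dvd_in A a a"
  unfolding dvd_in_def by (rule bexI[of _ 1]) auto

lemma dvd_in_mult_right: "dvd_in A a b \<Longrightarrow> c \<in> A \<Longrightarrow> dvd_in A a (b * c)"
  unfolding dvd_in_def by (metis mult_in mult.assoc)

lemma dvd_in_trans: "dvd_in A a b \<Longrightarrow> dvd_in A b c \<Longrightarrow> dvd_in A a c"
  unfolding dvd_in_def by (metis mult_in mult.assoc)

lemma dvd_in_sum: "(\<And>i. i \<in> I \<Longrightarrow> dvd_in A a (g i)) \<Longrightarrow> dvd_in A a (sum g I)"
  by (induction I rule: infinite_finite_induct) (auto intro: dvd_in_add)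

lemma polys_over_subring: "subring_of_idom (polys_over A)"
proof
  show "P * Q \<in> polys_over A" if "P \<in> polys_over A" "Q \<in> polys_over A" for P Q
    using that by (auto simp: polys_over_def coeff_mult intro!: sum_in)
qed (auto simp: polys_over_def one_pCons coeff_pCons split: nat.splits)

lemma const_in_polys_over: "[:a:] \<in> polys_over A \<longleftrightarrow> a \<in> A"
  by (auto simp: polys_over_def coeff_pCons split: nat.splits)

lemma monom_in_polys_over: "a \<in> A \<Longrightarrow> monom a k \<in> polys_over A"
  by (auto simp: polys_over_def)

lemma coeff_in: "P \<in> polys_over A \<Longrightarrow> coeff P k \<in> A"
  by (simp add: polys_over_def)

lemma smult_in_polys_over: "a \<in> A \<Longrightarrow> P \<in> polys_over A \<Longrightarrow> smult a P \<in> polys_over A"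
  by (auto simp: polys_over_def)

lemma const_dvd_in_polys_over_iff:
  "dvd_in (polys_over A) [:a:] P \<longleftrightarrow> (\<forall>k. dvd_in A a (coeff P k))"
proof
  assume "dvd_in (polys_over A) [:a:] P"
  then obtain Q where "Q \<in> polys_over A" "P = smult a Q" by (auto simp: dvd_in_def)
  thus "\<forall>k. dvd_in A a (coeff P k)" by (auto simp: dvd_in_def polys_over_def)
next
  assume "\<forall>k. dvd_in A a (coeff P k)"
  then obtain c where c: "\<And>k. c k \<in> A" "\<And>k. coeff P k = a * c k"
    unfolding dvd_in_def by metis
  define Q where "Q = (\<Sum>k\<le>degree P. monom (c k) k)"
  have Q: "coeff Q k = (if k \<le> degree P then c k else 0)" for k
    by (simp add: Q_def coeff_sum)
  have "Q \<in> polys_over A" using c by (auto simp: polys_over_def Q)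
  moreover have "P = [:a:] * Q"
    using c(2)[symmetric] by (intro poly_eqI) (auto simp: Q coeff_eq_0)
  ultimately show "dvd_in (polys_over A) [:a:] P" by (auto simp: dvd_in_def)
qed

text \<open>Gauss's lemma. If P_i and Q_j are the first coefficients that q does not divide, then
  coefficient i + j of P * Q is P_i * Q_j plus multiples of q.\<close>

lemma prime_in_polys_over:
  assumes "prime_in A q"
  shows "prime_in (polys_over A) [:q:]"
proof -
  have q: "q \<in> A" "q \<noteq> 0" "\<not> dvd_in A q 1"
    "\<And>a b. a \<in> A \<Longrightarrow> b \<in> A \<Longrightarrow> dvd_in A q (a * b) \<Longrightarrow> dvd_in A q a \<or> dvd_in A q b"
    using assms by (auto simp: prime_in_def)
  have "\<exists>k. \<not> dvd_in A q (coeff (P * Q) k)"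
    if PQ: "P \<in> polys_over A" "Q \<in> polys_over A"
      and P: "\<exists>k. \<not> dvd_in A q (coeff P k)" and Q: "\<exists>k. \<not> dvd_in A q (coeff Q k)" for P Q
  proof -
    define i where "i = (LEAST k. \<not> dvd_in A q (coeff P k))"
    define j where "j = (LEAST k. \<not> dvd_in A q (coeff Q k))"
    have i: "\<not> dvd_in A q (coeff P i)" "\<And>k. k < i \<Longrightarrow> dvd_in A q (coeff P k)"
      using LeastI_ex[OF P] not_less_Least unfolding i_def by auto
    have j: "\<not> dvd_in A q (coeff Q j)" "\<And>k. k < j \<Longrightarrow> dvd_in A q (coeff Q k)"
      using LeastI_ex[OF Q] not_less_Least unfolding j_def by auto
    have split: "coeff (P * Q) (i + j) = coeff P i * coeff Q j
        + (\<Sum>k\<in>{..i+j}-{i}. coeff P k * coeff Q (i + j - k))"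
      unfolding coeff_mult by (subst sum.remove[of _ i]) auto
    have rest: "dvd_in A q (\<Sum>k\<in>{..i+j}-{i}. coeff P k * coeff Q (i + j - k))"
    proof (rule dvd_in_sum)
      fix k assume k: "k \<in> {..i+j}-{i}"
      show "dvd_in A q (coeff P k * coeff Q (i + j - k))"
      proof (cases "k < i")
        case True
        thus ?thesis using i(2) PQ coeff_in by (blast intro: dvd_in_mult_right)
      next
        case False
        hence "i + j - k < j" using k by auto
        thus ?thesis using j(2) PQ coeff_in dvd_in_mult_right[of q "coeff Q (i+j-k)" "coeff P k"]
          by (simp add: mult.commute)
      qed
    qed
    have "\<not> dvd_in A q (coeff P i * coeff Q j)"
      using i(1) j(1) q(4) PQ coeff_in by blast
    hence "\<not> dvd_in A q (coeff (P * Q) (i + j))"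
      using dvd_in_diff[OF _ rest, of "coeff (P * Q) (i + j)"] split by auto
    thus ?thesis by blast
  qed
  moreover have "\<not> dvd_in (polys_over A) [:q:] 1"
    using q(3) unfolding const_dvd_in_polys_over_iff by (metis lead_coeff_1)
  ultimately show ?thesis
    using q(1,2) const_in_polys_over unfolding prime_in_def const_dvd_in_polys_over_iff
    by (metis pCons_eq_0_iff)
qed

end

text \<open>Unique factorization in a form made for induction: an additive size that vanishes
  exactly at the units, and a prime divisor for every other nonzero element. \<open>\<mu>\<close>
  need not count prime factors.\<close>

locale factorial_subring = subring_of_idom A for A :: "'r::idom set" +
  fixes \<mu> :: "'r \<Rightarrow> nat"
  assumes size_mult: "\<And>a b. a \<in> A \<Longrightarrow> b \<in> A \<Longrightarrow> a \<noteq> 0 \<Longrightarrow> b \<noteq> 0 \<Longrightarrow> \<mu> (a * b) = \<mu> a + \<mu> b"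
    and size_0_unit: "\<And>a. a \<in> A \<Longrightarrow> a \<noteq> 0 \<Longrightarrow> \<mu> a = 0 \<Longrightarrow> dvd_in A a 1"
    and size_pos_prime: "\<And>a. a \<in> A \<Longrightarrow> a \<noteq> 0 \<Longrightarrow> \<mu> a \<noteq> 0 \<Longrightarrow> \<exists>q. prime_in A q \<and> dvd_in A q a"
begin

lemma prime_size: "prime_in A q \<Longrightarrow> \<mu> q > 0"
  using size_0_unit unfolding prime_in_def by blast

interpretation P: subring_of_idom "polys_over A" by (rule polys_over_subring)

text \<open>The constant \<open>a\<close> is removed one prime q at a time. If q divides G, it is
  moved into \<open>b\<close>; otherwise q divides the cofactor of each \<open>smult a F\<close>, by
  primality in the polynomial ring, and cancels there. The case distinction concerns G alone, so one
  H serves all of S.\<close>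

lemma gauss_descent:
  assumes "a \<in> A" "a \<noteq> 0" "G \<in> polys_over A" "\<And>F. F \<in> S \<Longrightarrow> F \<in> polys_over A"
    and "\<And>F. F \<in> S \<Longrightarrow> dvd_in (polys_over A) G (smult a F)"
  shows "\<exists>b\<in>A. \<exists>H\<in>polys_over A. G = smult b H \<and> (\<forall>F\<in>S. dvd_in (polys_over A) H F)"
  using assms
proof (induction "\<mu> a" arbitrary: a G rule: less_induct)
  case less
  show ?case
  proof (cases "\<mu> a = 0")
    case True
    then obtain c where c: "c \<in> A" "a * c = 1"
      using size_0_unit[of a] less.prems unfolding dvd_in_def by metis
    have "dvd_in (polys_over A) G F" if "F \<in> S" for F
    proof -
      have "F = smult a F * [:c:]" using c by (simp add: mult.commute)
      thus ?thesis
        using P.dvd_in_mult_right[OF less.prems(5)[OF that], of "[:c:]"] c const_in_polys_over by simp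
    qed
    thus ?thesis using less.prems by (intro bexI[of _ 1] bexI[of _ G]) auto
  next
    case False
    then obtain q where q: "prime_in A q" "dvd_in A q a"
      using size_pos_prime less.prems by blast
    then obtain b where b: "b \<in> A" "a = q * b" by (auto simp: dvd_in_def)
    have q': "q \<in> A" "q \<noteq> 0" using q by (auto simp: prime_in_def)
    have b0: "b \<noteq> 0" using b less.prems by auto
    have less_b: "\<mu> b < \<mu> a"
      using size_mult[OF q'(1) b(1) q'(2) b0] prime_size[OF q(1)] b(2) by simp
    have prime: "prime_in (polys_over A) [:q:]" using q by (intro prime_in_polys_over)
    show ?thesis
    proof (cases "dvd_in (polys_over A) [:q:] G")
      case True
      then obtain G1 where G1: "G1 \<in> polys_over A" "G = smult q G1" by (auto simp: dvd_in_def)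
      have "dvd_in (polys_over A) G1 (smult b F)" if F: "F \<in> S" for F
      proof -
        obtain H where "H \<in> polys_over A" "smult a F = G * H"
          using less.prems(5)[OF F] by (auto simp: dvd_in_def)
        hence "smult q (smult b F) = smult q (G1 * H)" using G1 b by simp
        hence "smult b F = G1 * H" using q' smult_left_cancel by blast
        thus ?thesis using \<open>H \<in> polys_over A\<close> by (auto simp: dvd_in_def)
      qed
      from less.hyps[OF less_b b(1) b0 G1(1) less.prems(4) this]
      obtain c H where "c \<in> A" "H \<in> polys_over A" "G1 = smult c H"
        "\<forall>F\<in>S. dvd_in (polys_over A) H F" by blast
      thus ?thesis using G1 q' by (intro bexI[of _ "q * c"] bexI[of _ H]) auto
    next
      case False
      have "dvd_in (polys_over A) G (smult b F)" if F: "F \<in> S" for F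
      proof -
        obtain H where H: "H \<in> polys_over A" "smult a F = G * H"
          using less.prems(5)[OF F] by (auto simp: dvd_in_def)
        hence "G * H = [:q:] * smult b F" using b by (simp add: mult.commute)
        hence "dvd_in (polys_over A) [:q:] (G * H)"
          using smult_in_polys_over[OF b(1) less.prems(4)[OF F]] unfolding dvd_in_def by blast
        hence "dvd_in (polys_over A) [:q:] H"
          using prime False H less.prems(3) by (auto simp: prime_in_def)
        then obtain H1 where H1: "H1 \<in> polys_over A" "H = smult q H1" by (auto simp: dvd_in_def)
        have "smult q (smult b F) = smult q (G * H1)" using H H1 b by simp
        hence "smult b F = G * H1" using q' smult_left_cancel by blast
        thus ?thesis using H1 by (auto simp: dvd_in_def)
      qed
      from less.hyps[OF less_b b(1) b0 less.prems(3,4) this] show ?thesis .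
    qed
  qed
qed

text \<open>An element of least degree in an ideal divides every member up to a constant, by pseudo-division.\<close>

lemma ideal_least_degree:
  assumes J: "J \<subseteq> polys_over A" "\<And>P Q. P \<in> J \<Longrightarrow> Q \<in> J \<Longrightarrow> P - Q \<in> J"
      "\<And>P Q. P \<in> J \<Longrightarrow> Q \<in> polys_over A \<Longrightarrow> P * Q \<in> J"
    and G: "G \<in> J" "G \<noteq> 0" "\<And>P. P \<in> J \<Longrightarrow> P \<noteq> 0 \<Longrightarrow> degree G \<le> degree P"
    and F: "F \<in> J"
  shows "\<exists>k. dvd_in (polys_over A) G (smult (lead_coeff G ^ k) F)"
  using F
proof (induction "degree F" arbitrary: F rule: less_induct)
  case less
  let ?c = "lead_coeff G"
  have GA: "G \<in> polys_over A" "F \<in> polys_over A" using G J(1) less.prems by auto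
  have cA: "?c \<in> A" using GA coeff_in by auto
  have powA: "?c ^ k \<in> A" for k by (induction k) (auto intro: cA)
  show ?case
  proof (cases "F = 0")
    case True
    thus ?thesis by simp
  next
    case False
    hence deg: "degree G \<le> degree F" using G less.prems by auto
    define M where "M = monom (lead_coeff F) (degree F - degree G)"
    have M: "M \<in> polys_over A" unfolding M_def using GA(2) coeff_in by (auto intro: monom_in_polys_over)
    define F' where "F' = F * [:?c:] - G * M"
    have F'J: "F' \<in> J" unfolding F'_def
      using J(2)[OF J(3)[OF less.prems] J(3)[OF G(1) M]] const_in_polys_over cA by blast
    have degM: "degree (G * M) \<le> degree F"
      by (rule order.trans[OF degree_mult_le]) (use deg in \<open>auto simp: M_def degree_monom_eq False\<close>)
    have le: "degree F' \<le> degree F" unfolding F'_def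
      by (rule degree_diff_le) (use degM in auto)
    have "coeff (G * M) (degree F) = ?c * lead_coeff F"
      using coeff_mult_degree_sum[of G M] deg False by (simp add: M_def degree_monom_eq)
    hence 0: "coeff F' (degree F) = 0" by (simp add: F'_def)
    have "\<exists>k. dvd_in (polys_over A) G (smult (?c ^ k) F')"
    proof (cases "F' = 0")
      case True
      thus ?thesis by simp
    next
      case nz: False
      hence "degree F' \<noteq> degree F" using 0 leading_coeff_0_iff by metis
      thus ?thesis using less.hyps F'J le by simp
    qed
    then obtain k where "dvd_in (polys_over A) G (smult (?c ^ k) F')" by blast
    moreover have "dvd_in (polys_over A) G (G * smult (?c ^ k) M)"
      using smult_in_polys_over[OF powA M] unfolding dvd_in_def by blast
    ultimately have "dvd_in (polys_over A) G (smult (?c ^ k) F' + G * smult (?c ^ k) M)"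
      by (rule P.dvd_in_add)
    moreover have "smult (?c ^ k) F' + G * smult (?c ^ k) M = smult (?c ^ Suc k) F"
      by (simp add: F'_def smult_diff_right mult.commute)
    ultimately show ?thesis by metis
  qed
qed

text \<open>A nonzero member G of least degree divides the members of S up to powers of its leading
  coefficient, and \<open>gauss_descent\<close> trades these powers for the constant
  \<open>b\<close>. Since G and H have the same degree, the ideal contains a nonzero constant as
  soon as S has no nonconstant common factor.\<close>

lemma ideal_common_factor:
  assumes J: "J \<subseteq> polys_over A" "\<And>P Q. P \<in> J \<Longrightarrow> Q \<in> J \<Longrightarrow> P - Q \<in> J"
      "\<And>P Q. P \<in> J \<Longrightarrow> Q \<in> polys_over A \<Longrightarrow> P * Q \<in> J"
    and S: "finite S" "S \<subseteq> J" and nz: "\<exists>P\<in>J. P \<noteq> 0"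
  shows "\<exists>G\<in>J. \<exists>b\<in>A. \<exists>H\<in>polys_over A. G \<noteq> 0 \<and> b \<noteq> 0 \<and> G = smult b H \<and>
      (\<forall>F\<in>S. dvd_in (polys_over A) H F)"
proof -
  obtain G where G: "G \<in> J" "G \<noteq> 0" "\<And>P. P \<in> J \<Longrightarrow> P \<noteq> 0 \<Longrightarrow> degree G \<le> degree P"
    using ex_has_least_nat[of "\<lambda>P. P \<in> J \<and> P \<noteq> 0" _ degree] nz by metis
  let ?c = "lead_coeff G"
  have cA: "?c \<in> A" using G J(1) coeff_in by auto
  have powA: "?c ^ k \<in> A" for k by (induction k) (auto intro: cA)
  have "\<forall>F\<in>S. \<exists>k. dvd_in (polys_over A) G (smult (?c ^ k) F)"
    using ideal_least_degree[OF J G] S by blast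
  then obtain k where k: "\<And>F. F \<in> S \<Longrightarrow> dvd_in (polys_over A) G (smult (?c ^ k F) F)" by metis
  define K where "K = Max (insert 0 (k ` S))"
  have "dvd_in (polys_over A) G (smult (?c ^ K) F)" if F: "F \<in> S" for F
  proof -
    have "k F \<le> K" using S F by (auto simp: K_def)
    hence "smult (?c ^ K) F = smult (?c ^ k F) F * [:?c ^ (K - k F):]"
      by (simp flip: power_add)
    thus ?thesis using P.dvd_in_mult_right[OF k[OF F], of "[:?c ^ (K - k F):]"] powA const_in_polys_over
      by metis
  qed
  hence "\<exists>b\<in>A. \<exists>H\<in>polys_over A. G = smult b H \<and> (\<forall>F\<in>S. dvd_in (polys_over A) H F)"
    using G J S powA by (intro gauss_descent[of "?c ^ K"]) auto
  thus ?thesis using G by (metis smult_0_left)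
qed

text \<open>Q is a nonconstant divisor of P of least degree; a nonunit constant factor of Q would
  give a prime constant dividing P. If Q divides R1 * R2, the ideal generated by Q and R1 yields a
  common factor H of Q and R1. Either H is nonconstant, hence associate to Q by minimality, and Q
  divides R1; or H is constant and Q divides R2.\<close>

lemma polys_over_prime_factor:
  assumes P: "P \<in> polys_over A" "P \<noteq> 0" and prim: "\<And>q. prime_in A q \<Longrightarrow> \<not> dvd_in (polys_over A) [:q:] P"
    and deg: "degree P > 0"
  shows "\<exists>Q. prime_in (polys_over A) Q \<and> dvd_in (polys_over A) Q P"
proof -
  obtain Q where Q: "Q \<in> polys_over A" "dvd_in (polys_over A) Q P" "degree Q > 0"
    and Qmin: "\<And>R. R \<in> polys_over A \<Longrightarrow> dvd_in (polys_over A) R P \<Longrightarrow> degree R > 0 \<Longrightarrow> degree Q \<le> degree R"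
    using ex_has_least_nat[of "\<lambda>Q. Q \<in> polys_over A \<and> dvd_in (polys_over A) Q P \<and> degree Q > 0" P degree]
      P deg P.dvd_in_refl by metis
  have Q0: "Q \<noteq> 0" using Q by auto
  have unit: "dvd_in A b 1" if bA: "b \<in> A" and "H \<in> polys_over A" "Q = smult b H" for b H
  proof (rule ccontr)
    assume "\<not> dvd_in A b 1"
    moreover have "b \<noteq> 0" using that Q0 by auto
    ultimately obtain q where q: "prime_in A q" "dvd_in A q b"
      using bA size_0_unit[of b] size_pos_prime[of b] by blast
    have "dvd_in (polys_over A) [:q:] Q"
      using dvd_in_mult_right[OF q(2)] that coeff_in unfolding const_dvd_in_polys_over_iff by simp
    thus False using prim[OF q(1)] P.dvd_in_trans[OF _ Q(2)] by blast
  qed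
  have unit': "dvd_in (polys_over A) Q H" if H: "b \<in> A" "H \<in> polys_over A" "Q = smult b H" for b H
  proof -
    obtain c where c: "c \<in> A" "b * c = 1" using unit[OF H] by (metis dvd_in_def)
    have "H = Q * [:c:]" using H c by (simp add: mult.commute)
    thus ?thesis using c(1) const_in_polys_over unfolding dvd_in_def by blast
  qed
  have "dvd_in (polys_over A) Q R2"
    if R: "R1 \<in> polys_over A" "R2 \<in> polys_over A" "dvd_in (polys_over A) Q (R1 * R2)"
      "\<not> dvd_in (polys_over A) Q R1" for R1 R2
  proof -
    define J where "J = {Q * X + R1 * Y |X Y. X \<in> polys_over A \<and> Y \<in> polys_over A}"
    have J: "J \<subseteq> polys_over A" using Q R by (auto simp: J_def)
    have Jd: "X - Y \<in> J" if "X \<in> J" "Y \<in> J" for X Y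
    proof -
      obtain X1 X2 Y1 Y2 where *: "X1 \<in> polys_over A" "X2 \<in> polys_over A" "Y1 \<in> polys_over A"
        "Y2 \<in> polys_over A" "X = Q * X1 + R1 * X2" "Y = Q * Y1 + R1 * Y2"
        using \<open>X \<in> J\<close> \<open>Y \<in> J\<close> by (auto simp: J_def)
      have "X - Y = Q * (X1 - Y1) + R1 * (X2 - Y2)" using * by (simp add: algebra_simps)
      thus ?thesis using * unfolding J_def by blast
    qed
    have Jm: "X * Y \<in> J" if "X \<in> J" "Y \<in> polys_over A" for X Y
    proof -
      obtain X1 X2 where *: "X1 \<in> polys_over A" "X2 \<in> polys_over A" "X = Q * X1 + R1 * X2"
        using \<open>X \<in> J\<close> by (auto simp: J_def)
      have "X * Y = Q * (X1 * Y) + R1 * (X2 * Y)" using * by (simp add: algebra_simps)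
      thus ?thesis using * that unfolding J_def by blast
    qed
    have QJ: "Q \<in> J" unfolding J_def using P.zero_in P.one_in
      by (intro CollectI exI[of _ 1] exI[of _ 0]) auto
    have RJ: "R1 \<in> J" unfolding J_def using P.zero_in P.one_in
      by (intro CollectI exI[of _ 0] exI[of _ 1]) auto
    have "\<exists>G\<in>J. \<exists>b\<in>A. \<exists>H\<in>polys_over A. G \<noteq> 0 \<and> b \<noteq> 0 \<and> G = smult b H \<and>
        (\<forall>F\<in>{Q, R1}. dvd_in (polys_over A) H F)"
      by (rule ideal_common_factor[OF J Jd Jm]) (use QJ RJ Q0 in auto)
    then obtain G b H where G: "G \<in> J" "G \<noteq> 0" "b \<in> A" "H \<in> polys_over A" "b \<noteq> 0" "G = smult b H"
        and H: "\<forall>F\<in>{Q, R1}. dvd_in (polys_over A) H F"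
      by (elim bexE conjE)
    have HQ: "dvd_in (polys_over A) H Q" "dvd_in (polys_over A) H R1" using H by simp_all
    show ?thesis
    proof (cases "degree H = 0")
      case False
      hence le: "degree Q \<le> degree H" using Qmin[OF G(4) P.dvd_in_trans[OF HQ(1) Q(2)]] by simp
      obtain B where B: "B \<in> polys_over A" "Q = H * B" using HQ(1) by (auto simp: dvd_in_def)
      have "degree Q = degree H + degree B"
        using B Q0 degree_mult_eq by (metis mult_eq_0_iff)
      with le have "degree B = 0" by simp
      then obtain \<beta> where "B = [:\<beta>:]" by (meson degree_eq_zeroE)
      hence "dvd_in (polys_over A) Q H"
        using B G const_in_polys_over by (intro unit'[of \<beta>]) auto
      hence "dvd_in (polys_over A) Q R1" using P.dvd_in_trans[OF _ HQ(2)] by blast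
      thus ?thesis using R by blast
    next
      case True
      hence "degree G = 0" using G by simp
      then obtain g where g: "G = [:g:]" by (meson degree_eq_zeroE)
      have gA: "g \<in> A" "g \<noteq> 0" using G(1,2) J g const_in_polys_over by auto
      obtain X Y where XY: "X \<in> polys_over A" "Y \<in> polys_over A" "[:g:] = Q * X + R1 * Y"
        using G(1) g by (auto simp: J_def)
      \<comment> \<open>A Bezout identity up to the constant \<open>g\<close>, multiplied by R2;
        both summands are multiples of Q, and \<open>gauss_descent\<close> then disposes of
        \<open>g\<close>.\<close>
      have "smult g R2 = Q * (X * R2) + (R1 * R2) * Y"
        using arg_cong[OF XY(3), of "\<lambda>Z. Z * R2"] by (simp add: algebra_simps)
      moreover have "dvd_in (polys_over A) Q (Q * (X * R2))"
        using XY R unfolding dvd_in_def by blast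
      ultimately have "dvd_in (polys_over A) Q (smult g R2)"
        using P.dvd_in_add P.dvd_in_mult_right[OF R(3) XY(2)] by simp
      hence "\<exists>b\<in>A. \<exists>H\<in>polys_over A. Q = smult b H \<and> (\<forall>F\<in>{R2}. dvd_in (polys_over A) H F)"
        using gA Q R by (intro gauss_descent[of g]) auto
      then obtain b H where bH: "b \<in> A" "H \<in> polys_over A" "Q = smult b H" "dvd_in (polys_over A) H R2"
        by blast
      show ?thesis by (rule P.dvd_in_trans[OF unit'[OF bH(1-3)] bH(4)])
    qed
  qed
  moreover have "\<not> dvd_in (polys_over A) Q 1"
  proof
    assume "dvd_in (polys_over A) Q 1"
    then obtain R where R: "1 = Q * R" by (auto simp: dvd_in_def)
    hence "R \<noteq> 0" by auto
    hence "degree (Q * R) = degree Q + degree R" using Q0 degree_mult_eq by blast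
    thus False using R Q(3) by (metis add_is_0 degree_1 less_irrefl)
  qed
  ultimately have "prime_in (polys_over A) Q" using Q Q0 unfolding prime_in_def by blast
  thus ?thesis using Q by blast
qed

text \<open>Degree plus size of the leading coefficient is additive over a domain and vanishes
  exactly at the constant units. It may exceed the number of prime factors, as for the prime x^2 + 1
  over the integers, which gets size 2.\<close>

lemma polys_over_factorial:
  "factorial_subring (polys_over A) (\<lambda>P. degree P + \<mu> (lead_coeff P))"
proof
  fix P Q assume PQ: "P \<in> polys_over A" "Q \<in> polys_over A" "P \<noteq> 0" "Q \<noteq> 0"
  thus "degree (P * Q) + \<mu> (lead_coeff (P * Q)) = degree P + \<mu> (lead_coeff P) + (degree Q + \<mu> (lead_coeff Q))"
    using size_mult[of "lead_coeff P" "lead_coeff Q"] coeff_in by (simp add: degree_mult_eq coeff_mult_degree_sum)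
next
  fix P assume P: "P \<in> polys_over A" "P \<noteq> 0" "degree P + \<mu> (lead_coeff P) = 0"
  then obtain a where a: "P = [:a:]" by (metis add_is_0 degree_eq_zeroE)
  hence "dvd_in A a 1" using P size_0_unit[of a] const_in_polys_over by auto
  then obtain c where "c \<in> A" "a * c = 1" by (metis dvd_in_def)
  thus "dvd_in (polys_over A) P 1"
    unfolding dvd_in_def a using const_in_polys_over by (intro bexI[of _ "[:c:]"]) (auto simp: one_pCons mult.commute)
next
  fix P assume P: "P \<in> polys_over A" "P \<noteq> 0" "degree P + \<mu> (lead_coeff P) \<noteq> 0"
  show "\<exists>Q. prime_in (polys_over A) Q \<and> dvd_in (polys_over A) Q P"
  proof (cases "\<exists>q. prime_in A q \<and> dvd_in (polys_over A) [:q:] P")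
    case True
    thus ?thesis using prime_in_polys_over by blast
  next
    case False
    have "degree P > 0"
    proof (rule ccontr)
      assume "\<not> degree P > 0"
      hence d0: "degree P = 0" by simp
      then obtain a where a: "P = [:a:]" by (meson degree_eq_zeroE)
      hence "a \<in> A" "a \<noteq> 0" "\<mu> a \<noteq> 0" using P d0 const_in_polys_over by auto
      then obtain q where "prime_in A q" "dvd_in A q a" using size_pos_prime by blast
      moreover have "dvd_in (polys_over A) [:q:] P"
        unfolding const_dvd_in_polys_over_iff a using \<open>dvd_in A q a\<close>
        by (auto simp: coeff_pCons split: nat.splits)
      ultimately show False using False by blast
    qed
    thus ?thesis using polys_over_prime_factor P False by blast
  qed
qed unfold_locales

end

text \<open>Injectivity is assumed on \<open>B\<close> only: the intended \<open>\<phi>\<close>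
  evaluates at \<open>Var s\<close>, and on polynomials over all of \<open>int_mpoly\<close> its
  kernel contains X - \<open>Var s\<close>.\<close>

lemma factorial_subring_image:
  fixes \<phi> :: "'r::idom \<Rightarrow> 's::idom"
  assumes "factorial_subring B \<mu>"
    and hom: "\<And>a b. \<phi> (a + b) = \<phi> a + \<phi> b" "\<And>a b. \<phi> (a * b) = \<phi> a * \<phi> b" "\<phi> 1 = 1"
    and inj: "inj_on \<phi> B"
  shows "factorial_subring (\<phi> ` B) (\<mu> \<circ> inv_into B \<phi>)"
proof -
  interpret factorial_subring B \<mu> by fact
  have 0: "\<phi> 0 = 0" using hom(1)[of 0 0] by (metis add.right_neutral add_left_cancel)
  have neg: "\<phi> (- a) = - \<phi> a" for a using hom(1)[of a "- a"] 0 by (simp add: eq_neg_iff_add_eq_0 add.commute)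
  have inv: "inv_into B \<phi> (\<phi> a) = a" if "a \<in> B" for a using inj that by simp
  have nz: "\<phi> a \<noteq> 0 \<longleftrightarrow> a \<noteq> 0" if "a \<in> B" for a using inj_onD[OF inj, of a 0] that 0 by auto
  have dvd: "dvd_in (\<phi> ` B) (\<phi> a) (\<phi> b) \<longleftrightarrow> dvd_in B a b" if "a \<in> B" "b \<in> B" for a b
    unfolding dvd_in_def using that inj_onD[OF inj] by (auto simp flip: hom(2))
  have dvd1: "dvd_in (\<phi> ` B) (\<phi> a) 1 \<longleftrightarrow> dvd_in B a 1" if "a \<in> B" for a
    using dvd[OF that one_in] hom(3) by simp
  have dvdm: "dvd_in (\<phi> ` B) (\<phi> a) (\<phi> b * \<phi> c) \<longleftrightarrow> dvd_in B a (b * c)" if "a \<in> B" "b \<in> B" "c \<in> B" for a b c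
    using dvd[of a "b * c"] that hom(2) by auto
  have prime: "prime_in (\<phi> ` B) (\<phi> q)" if "prime_in B q" for q
    using that nz unfolding prime_in_def by (auto simp: dvd dvd1 dvdm)
  show ?thesis
  proof
    show "0 \<in> \<phi> ` B" using 0 by (metis image_eqI zero_in)
    show "1 \<in> \<phi> ` B" using hom(3) by (metis image_eqI one_in)
  next
    fix a b assume "a \<in> \<phi> ` B" "b \<in> \<phi> ` B"
    thus "a + b \<in> \<phi> ` B" "a * b \<in> \<phi> ` B" using hom by (auto simp flip: hom(1,2))
  next
    fix a assume "a \<in> \<phi> ` B"
    thus "- a \<in> \<phi> ` B" by (auto simp flip: neg)
  next
    fix a b assume "a \<in> \<phi> ` B" "b \<in> \<phi> ` B" "a \<noteq> 0" "b \<noteq> 0"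
    then obtain a' b' where "a' \<in> B" "b' \<in> B" "a = \<phi> a'" "b = \<phi> b'" "a' \<noteq> 0" "b' \<noteq> 0" using 0 by auto
    thus "(\<mu> \<circ> inv_into B \<phi>) (a * b) = (\<mu> \<circ> inv_into B \<phi>) a + (\<mu> \<circ> inv_into B \<phi>) b"
      using inv[OF mult_in[of a' b']] by (auto simp: inv size_mult simp flip: hom(2))
  next
    fix a assume "a \<in> \<phi> ` B" "a \<noteq> 0" "(\<mu> \<circ> inv_into B \<phi>) a = 0"
    then obtain a' where "a' \<in> B" "a = \<phi> a'" "a' \<noteq> 0" "\<mu> a' = 0" using 0 by (force simp: inv)
    thus "dvd_in (\<phi> ` B) a 1" using size_0_unit by (auto simp: dvd1)
  next
    fix a assume "a \<in> \<phi> ` B" "a \<noteq> 0" "(\<mu> \<circ> inv_into B \<phi>) a \<noteq> 0"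
    then obtain a' where a: "a' \<in> B" "a = \<phi> a'" "a' \<noteq> 0" "\<mu> a' \<noteq> 0" using 0 by (force simp: inv)
    then obtain q where q: "prime_in B q" "dvd_in B q a'" using size_pos_prime by blast
    moreover have "q \<in> B" using q by (simp add: prime_in_def)
    ultimately show "\<exists>q. prime_in (\<phi> ` B) q \<and> dvd_in (\<phi> ` B) q a"
      using prime dvd a by blast
  qed
qed

lemma int_factorial: "factorial_subring (UNIV :: int set) (\<lambda>a. size (prime_factorization a))"
proof
  fix a :: int
  have dvd: "dvd_in (UNIV :: int set) = (dvd)" by (auto simp: dvd_in_def dvd_def fun_eq_iff)
  { assume a: "a \<noteq> 0" "size (prime_factorization a) = 0"
    thus "dvd_in UNIV a 1" by (auto simp: dvd prime_factorization_empty_iff) }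
  { assume a: "a \<noteq> 0" "size (prime_factorization a) \<noteq> 0"
    then obtain q where "prime q" "q dvd a"
      by (auto simp: prime_factorization_empty_iff intro: prime_divisorE)
    thus "\<exists>q. prime_in UNIV q \<and> dvd_in UNIV q a"
      unfolding dvd prime_in_def
      by (intro exI[of _ q]) (auto simp: prime_dvd_mult_iff not_prime_unit) }
qed (auto simp: prime_factorization_mult)

section \<open>Integer polynomials in several variables\<close>

lemma poly_mapping_eq_sum_single:
  "f = (\<Sum>\<alpha>\<in>Poly_Mapping.keys f. Poly_Mapping.single \<alpha> (Poly_Mapping.lookup f \<alpha>))"
  by (rule poly_mapping_eqI) (auto simp: lookup_sum lookup_single when_def in_keys_iff)

lemma eval_int_superset:
  assumes "finite S" "Poly_Mapping.keys f \<subseteq> S"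
  shows "eval_int f x = (\<Sum>\<alpha>\<in>S. Poly_Mapping.lookup f \<alpha> * (\<Prod>j\<in>Poly_Mapping.keys \<alpha>. x j ^ Poly_Mapping.lookup \<alpha> j))"
  unfolding eval_int_def by (rule sum.mono_neutral_left) (use assms in \<open>auto simp: in_keys_iff\<close>)

lemma eval_int_0 [simp]: "eval_int 0 x = 0"
  by (simp add: eval_int_def)

lemma eval_int_add [simp]: "eval_int (f + g) x = eval_int f x + eval_int g x"
proof -
  let ?S = "Poly_Mapping.keys f \<union> Poly_Mapping.keys g"
  have "Poly_Mapping.keys (f + g) \<subseteq> ?S" by (rule keys_add)
  thus ?thesis
    by (subst (1 2 3) eval_int_superset[of ?S]) (auto simp: lookup_add algebra_simps sum.distrib)
qed

lemma eval_int_sum: "eval_int (\<Sum>i\<in>I. f i) x = (\<Sum>i\<in>I. eval_int (f i) x)"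
  by (induction I rule: infinite_finite_induct) auto

lemma eval_int_uminus [simp]: "eval_int (- f) x = - eval_int f x"
  using eval_int_add[of f "- f" x] by (simp del: eval_int_add)

lemma eval_int_diff [simp]: "eval_int (f - g) x = eval_int f x - eval_int g x"
  using eval_int_add[of f "- g" x] by (simp del: eval_int_add)

lemma eval_int_single:
  "eval_int (Poly_Mapping.single \<alpha> c) x = c * (\<Prod>j\<in>Poly_Mapping.keys \<alpha>. x j ^ Poly_Mapping.lookup \<alpha> j)"
  by (subst eval_int_superset[of "{\<alpha>}"]) auto

lemma monomial_eval_add:
  fixes x :: "nat \<Rightarrow> int"
  shows "(\<Prod>j\<in>Poly_Mapping.keys (\<alpha> + \<beta>). x j ^ Poly_Mapping.lookup (\<alpha> + \<beta>) j) =
    (\<Prod>j\<in>Poly_Mapping.keys \<alpha>. x j ^ Poly_Mapping.lookup \<alpha> j) *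
    (\<Prod>j\<in>Poly_Mapping.keys \<beta>. x j ^ Poly_Mapping.lookup \<beta> j)"
proof -
  let ?S = "Poly_Mapping.keys \<alpha> \<union> Poly_Mapping.keys \<beta>"
  have sup: "(\<Prod>j\<in>Poly_Mapping.keys \<gamma>. x j ^ Poly_Mapping.lookup \<gamma> j) = (\<Prod>j\<in>?S. x j ^ Poly_Mapping.lookup \<gamma> j)"
    if "Poly_Mapping.keys \<gamma> \<subseteq> ?S" for \<gamma>
    by (rule prod.mono_neutral_left) (use that in \<open>auto simp: in_keys_iff\<close>)
  show ?thesis
    by (subst (1 2 3) sup) (use keys_add[of \<alpha> \<beta>] in \<open>auto simp: lookup_add power_add prod.distrib\<close>)
qed

lemma eval_int_mult [simp]: "eval_int (f * g) x = eval_int f x * eval_int g x"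
proof -
  have "f * g = (\<Sum>\<alpha>\<in>Poly_Mapping.keys f. \<Sum>\<beta>\<in>Poly_Mapping.keys g.
      Poly_Mapping.single (\<alpha> + \<beta>) (Poly_Mapping.lookup f \<alpha> * Poly_Mapping.lookup g \<beta>))"
    by (subst poly_mapping_eq_sum_single[of f], subst poly_mapping_eq_sum_single[of g])
       (simp add: sum_product mult_single)
  hence "eval_int (f * g) x = (\<Sum>\<alpha>\<in>Poly_Mapping.keys f. \<Sum>\<beta>\<in>Poly_Mapping.keys g.
      eval_int (Poly_Mapping.single (\<alpha> + \<beta>) (Poly_Mapping.lookup f \<alpha> * Poly_Mapping.lookup g \<beta>)) x)"
    by (simp only: eval_int_sum)
  also have "\<dots> = eval_int f x * eval_int g x"
    by (simp add: eval_int_single monomial_eval_add eval_int_def[of f] eval_int_def[of g] sum_product mult_ac)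
  finally show ?thesis .
qed

lemma eval_int_cong:
  assumes "f \<in> int_polys s" "\<And>j. j < s \<Longrightarrow> x j = y j"
  shows "eval_int f x = eval_int f y"
  unfolding eval_int_def using assms
  by (intro sum.cong prod.cong arg_cong2[of _ _ _ _ "(*)"] refl arg_cong2[of _ _ _ _ "(^)"])
     (auto simp: int_polys_def)

lemma eval_int_cong_mod:
  assumes "f \<in> int_polys s" "\<And>j. j < s \<Longrightarrow> x j mod q = y j mod q"
  shows "eval_int f x mod q = eval_int f y mod q"
proof -
  have mon: "(\<Prod>j\<in>Poly_Mapping.keys \<alpha>. x j ^ Poly_Mapping.lookup \<alpha> j) mod q =
      (\<Prod>j\<in>Poly_Mapping.keys \<alpha>. y j ^ Poly_Mapping.lookup \<alpha> j) mod q"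
    if "\<alpha> \<in> Poly_Mapping.keys f" for \<alpha>
  proof -
    have "(\<Prod>j\<in>Poly_Mapping.keys \<alpha>. x j ^ Poly_Mapping.lookup \<alpha> j mod q) =
        (\<Prod>j\<in>Poly_Mapping.keys \<alpha>. y j ^ Poly_Mapping.lookup \<alpha> j mod q)"
    proof (rule prod.cong[OF refl])
      fix j assume "j \<in> Poly_Mapping.keys \<alpha>"
      hence "x j mod q = y j mod q" using assms that by (auto simp: int_polys_def)
      thus "x j ^ Poly_Mapping.lookup \<alpha> j mod q = y j ^ Poly_Mapping.lookup \<alpha> j mod q"
        by (metis power_mod)
    qed
    thus ?thesis
      by (rule trans[OF mod_prod_eq[symmetric] trans[OF arg_cong[of _ _ "\<lambda>z. z mod q"] mod_prod_eq]])
  qed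
  have "(\<Sum>\<alpha>\<in>Poly_Mapping.keys f. Poly_Mapping.lookup f \<alpha> * (\<Prod>j\<in>Poly_Mapping.keys \<alpha>. x j ^ Poly_Mapping.lookup \<alpha> j) mod q) =
      (\<Sum>\<alpha>\<in>Poly_Mapping.keys f. Poly_Mapping.lookup f \<alpha> * (\<Prod>j\<in>Poly_Mapping.keys \<alpha>. y j ^ Poly_Mapping.lookup \<alpha> j) mod q)"
    using mon by (intro sum.cong refl mod_mult_cong)
  thus ?thesis unfolding eval_int_def
    by (rule trans[OF mod_sum_eq[symmetric] trans[OF arg_cong[of _ _ "\<lambda>z. z mod q"] mod_sum_eq]])
qed

lemma eval_int_bound:
  "\<exists>C k. \<forall>n\<ge>1. \<forall>x. (\<forall>j. \<bar>x j\<bar> \<le> int n) \<longrightarrow> \<bar>eval_int f x\<bar> \<le> int C * int n ^ k"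
proof -
  define k where "k = total_degree f"
  define C where "C = nat (\<Sum>\<alpha>\<in>Poly_Mapping.keys f. \<bar>Poly_Mapping.lookup f \<alpha>\<bar>)"
  have "\<bar>eval_int f x\<bar> \<le> int C * int n ^ k" if n: "n \<ge> 1" and x: "\<And>j. \<bar>x j\<bar> \<le> int n" for n x
  proof -
    have "\<bar>eval_int f x\<bar> \<le> (\<Sum>\<alpha>\<in>Poly_Mapping.keys f. \<bar>Poly_Mapping.lookup f \<alpha>\<bar> * int n ^ k)"
      unfolding eval_int_def
    proof (rule order.trans[OF sum_abs], rule sum_mono)
      fix \<alpha> assume \<alpha>: "\<alpha> \<in> Poly_Mapping.keys f"
      have "\<bar>\<Prod>j\<in>Poly_Mapping.keys \<alpha>. x j ^ Poly_Mapping.lookup \<alpha> j\<bar> \<le>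
          (\<Prod>j\<in>Poly_Mapping.keys \<alpha>. int n ^ Poly_Mapping.lookup \<alpha> j)"
        unfolding abs_prod power_abs by (intro prod_mono) (auto intro: power_mono x)
      also have "\<dots> = int n ^ monom_degree \<alpha>"
        by (simp add: monom_degree_def power_sum)
      also have "\<dots> \<le> int n ^ k"
        using n \<alpha> by (intro power_increasing) (auto simp: k_def total_degree_def)
      finally show "\<bar>Poly_Mapping.lookup f \<alpha> * (\<Prod>j\<in>Poly_Mapping.keys \<alpha>. x j ^ Poly_Mapping.lookup \<alpha> j)\<bar>
          \<le> \<bar>Poly_Mapping.lookup f \<alpha>\<bar> * int n ^ k"
        by (simp add: abs_mult mult_left_mono)
    qed
    also have "\<dots> = int C * int n ^ k"
      by (simp add: C_def sum_nonneg flip: sum_distrib_right)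
    finally show ?thesis .
  qed
  thus ?thesis by blast
qed

lemma subring_int_polys: "subring_of_idom (int_polys s)"
proof
  fix f g assume "f \<in> int_polys s" "g \<in> int_polys s"
  note fg = this
  show "f + g \<in> int_polys s" using fg keys_add[of f g] unfolding int_polys_def by blast
  show "f * g \<in> int_polys s" unfolding int_polys_def
  proof (intro CollectI ballI)
    fix \<gamma> assume "\<gamma> \<in> Poly_Mapping.keys (f * g)"
    then obtain \<alpha> \<beta> where "\<gamma> = \<alpha> + \<beta>" "\<alpha> \<in> Poly_Mapping.keys f" "\<beta> \<in> Poly_Mapping.keys g"
      using keys_mult[of f g] by blast
    thus "Poly_Mapping.keys \<gamma> \<subseteq> {..<s}"
      using fg keys_add[of \<alpha> \<beta>] unfolding int_polys_def by blast
  qed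
qed (auto simp: int_polys_def)

section \<open>The last variable: Z[x_0, ..., x_s] as polynomials over Z[x_0, ..., x_{s-1}]\<close>

definition Var :: "nat \<Rightarrow> int_mpoly" where
  "Var s = Poly_Mapping.single (Poly_Mapping.single s 1) 1"

lemma Var_power: "Var s ^ k = Poly_Mapping.single (Poly_Mapping.single s k) 1"
  by (induction k) (auto simp: Var_def mult_single simp flip: single_add single_one)

lemma eval_int_Var [simp]: "eval_int (Var s) x = x s"
  by (simp add: Var_def eval_int_single)

lemma Var_in: "Var s \<in> int_polys (Suc s)"
  by (auto simp: Var_def int_polys_def)

lemma int_polys_mono: "s \<le> t \<Longrightarrow> int_polys s \<subseteq> int_polys t"
  by (force simp: int_polys_def)

text \<open>Coefficients in the first s variables leave the exponent of \<open>Var s\<close>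
  untouched, so different powers of \<open>Var s\<close> cannot interfere. This gives injectivity of
  the evaluation and later exhibits a nonconstant monomial of a common factor.\<close>

lemma lookup_poly_Var:
  assumes P: "P \<in> polys_over (int_polys s)" and \<beta>: "s \<notin> Poly_Mapping.keys \<beta>"
  shows "Poly_Mapping.lookup (poly P (Var s)) (\<beta> + Poly_Mapping.single s k) = Poly_Mapping.lookup (coeff P k) \<beta>"
proof -
  let ?\<delta> = "\<beta> + Poly_Mapping.single s k"
  have mono: "Poly_Mapping.lookup (coeff P i * Var s ^ i) ?\<delta> = (if i = k then Poly_Mapping.lookup (coeff P k) \<beta> else 0)" for i
  proof -
    let ?c = "coeff P i"
    have "?c * Var s ^ i = (\<Sum>\<alpha>\<in>Poly_Mapping.keys ?c. Poly_Mapping.single (\<alpha> + Poly_Mapping.single s i) (Poly_Mapping.lookup ?c \<alpha>))"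
      by (subst poly_mapping_eq_sum_single[of ?c]) (simp add: Var_power sum_distrib_right mult_single)
    hence "Poly_Mapping.lookup (?c * Var s ^ i) ?\<delta> =
       (\<Sum>\<alpha>\<in>Poly_Mapping.keys ?c. (Poly_Mapping.lookup ?c \<alpha> when \<alpha> + Poly_Mapping.single s i = ?\<delta>))"
      by (simp add: lookup_sum lookup_single)
    also have "\<dots> = (\<Sum>\<alpha>\<in>Poly_Mapping.keys ?c. if i = k \<and> \<alpha> = \<beta> then Poly_Mapping.lookup ?c \<beta> else 0)"
    proof (rule sum.cong[OF refl])
      fix \<alpha> assume "\<alpha> \<in> Poly_Mapping.keys ?c"
      moreover have "?c \<in> int_polys s" using P by (simp add: polys_over_def)
      ultimately have "s \<notin> Poly_Mapping.keys \<alpha>" by (auto simp: int_polys_def)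
      hence "Poly_Mapping.lookup (\<alpha> + Poly_Mapping.single s i) s = i" "Poly_Mapping.lookup ?\<delta> s = k"
        using \<beta> by (simp_all add: lookup_add in_keys_iff)
      hence "\<alpha> + Poly_Mapping.single s i = ?\<delta> \<Longrightarrow> i = k" by metis
      hence "\<alpha> + Poly_Mapping.single s i = ?\<delta> \<longleftrightarrow> i = k \<and> \<alpha> = \<beta>" by auto
      thus "(Poly_Mapping.lookup ?c \<alpha> when \<alpha> + Poly_Mapping.single s i = ?\<delta>) =
          (if i = k \<and> \<alpha> = \<beta> then Poly_Mapping.lookup ?c \<beta> else 0)"
        by (simp add: when_def)
    qed
    also have "\<dots> = (if i = k then Poly_Mapping.lookup (coeff P k) \<beta> else 0)"
      by (auto simp: in_keys_iff)
    finally show ?thesis .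
  qed
  have "Poly_Mapping.lookup (poly P (Var s)) ?\<delta> =
      (\<Sum>i\<le>degree P. if i = k then Poly_Mapping.lookup (coeff P k) \<beta> else 0)"
    by (simp add: poly_altdef lookup_sum mono)
  also have "\<dots> = Poly_Mapping.lookup (coeff P k) \<beta>"
    by (auto simp: coeff_eq_0)
  finally show ?thesis .
qed

lemma inj_on_poly_Var: "inj_on (\<lambda>P. poly P (Var s)) (polys_over (int_polys s))"
proof (rule inj_onI)
  fix P Q assume PQ: "P \<in> polys_over (int_polys s)" "Q \<in> polys_over (int_polys s)"
    "poly P (Var s) = poly Q (Var s)"
  have "coeff P k = coeff Q k" for k
  proof (rule poly_mapping_eqI)
    fix \<beta>
    show "Poly_Mapping.lookup (coeff P k) \<beta> = Poly_Mapping.lookup (coeff Q k) \<beta>"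
    proof (cases "s \<in> Poly_Mapping.keys \<beta>")
      case True
      hence "\<beta> \<notin> Poly_Mapping.keys (coeff P k)" "\<beta> \<notin> Poly_Mapping.keys (coeff Q k)"
        using PQ unfolding polys_over_def int_polys_def by blast+
      thus ?thesis by (simp add: in_keys_iff)
    next
      case False
      thus ?thesis using lookup_poly_Var PQ by metis
    qed
  qed
  thus "P = Q" by (rule poly_eqI)
qed

text \<open>Together with \<open>inj_on_poly_Var\<close> this identifies
  \<open>int_polys (Suc s)\<close> with the univariate polynomials over \<open>int_polys s\<close>;
  the inductions on \<open>s\<close> pass through this bijection.\<close>

lemma poly_Var_image: "(\<lambda>P. poly P (Var s)) ` polys_over (int_polys s) = int_polys (Suc s)"
proof
  interpret subring_of_idom "int_polys (Suc s)" by (rule subring_int_polys)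
  have pow: "Var s ^ k \<in> int_polys (Suc s)" for k
    by (induction k) (auto intro: Var_in)
  show "(\<lambda>P. poly P (Var s)) ` polys_over (int_polys s) \<subseteq> int_polys (Suc s)"
  proof clarify
    fix P assume "P \<in> polys_over (int_polys s)"
    hence "coeff P k \<in> int_polys (Suc s)" for k
      using int_polys_mono[of s "Suc s"] by (auto simp: polys_over_def)
    thus "poly P (Var s) \<in> int_polys (Suc s)"
      unfolding poly_altdef using pow by (intro sum_in mult_in)
  qed
next
  interpret R: subring_of_idom "int_polys s" by (rule subring_int_polys)
  interpret P: subring_of_idom "polys_over (int_polys s)" by (rule R.polys_over_subring)
  show "int_polys (Suc s) \<subseteq> (\<lambda>P. poly P (Var s)) ` polys_over (int_polys s)"
  proof
    fix f assume f: "f \<in> int_polys (Suc s)"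
    define Q where "Q = (\<Sum>\<alpha>\<in>Poly_Mapping.keys f.
      monom (Poly_Mapping.single (\<alpha> - Poly_Mapping.single s (Poly_Mapping.lookup \<alpha> s)) (Poly_Mapping.lookup f \<alpha>)) (Poly_Mapping.lookup \<alpha> s))"
    have split: "\<alpha> - Poly_Mapping.single s (Poly_Mapping.lookup \<alpha> s) + Poly_Mapping.single s (Poly_Mapping.lookup \<alpha> s) = \<alpha>" for \<alpha> :: "nat \<Rightarrow>\<^sub>0 nat"
      by (rule poly_mapping_eqI) (auto simp: lookup_add lookup_minus lookup_single when_def)
    have "poly Q (Var s) = (\<Sum>\<alpha>\<in>Poly_Mapping.keys f. Poly_Mapping.single \<alpha> (Poly_Mapping.lookup f \<alpha>))"
      by (simp add: Q_def poly_sum poly_monom Var_power mult_single split)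
    hence "poly Q (Var s) = f" using poly_mapping_eq_sum_single by metis
    moreover have "Q \<in> polys_over (int_polys s)"
      unfolding Q_def
    proof (intro P.sum_in R.monom_in_polys_over)
      fix \<alpha> assume "\<alpha> \<in> Poly_Mapping.keys f"
      hence "Poly_Mapping.keys \<alpha> \<subseteq> {..<Suc s}" using f by (auto simp: int_polys_def)
      hence "Poly_Mapping.keys (\<alpha> - Poly_Mapping.single s (Poly_Mapping.lookup \<alpha> s)) \<subseteq> {..<s}"
        unfolding subset_iff by (auto simp: in_keys_iff lookup_minus lookup_single when_def split: if_splits)
           (metis less_Suc_eq)
      thus "Poly_Mapping.single (\<alpha> - Poly_Mapping.single s (Poly_Mapping.lookup \<alpha> s)) (Poly_Mapping.lookup f \<alpha>) \<in> int_polys s"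
        by (auto simp: int_polys_def)
    qed
    ultimately show "f \<in> (\<lambda>P. poly P (Var s)) ` polys_over (int_polys s)" by blast
  qed
qed

lemma int_polys_0: "int_polys 0 = range (Poly_Mapping.single 0)"
proof
  show "int_polys 0 \<subseteq> range (Poly_Mapping.single 0)"
  proof
    fix f assume "f \<in> int_polys 0"
    hence "Poly_Mapping.keys f \<subseteq> {0}" by (auto simp: int_polys_def)
    hence "f = Poly_Mapping.single 0 (Poly_Mapping.lookup f 0)"
      by (intro poly_mapping_eqI) (auto simp: lookup_single when_def in_keys_iff)
    thus "f \<in> range (Poly_Mapping.single 0)" by blast
  qed
qed (auto simp: int_polys_def split: if_splits)

lemma int_polys_factorial: "\<exists>\<mu>. factorial_subring (int_polys s) \<mu>"
proof (induction s)
  case 0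
  have "factorial_subring (range (Poly_Mapping.single 0 :: int \<Rightarrow> int_mpoly))
      ((\<lambda>a. size (prime_factorization a)) \<circ> inv_into UNIV (Poly_Mapping.single 0))"
    by (rule factorial_subring_image[OF int_factorial]) (auto simp: single_add mult_single)
  thus ?case unfolding int_polys_0 by blast
next
  case (Suc s)
  then obtain \<mu> where "factorial_subring (int_polys s) \<mu>" by blast
  from factorial_subring_image[OF factorial_subring.polys_over_factorial[OF this], of "\<lambda>P. poly P (Var s)"]
  show ?case using inj_on_poly_Var by (auto simp: poly_Var_image)
qed

lemma eval_int_poly_Var:
  "eval_int (poly P (Var s)) x = poly (map_poly (\<lambda>c. eval_int c x) P) (x s)"
  by (induction P) (auto simp: map_poly_pCons)

text \<open>A set, because the induction on the number of variables replaces the polynomials by all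
  their coefficients in the last variable, a family of another size that may contain 0. Constants
  may be common factors, so for \<open>s = 0\<close> every set qualifies.\<close>

definition coprime_family :: "nat \<Rightarrow> int_mpoly set \<Rightarrow> bool" where
  "coprime_family s F \<longleftrightarrow>
     \<not> (\<exists>h\<in>int_polys s. total_degree h > 0 \<and> (\<forall>f\<in>F. dvd_in (int_polys s) h f))"

lemma total_degree_pos:
  assumes "\<alpha> \<in> Poly_Mapping.keys f" "\<alpha> \<noteq> 0"
  shows "total_degree f > 0"
proof -
  obtain j where "j \<in> Poly_Mapping.keys \<alpha>" using assms(2) by (metis all_not_in_conv keys_eq_empty)
  hence "0 < Poly_Mapping.lookup \<alpha> j" "Poly_Mapping.lookup \<alpha> j \<le> monom_degree \<alpha>"
    unfolding monom_degree_def by (auto simp: in_keys_iff intro: member_le_sum)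
  moreover have "monom_degree \<alpha> \<le> total_degree f"
    using assms(1) unfolding total_degree_def by (intro Max_ge) auto
  ultimately show ?thesis by linarith
qed

text \<open>A least-degree member G = b H of a suitable ideal has H as a common factor of the
  family; coprimality makes H, hence G, constant in the last variable, and this constant is
  \<open>R\<close>.\<close>

lemma coprime_family_eliminate:
  assumes F: "finite F" "F \<subseteq> int_polys (Suc s)" "\<exists>f\<in>F. f \<noteq> 0" and cop: "coprime_family (Suc s) F"
  shows "\<exists>R\<in>int_polys s. R \<noteq> 0 \<and>
    (\<forall>x d. (\<forall>f\<in>F. d dvd eval_int f x) \<longrightarrow> d dvd eval_int R x)"
proof -
  define \<phi> where "\<phi> = (\<lambda>P. poly P (Var s))"
  let ?B = "polys_over (int_polys s)"
  obtain \<mu> where "factorial_subring (int_polys s) \<mu>" using int_polys_factorial by blast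
  then interpret factorial_subring "int_polys s" \<mu> .
  interpret P: subring_of_idom ?B by (rule polys_over_subring)
  have im: "\<phi> ` ?B = int_polys (Suc s)" unfolding \<phi>_def by (rule poly_Var_image)
  define S where "S = inv_into ?B \<phi> ` F"
  have inv: "inv_into ?B \<phi> f \<in> ?B" "\<phi> (inv_into ?B \<phi> f) = f" if "f \<in> F" for f
    using inv_into_into[of f \<phi> ?B] f_inv_into_f[of f \<phi> ?B] F(2) im that by auto
  have S: "finite S" "S \<subseteq> ?B" "\<phi> ` S = F"
    unfolding S_def using F(1) inv by (auto simp: image_image)
  \<comment> \<open>This ideal contains the one generated by S. Membership is itself the property
    wanted of \<open>R\<close>, so no explicit combination of the members of F has to be written
    down.\<close>
  define J where "J = {P \<in> ?B. \<forall>x d. (\<forall>f\<in>F. d dvd eval_int f x) \<longrightarrow> d dvd eval_int (\<phi> P) x}"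
  have "S \<subseteq> J" using S by (auto simp: J_def)
  moreover have "\<exists>P\<in>J. P \<noteq> 0" 
  proof -
    obtain f where "f \<in> F" "f \<noteq> 0" using F(3) by blast
    then obtain P where "P \<in> S" "\<phi> P \<noteq> 0" using S(3) by blast
    thus ?thesis using \<open>S \<subseteq> J\<close> by (auto simp: \<phi>_def intro!: bexI[of _ P])
  qed
  ultimately have "\<exists>G\<in>J. \<exists>b\<in>int_polys s. \<exists>H\<in>?B. G \<noteq> 0 \<and> b \<noteq> 0 \<and> G = smult b H \<and>
      (\<forall>P\<in>S. dvd_in ?B H P)"
    using S(1) by (intro ideal_common_factor) (auto simp: J_def \<phi>_def P.mult_in P.diff_in)
  then obtain G b H where G: "G \<in> J" "b \<in> int_polys s" "H \<in> ?B" "G \<noteq> 0" "b \<noteq> 0" "G = smult b H"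
    and H: "\<forall>P\<in>S. dvd_in ?B H P"
    by (elim bexE conjE)
  \<comment> \<open>A positive degree in the last variable would give \<open>\<phi> H\<close> a
    nonconstant monomial, making it a forbidden common factor of F.\<close>
  have "degree H = 0"
  proof (rule ccontr)
    assume d: "degree H \<noteq> 0"
    hence "lead_coeff H \<noteq> 0" by auto
    then obtain \<beta> where \<beta>: "\<beta> \<in> Poly_Mapping.keys (lead_coeff H)"
      by (metis all_not_in_conv keys_eq_empty)
    have "lead_coeff H \<in> int_polys s" using G coeff_in by blast
    hence "s \<notin> Poly_Mapping.keys \<beta>" using \<beta> by (auto simp: int_polys_def)
    hence "\<beta> + Poly_Mapping.single s (degree H) \<in> Poly_Mapping.keys (\<phi> H)"
      using lookup_poly_Var[OF G(3), of \<beta> "degree H"] \<beta> by (simp add: in_keys_iff \<phi>_def)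
    moreover have "\<beta> + Poly_Mapping.single s (degree H) \<noteq> 0"
      using d by (metis add_is_0 lookup_add lookup_single_eq lookup_zero)
    ultimately have "total_degree (\<phi> H) > 0" by (rule total_degree_pos)
    moreover have "dvd_in (int_polys (Suc s)) (\<phi> H) f" if "f \<in> F" for f
    proof -
      obtain P where "P \<in> S" "f = \<phi> P" using S \<open>f \<in> F\<close> by auto
      then obtain Q where "Q \<in> ?B" "f = \<phi> H * \<phi> Q" using H by (auto simp: dvd_in_def \<phi>_def)
      thus ?thesis using im by (auto simp: dvd_in_def)
    qed
    moreover have "\<phi> H \<in> int_polys (Suc s)" using im G by blast
    ultimately show False using cop unfolding coprime_family_def by blast
  qed
  hence "degree G = 0" using G by simp
  then obtain R where R: "G = [:R:]" by (meson degree_eq_zeroE)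
  thus ?thesis using G(1,4) const_in_polys_over by (intro bexI[of _ R]) (auto simp: J_def \<phi>_def)
qed

text \<open>A factor common to all coefficients divides the polynomials themselves, so the
  hypothesis of the induction on \<open>s\<close> is inherited by the coefficient family.\<close>

lemma coprime_family_coeffs:
  assumes S: "S \<subseteq> polys_over (int_polys s)"
    and cop: "coprime_family (Suc s) ((\<lambda>P. poly P (Var s)) ` S)"
  shows "coprime_family s (\<Union>P\<in>S. range (coeff P))"
  unfolding coprime_family_def
proof clarify
  fix h assume h: "h \<in> int_polys s" "total_degree h > 0"
    "\<forall>c\<in>\<Union>P\<in>S. range (coeff P). dvd_in (int_polys s) h c"
  interpret subring_of_idom "int_polys s" by (rule subring_int_polys)
  have "dvd_in (int_polys (Suc s)) h (poly P (Var s))" if P: "P \<in> S" for P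
  proof -
    have "dvd_in (polys_over (int_polys s)) [:h:] P"
      unfolding const_dvd_in_polys_over_iff using h(3) P by blast
    then obtain Q where "Q \<in> polys_over (int_polys s)" "P = smult h Q" by (auto simp: dvd_in_def)
    thus ?thesis using poly_Var_image[of s] by (auto simp: dvd_in_def)
  qed
  moreover have "h \<in> int_polys (Suc s)" using h int_polys_mono[of s "Suc s"] by auto
  ultimately show False using cop h(2) unfolding coprime_family_def by blast
qed

section \<open>Zeros modulo prime powers\<close>

abbreviation (input) cube :: "nat \<Rightarrow> nat \<Rightarrow> (nat \<Rightarrow> int) set" where
  "cube s n \<equiv> {..<s} \<rightarrow>\<^sub>E {1..int n}"

lemma finite_cube: "finite (cube s n)"
  by (intro finite_PiE) auto

lemma card_cube: "card (cube s n) = n ^ s"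
  by (simp add: card_PiE)

lemma finite_interval_filter: "finite {t \<in> {1..int n}. Q t}"
  by (rule finite_subset[of _ "{1..int n}"]) auto

lemma card_cube_Suc:
  "card {x \<in> cube (Suc s) n. Q x} = (\<Sum>x\<in>cube s n. card {t \<in> {1..int n}. Q (x(s := t))})"
proof -
  let ?S = "Sigma (cube s n) (\<lambda>x. {t \<in> {1..int n}. Q (x(s := t))})"
  have ins: "cube (Suc s) n = (\<lambda>(y, g). g(s := y)) ` ({1..int n} \<times> cube s n)"
    using PiE_insert_eq[of s "{..<s}" "\<lambda>_. {1..int n}"] by (simp add: lessThan_Suc)
  have inj: "inj_on (\<lambda>(g, y). g(s := y)) (cube s n \<times> {1..int n})"
    using inj_combinator[of s "{..<s}" "\<lambda>_. {1..int n}"] by (auto simp: inj_on_def)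
  have "{x \<in> cube (Suc s) n. Q x} = (\<lambda>(g, y). g(s := y)) ` ?S"
    unfolding ins by auto
  hence "card {x \<in> cube (Suc s) n. Q x} = card ?S"
    by (simp only:) (rule card_image, rule inj_on_subset[OF inj], auto)
  also have "\<dots> = (\<Sum>x\<in>cube s n. card {t \<in> {1..int n}. Q (x(s := t))})"
    by (intro card_SigmaI finite_cube ballI finite_interval_filter)
  finally show ?thesis .
qed

lemma card_residue_class:
  fixes q :: nat and r :: int
  assumes "q > 0"
  shows "\<bar>real (card {t \<in> {1..int n}. int q dvd t - r}) - n / q\<bar> \<le> 1"
proof -
  \<comment> \<open>The largest k with r + k q at most 0 and at most n, respectively; the class in
    question is r + k q for l < k \<le> u.\<close>
  define l u where "l = (- r) div int q" and "u = (int n - r) div int q"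
  have div: "k \<le> a div int q \<longleftrightarrow> k * int q \<le> a" for k a :: int
  proof -
    have "k \<le> a div int q \<longleftrightarrow> real_of_int k \<le> real_of_int a / real_of_int (int q)"
      by (metis floor_divide_of_int_eq le_floor_iff)
    also have "\<dots> \<longleftrightarrow> real_of_int (k * int q) \<le> real_of_int a"
      using assms by (simp add: field_simps)
    finally show ?thesis by linarith
  qed
  have "{t \<in> {1..int n}. int q dvd t - r} = (\<lambda>k. r + k * int q) ` {l+1..u}"
  proof (intro Set.set_eqI iffI)
    fix t assume t: "t \<in> {t \<in> {1..int n}. int q dvd t - r}"
    then obtain k where "t - r = int q * k" by (auto elim: dvdE)
    hence k: "t = r + k * int q" by (simp add: algebra_simps)
    have "\<not> k \<le> l" "k \<le> u" using t k unfolding l_def u_def div by auto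
    thus "t \<in> (\<lambda>k. r + k * int q) ` {l+1..u}" using k by auto
  next
    fix t assume "t \<in> (\<lambda>k. r + k * int q) ` {l+1..u}"
    then obtain k where k: "t = r + k * int q" "\<not> k \<le> l" "k \<le> u" by fastforce
    thus "t \<in> {t \<in> {1..int n}. int q dvd t - r}" unfolding l_def u_def div by auto
  qed
  hence "card {t \<in> {1..int n}. int q dvd t - r} = nat (u - l)"
    using assms by (simp add: card_image inj_on_def)
  moreover have "l \<le> u" unfolding l_def u_def using assms by (intro zdiv_mono1) auto
  ultimately have card: "real (card {t \<in> {1..int n}. int q dvd t - r}) = real_of_int u - real_of_int l"
    by simp
  have fl: "real_of_int (a div int q) \<le> real_of_int a / q" "real_of_int a / q < real_of_int (a div int q) + 1" for a
    using floor_correct[of "real_of_int a / real_of_int (int q)"] unfolding floor_divide_of_int_eq by auto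
  have "real_of_int (int n - r) / q = n / q + real_of_int (- r) / q"
    by (simp add: diff_divide_distrib)
  thus ?thesis
    using fl[of "- r"] fl[of "int n - r"] unfolding card l_def u_def by linarith
qed

section \<open>Roots modulo prime powers, in one and in several variables\<close>

lemma prime_power_dvd_mult_cancel:
  fixes p :: nat and x y :: int
  assumes "prime p" "int p ^ (a + b) dvd x * y" "\<not> int p ^ Suc a dvd x"
  shows "int p ^ b dvd y"
proof -
  have "prime_elem (int p)" using assms(1) by simp
  then obtain i j where ij: "i + j = a + b" "int p ^ i dvd x" "int p ^ j dvd y"
    using prime_elem_power_dvd_prod[OF assms(2)] by blast
  hence "i < Suc a" using assms(3) power_le_dvd[of "int p" i x "Suc a"] by (meson not_le)
  hence "b \<le> j" using ij by simp
  thus ?thesis using ij power_le_dvd by blast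
qed

text \<open>Let q1 be the quotient of q by X - t0 for one solution t0. Every solution t makes (t -
  t0) q1(t) divisible by \<open>p ^ (e + Suc d * L)\<close>, so \<open>p ^ Suc L\<close> divides t -
  t0 or \<open>p ^ (e + d * L)\<close> divides q1(t). Each degree costs one residue class and L in
  the exponent. For e = 1 and L = 0 this is Lagrange's bound of d classes modulo p.\<close>

lemma card_roots_mod_prime_power:
  fixes q :: "int poly" and p :: nat
  assumes "prime p" "degree q \<le> d" "\<not> int p ^ e dvd coeff q k"
  shows "real (card {t \<in> {1..int n}. int p ^ (e + d * L) dvd poly q t}) \<le> d * (n / p ^ Suc L + 1)"
  using assms(2,3)
proof (induction d arbitrary: q k)
  case 0
  then obtain c where c: "q = [:c:]" by (metis degree_eq_zeroE le_zero_eq)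
  hence "\<not> int p ^ e dvd c" using 0 by (cases k) auto
  thus ?case using c by simp
next
  case (Suc d)
  let ?Z = "{t \<in> {1..int n}. int p ^ (e + Suc d * L) dvd poly q t}"
  show ?case
  proof (cases "?Z = {}")
    case True
    thus ?thesis by (simp only: card.empty) simp
  next
    case False
    then obtain t0 where t0: "int p ^ (e + Suc d * L) dvd poly q t0" by blast
    define q1 where "q1 = synthetic_div q t0"
    have q1: "q = [:- t0, 1:] * q1 + [:poly q t0:]"
      unfolding q1_def by (rule synthetic_div_correct'[symmetric])
    have "degree q1 \<le> d" unfolding q1_def using Suc.prems by (simp add: degree_synthetic_div)
    \<comment> \<open>The remainder q(t0) is divisible by p^e, so if q1 were too, all of q would
      be.\<close>
    moreover have "\<exists>k. \<not> int p ^ e dvd coeff q1 k"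
    proof (rule ccontr)
      assume "\<not> ?thesis"
      hence "[:int p ^ e:] dvd q1" by (simp add: const_poly_dvd_iff)
      moreover have "int p ^ e dvd poly q t0" using t0 power_le_dvd[of "int p" _ "poly q t0" e] by simp
      hence "[:int p ^ e:] dvd [:poly q t0:]" by (simp add: const_poly_dvd_const_poly_iff)
      ultimately have "[:int p ^ e:] dvd q" using q1 by (metis dvd_add dvd_mult)
      thus False using Suc.prems(2) by (simp add: const_poly_dvd_iff)
    qed
    then obtain k' where "\<not> int p ^ e dvd coeff q1 k'" by blast
    ultimately have IH: "real (card {t \<in> {1..int n}. int p ^ (e + d * L) dvd poly q1 t}) \<le> d * (n / p ^ Suc L + 1)"
      by (rule Suc.IH)
    let ?A = "{t \<in> {1..int n}. int (p ^ Suc L) dvd t - t0}"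
    let ?B = "{t \<in> {1..int n}. int p ^ (e + d * L) dvd poly q1 t}"
    have "?Z \<subseteq> ?A \<union> ?B"
    proof
      fix t assume t: "t \<in> ?Z"
      have "poly q t = (t - t0) * poly q1 t + poly q t0"
        using arg_cong[OF q1, of "\<lambda>q. poly q t"] by (simp add: algebra_simps)
      hence "int p ^ (e + Suc d * L) dvd (t - t0) * poly q1 t"
        using t t0 dvd_diff[of "int p ^ (e + Suc d * L)" "poly q t" "poly q t0"] by auto
      hence "int p ^ (L + (e + d * L)) dvd (t - t0) * poly q1 t" by (simp add: algebra_simps)
      hence "int p ^ Suc L dvd t - t0 \<or> int p ^ (e + d * L) dvd poly q1 t"
        using prime_power_dvd_mult_cancel[OF assms(1)] by blast
      thus "t \<in> ?A \<union> ?B" using t by auto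
    qed
    hence "card ?Z \<le> card (?A \<union> ?B)" by (intro card_mono finite_UnI finite_interval_filter)
    also have "\<dots> \<le> card ?A + card ?B" by (rule card_Un_le)
    finally have "real (card ?Z) \<le> real (card ?A) + real (card ?B)" by linarith
    moreover have "real (card ?A) \<le> n / p ^ Suc L + 1"
      using card_residue_class[of "p ^ Suc L" n t0] prime_gt_0_nat[OF assms(1)] by (simp add: abs_le_iff)
    ultimately have "real (card ?Z) \<le> (n / p ^ Suc L + 1) + d * (n / p ^ Suc L + 1)" using IH by linarith
    also have "\<dots> = real (Suc d) * (n / p ^ Suc L + 1)" by (simp add: algebra_simps add_divide_distrib)
    finally show ?thesis .
  qed
qed

lemma eval_int_poly_Var_upd:
  assumes "P \<in> polys_over (int_polys s)"
  shows "eval_int (poly P (Var s)) (x(s := t)) = poly (map_poly (\<lambda>c. eval_int c x) P) t"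
proof -
  have "eval_int (coeff P k) (x(s := t)) = eval_int (coeff P k) x" for k
    by (rule eval_int_cong[of _ s]) (use assms in \<open>auto simp: polys_over_def\<close>)
  hence "map_poly (\<lambda>c. eval_int c (x(s := t))) P = map_poly (\<lambda>c. eval_int c x) P"
    by (intro poly_eqI) (simp add: coeff_map_poly)
  thus ?thesis by (simp add: eval_int_poly_Var)
qed

text \<open>
  A Schwartz--Zippel bound modulo prime powers. Both sides carry a factor \<open>n\<close> so that \<open>s = 0\<close> is
  not an exception.
\<close>

lemma card_zeros_mod_prime_power:
  assumes "f \<in> int_polys s" "f \<noteq> 0"
  shows "\<exists>D. \<exists>a::int. a \<noteq> 0 \<and> (\<forall>p K L n. prime p \<longrightarrow> \<not> int p ^ K dvd a \<longrightarrow>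
     real n * card {x \<in> cube s n. int p ^ (K + D * L) dvd eval_int f x} \<le> D * (n / p ^ Suc L + 1) * n ^ s)"
  using assms
proof (induction s arbitrary: f)
  case 0
  then obtain a where a: "f = Poly_Mapping.single 0 a" by (auto simp: int_polys_0)
  moreover have "a \<noteq> 0" using a 0 by auto
  ultimately show ?case by (intro exI[of _ 0] exI[of _ a]) (auto simp: eval_int_single)
next
  case (Suc s)
  have "f \<in> (\<lambda>P. poly P (Var s)) ` polys_over (int_polys s)" using Suc.prems by (simp add: poly_Var_image)
  then obtain P where P: "P \<in> polys_over (int_polys s)" "f = poly P (Var s)" by blast
  \<comment> \<open>Passing to leading coefficients again and again ends in the integer
    \<open>a\<close>, while \<open>D\<close> adds up the degrees met on the way; neither depends on
    p, K, L or n.\<close>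
  define c where "c = lead_coeff P"
  have "P \<noteq> 0" using P Suc.prems by auto
  hence "c \<in> int_polys s" "c \<noteq> 0" using P by (auto simp: c_def polys_over_def)
  from Suc.IH[OF this] obtain D a where a: "a \<noteq> 0" and IH: "\<forall>p K L n. prime p \<longrightarrow> \<not> int p ^ K dvd a \<longrightarrow>
     real n * card {x \<in> cube s n. int p ^ (K + D * L) dvd eval_int c x} \<le> D * (n / p ^ Suc L + 1) * n ^ s"
    by (elim exE conjE)
  define d where "d = degree P"
  have "real n * card {x \<in> cube (Suc s) n. int p ^ (K + (D + d) * L) dvd eval_int f x}
      \<le> (D + d) * (n / p ^ Suc L + 1) * n ^ Suc s" if p: "prime p" "\<not> int p ^ K dvd a" for p K L n
  proof -
    \<comment> \<open>Over these points the whole fibre of n values is counted. Elsewhere the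
      specialised polynomial has a coefficient not divisible by \<open>p ^ e\<close> with
      \<open>e = K + D * L\<close>, and the univariate bound spends the remaining d * L.\<close>
    let ?bad = "{x \<in> cube s n. int p ^ (K + D * L) dvd eval_int c x}"
    let ?T = "\<lambda>x. {t \<in> {1..int n}. int p ^ (K + (D + d) * L) dvd eval_int f (x(s := t))}"
    let ?\<beta> = "n / p ^ Suc L + 1"
    have le: "real (card (?T x)) \<le> (if x \<in> ?bad then real n else 0) + d * ?\<beta>" if x: "x \<in> cube s n" for x
    proof (cases "x \<in> ?bad")
      case True
      have "card (?T x) \<le> card {1..int n}" by (intro card_mono) auto
      thus ?thesis using True by (simp add: add_increasing2)
    next
      case False
      define q where "q = map_poly (\<lambda>c. eval_int c x) P"
      have "degree q \<le> d" unfolding q_def d_def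
        by (rule degree_le) (simp add: coeff_map_poly coeff_eq_0)
      moreover have "\<not> int p ^ (K + D * L) dvd coeff q d"
        using False x by (simp add: q_def coeff_map_poly d_def c_def)
      ultimately have "real (card {t \<in> {1..int n}. int p ^ (K + D * L + d * L) dvd poly q t}) \<le> d * ?\<beta>"
        by (rule card_roots_mod_prime_power[OF p(1)])
      thus ?thesis using False by (simp add: P(2) eval_int_poly_Var_upd[OF P(1)] q_def algebra_simps)
    qed
    have "real (card {x \<in> cube (Suc s) n. int p ^ (K + (D + d) * L) dvd eval_int f x}) = (\<Sum>x\<in>cube s n. real (card (?T x)))"
      by (subst card_cube_Suc) simp
    also have "\<dots> \<le> (\<Sum>x\<in>cube s n. (if x \<in> ?bad then real n else 0) + d * ?\<beta>)"
      by (intro sum_mono le)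
    also have "\<dots> = real n * card ?bad + n ^ s * (d * ?\<beta>)"
    proof -
      have "cube s n \<inter> {x. x \<in> ?bad} = ?bad" by blast
      hence "(\<Sum>x\<in>cube s n. if x \<in> ?bad then real n else 0) = real n * card ?bad"
        by (subst sum.inter_restrict[symmetric]) (auto simp: finite_cube)
      thus ?thesis by (simp add: sum.distrib card_cube)
    qed
    also have "\<dots> \<le> D * ?\<beta> * n ^ s + n ^ s * (d * ?\<beta>)"
      using IH[rule_format, OF p, of n L] by simp
    also have "\<dots> = (D + d) * ?\<beta> * n ^ s" by (simp add: algebra_simps add_divide_distrib)
    finally have "real n * card {x \<in> cube (Suc s) n. int p ^ (K + (D + d) * L) dvd eval_int f x}
       \<le> real n * ((D + d) * ?\<beta> * n ^ s)" by (intro mult_left_mono) auto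
    thus ?thesis by (simp add: algebra_simps)
  qed
  thus ?case using a by blast
qed

section \<open>Large common prime divisors\<close>

lemma prod_dvd_of_pairwise_coprime:
  fixes m :: "'i \<Rightarrow> 'a::semiring_gcd"
  assumes "finite A" "\<And>i j. i \<in> A \<Longrightarrow> j \<in> A \<Longrightarrow> i \<noteq> j \<Longrightarrow> coprime (m i) (m j)"
    "\<And>i. i \<in> A \<Longrightarrow> m i dvd x"
  shows "prod m A dvd x"
  using assms
proof (induction A rule: finite_induct)
  case (insert i A)
  have "coprime (m i) (prod m A)" using insert by (intro prod_coprime_right) auto
  moreover have "prod m A dvd x" using insert by auto
  ultimately show ?case using insert by (simp add: divides_mult)
qed simp

text \<open>The product of these primes divides r and is at least n to their number, while n \<ge> 2
  absorbs the constant: C n^k \<le> 2^C n^k \<le> n^(C + k). The bound does not depend on n.\<close>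

lemma card_large_prime_divisors:
  fixes r :: int
  assumes "r \<noteq> 0" "\<bar>r\<bar> \<le> int C * int n ^ k" "n \<ge> 2"
  shows "finite {p. prime p \<and> p > n \<and> int p dvd r}" "card {p. prime p \<and> p > n \<and> int p dvd r} \<le> C + k"
proof -
  let ?T = "{p. prime p \<and> p > n \<and> int p dvd r}"
  define N where "N = nat \<bar>r\<bar>"
  have N: "N > 0" "N \<le> C * n ^ k"
    using assms(1,2) unfolding N_def by (auto simp: nat_le_iff)
  have dvd: "int p dvd r \<longleftrightarrow> p dvd N" for p unfolding N_def by (metis dvd_abs_iff int_dvd_int_iff nat_0_le abs_ge_zero)
  have "?T \<subseteq> {..N}" using N by (auto simp: dvd dest: dvd_imp_le)
  thus fin: "finite ?T" by (rule finite_subset) auto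
  have "(\<Prod>p\<in>?T. p) dvd N"
    using fin by (rule prod_dvd_of_pairwise_coprime) (auto simp: dvd primes_coprime)
  hence "(\<Prod>p\<in>?T. p) \<le> N" using N(1) by (rule dvd_imp_le)
  moreover have "n ^ card ?T \<le> (\<Prod>p\<in>?T. p)"
    using prod_mono[of ?T "\<lambda>_. n" "\<lambda>p. p"] by simp
  moreover have "C * n ^ k \<le> n ^ (C + k)"
  proof -
    have "C \<le> 2 ^ C" by (simp add: less_imp_le)
    also have "\<dots> \<le> n ^ C" using assms(3) by (intro power_mono) auto
    finally show ?thesis by (simp add: power_add)
  qed
  ultimately have "n ^ card ?T \<le> n ^ (C + k)" using N(2) by linarith
  thus "card ?T \<le> C + k" using assms(3) by (simp add: power_increasing_iff)
qed

text \<open>Telescoping with 1/(n+1)^2 \<le> 1/n - 1/(n+1).\<close>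

lemma sum_inverse_squares_tail:
  fixes M n :: nat
  assumes "M > 0"
  shows "(\<Sum>k\<in>{M<..n}. 1 / real k ^ 2) \<le> 1 / M"
proof -
  have "(\<Sum>k\<in>{M<..n}. 1 / real k ^ 2) \<le> 1 / M - 1 / n" if "M \<le> n"
    using that
  proof (induction n rule: dec_induct)
    case (step n)
    have ins: "{M<..Suc n} = insert (Suc n) {M<..n}" using step by auto
    have n: "n > 0" using step assms by simp
    hence "1 / real (Suc n) ^ 2 \<le> 1 / (real n * real (Suc n))"
      by (intro frac_le) (auto simp: power2_eq_square)
    also have "\<dots> = 1 / n - 1 / Suc n" using n by (simp add: field_simps)
    finally have "1 / real (Suc n) ^ 2 \<le> 1 / n - 1 / Suc n" .
    thus ?case using step unfolding ins by simp
  qed simp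
  thus ?thesis by (cases "M \<le> n") (force simp: order.trans)+
qed

text \<open>Four sources share \<open>\<epsilon>\<close> equally: points where a large prime divides
  all coefficients, zeros of \<open>R\<close>, primes M < p \<le> n, and primes p > n.\<close>

lemma large_prime_tail:
  fixes \<epsilon> :: real
  assumes "finite F" "F \<subseteq> int_polys s" "\<exists>f\<in>F. f \<noteq> 0" "coprime_family s F" "\<epsilon> > 0"
  shows "\<exists>M n0. \<forall>n\<ge>n0. real (card {x \<in> cube s n. \<exists>p>M. prime p \<and> (\<forall>f\<in>F. int p dvd eval_int f x)})
     \<le> \<epsilon> * n ^ s"
  using assms
proof (induction s arbitrary: F \<epsilon>)
  case 0
  then obtain f where f: "f \<in> F" "f \<noteq> 0" by blast
  then obtain a where a: "f = Poly_Mapping.single 0 a" using 0 by (auto simp: int_polys_0)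
  hence "a \<noteq> 0" using f by auto
  have "\<not> int p dvd eval_int f x" if "p > nat \<bar>a\<bar>" for p x
    using \<open>a \<noteq> 0\<close> that dvd_imp_le_int[of a "int p"] by (auto simp: a eval_int_single)
  hence "{x \<in> cube 0 n. \<exists>p>nat \<bar>a\<bar>. prime p \<and> (\<forall>f\<in>F. int p dvd eval_int f x)} = {}" for n
    using f by blast
  thus ?case using \<open>\<epsilon> > 0\<close> by (intro exI[of _ "nat \<bar>a\<bar>"] exI[of _ 0]) (simp only: card.empty, simp)
next
  case (Suc s)
  define B where "B = polys_over (int_polys s)"
  define \<phi> where "\<phi> = (\<lambda>P. poly P (Var s))"
  have im: "\<phi> ` B = int_polys (Suc s)" unfolding \<phi>_def B_def by (rule poly_Var_image)
  define S where "S = inv_into B \<phi> ` F"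
  have inv: "inv_into B \<phi> f \<in> B" "\<phi> (inv_into B \<phi> f) = f" if "f \<in> F" for f
    using inv_into_into[of f \<phi> B] f_inv_into_f[of f \<phi> B] Suc.prems(2) im that by auto
  have S: "finite S" "S \<subseteq> B" "\<phi> ` S = F"
    unfolding S_def using Suc.prems(1) inv by (auto simp: image_image)
  define Cf where "Cf = (\<Union>P\<in>S. range (coeff P))"
  have Cf: "finite Cf" "Cf \<subseteq> int_polys s"
    unfolding Cf_def using S(1,2) by (auto simp: B_def polys_over_def) (simp add: range_coeff)
  have Cf_nz: "\<exists>c\<in>Cf. c \<noteq> 0"
  proof -
    obtain P where P: "P \<in> S" "\<phi> P \<noteq> 0" using Suc.prems(3) S(3) by blast
    hence "lead_coeff P \<noteq> 0" by (auto simp: \<phi>_def)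
    thus ?thesis using P unfolding Cf_def by blast
  qed
  have Cf_cop: "coprime_family s Cf"
    unfolding Cf_def using S Suc.prems(4) by (intro coprime_family_coeffs) (auto simp: B_def \<phi>_def)
  obtain R where R: "R \<in> int_polys s" "R \<noteq> 0"
      "\<And>x d. (\<And>f. f \<in> F \<Longrightarrow> d dvd eval_int f x) \<Longrightarrow> d dvd eval_int R x"
    using coprime_family_eliminate[OF Suc.prems(1-4)] by blast
  obtain M1 n1 where IH: "\<forall>n\<ge>n1.
      real (card {x \<in> cube s n. \<exists>p>M1. prime p \<and> (\<forall>c\<in>Cf. int p dvd eval_int c x)}) \<le> \<epsilon> / 4 * real n ^ s"
    using Suc.IH[OF Cf Cf_nz Cf_cop, of "\<epsilon> / 4"] Suc.prems(5) by auto
  from card_zeros_mod_prime_power[OF R(1,2)] obtain D a where a: "a \<noteq> 0"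
    and D: "\<forall>p K L n. prime p \<longrightarrow> \<not> int p ^ K dvd a \<longrightarrow>
     real n * card {x \<in> cube s n. int p ^ (K + D * L) dvd eval_int R x} \<le> D * (n / p ^ Suc L + 1) * real n ^ s"
    by (elim exE conjE)
  \<comment> \<open>The case K = 1, L = 0; a prime beyond |a| cannot divide
    \<open>a\<close>.\<close>
  have DR: "real n * card {x \<in> cube s n. int p dvd eval_int R x} \<le> D * (n / p + 1) * real n ^ s"
    if "prime p" "p > nat \<bar>a\<bar>" for p n
  proof -
    have "\<not> int p ^ 1 dvd a" using that a dvd_imp_le_int[of a "int p"] by auto
    thus ?thesis using D[rule_format, of p 1 n 0] that by simp
  qed
  obtain C k where bound: "\<And>n x. n \<ge> 1 \<Longrightarrow> (\<And>j. \<bar>x j\<bar> \<le> int n) \<Longrightarrow> \<bar>eval_int R x\<bar> \<le> int C * int n ^ k"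
    using eval_int_bound[of R] by blast
  define d where "d = Max (insert 0 (degree ` S))"
  have d: "degree P \<le> d" if "P \<in> S" for P using that S(1) unfolding d_def by (intro Max_ge) auto
  \<comment> \<open>Primes above M are within reach of the induction hypothesis and of
    \<open>DR\<close>. The last summand makes 4 d D / M at most \<open>\<epsilon> / 4\<close>, the
    share of the primes M < p \<le> n.\<close>
  define M where "M = M1 + nat \<bar>a\<bar> + 1 + nat \<lceil>16 * d * D / \<epsilon>\<rceil>"
  have M: "M1 \<le> M" "nat \<bar>a\<bar> \<le> M" "M > 0" "16 * d * D / \<epsilon> \<le> M"
    unfolding M_def by linarith+
  \<comment> \<open>The two quotients give 2 D \<le> (\<open>\<epsilon>\<close> / 4) n for the zeros
    of \<open>R\<close> and 2 d (C + k) \<le> (\<open>\<epsilon>\<close> / 4) n for the primes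
    beyond n.\<close>
  define n0 where "n0 = n1 + 2 + nat \<lceil>8 * D / \<epsilon>\<rceil> + nat \<lceil>8 * (d * (C + k)) / \<epsilon>\<rceil>"
  have "real (card {x \<in> cube (Suc s) n. \<exists>p>M. prime p \<and> (\<forall>f\<in>F. int p dvd eval_int f x)})
     \<le> \<epsilon> * n ^ Suc s" if "n \<ge> n0" for n
  proof -
    have n: "n \<ge> n1" "n \<ge> 2" "8 * D / \<epsilon> \<le> n" "8 * (d * (C + k)) / \<epsilon> \<le> n"
      using \<open>n \<ge> n0\<close> unfolding n0_def by linarith+
    define bad where "bad = {x \<in> cube s n. \<exists>p>M1. prime p \<and> (\<forall>c\<in>Cf. int p dvd eval_int c x)}"
    define zero where "zero = {x \<in> cube s n. eval_int R x = 0}"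
    define pr where "pr = {p. prime p \<and> M < p \<and> p \<le> n}"
    define T where "T = (\<lambda>x. {t \<in> {1..int n}. \<exists>p>M. prime p \<and> (\<forall>f\<in>F. int p dvd eval_int f (x(s := t)))})"
    define Z where "Z = (\<lambda>x p. {t \<in> {1..int n}. \<forall>f\<in>F. int p dvd eval_int f (x(s := t))})"
    have finpr: "finite pr" unfolding pr_def by (rule finite_subset[of _ "{..n}"]) auto
    have cardZ: "real (card (Z x p)) \<le> d * (n / p + 1)"
      if x: "x \<in> cube s n" "x \<notin> bad" and p: "prime p" "p > M" for x p
    proof -
      have "p > M1" using p M by simp
      then obtain c where c: "c \<in> Cf" "\<not> int p dvd eval_int c x" using x p by (auto simp: bad_def)
      then obtain P j where P: "P \<in> S" "c = coeff P j" by (auto simp: Cf_def)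
      define q where "q = map_poly (\<lambda>c. eval_int c x) P"
      have "degree q \<le> d" unfolding q_def
        by (rule order.trans[OF _ d[OF P(1)]], rule degree_le) (simp add: coeff_map_poly coeff_eq_0)
      moreover have "\<not> int p ^ 1 dvd coeff q j" using c P by (simp add: q_def coeff_map_poly)
      ultimately have "real (card {t \<in> {1..int n}. int p ^ (1 + d * 0) dvd poly q t}) \<le> d * (n / p ^ Suc 0 + 1)"
        by (rule card_roots_mod_prime_power[OF p(1)])
      moreover have "Z x p \<subseteq> {t \<in> {1..int n}. int p ^ (1 + d * 0) dvd poly q t}"
      proof
        fix t assume t: "t \<in> Z x p"
        have "\<phi> P \<in> F" using P S by blast
        hence "int p dvd eval_int (\<phi> P) (x(s := t))" using t by (auto simp: Z_def)
        moreover have "eval_int (\<phi> P) (x(s := t)) = poly q t"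
          unfolding \<phi>_def q_def using P S by (intro eval_int_poly_Var_upd) (auto simp: B_def)
        ultimately show "t \<in> {t \<in> {1..int n}. int p ^ (1 + d * 0) dvd poly q t}"
          using t by (simp add: Z_def)
      qed
      hence "card (Z x p) \<le> card {t \<in> {1..int n}. int p ^ (1 + d * 0) dvd poly q t}"
        by (intro card_mono finite_interval_filter)
      ultimately show ?thesis by simp
    qed
    \<comment> \<open>Fibres over \<open>bad\<close> and \<open>zero\<close> are counted in full.
      Elsewhere every relevant prime divides R(x): those up to n contribute \<open>cardZ\<close>
      each, and there are at most C + k beyond n, each with at most 2 d values because n/p <
      1.\<close>
    have cardT: "real (card (T x)) \<le> (if x \<in> bad then real n else 0) + (if x \<in> zero then real n else 0)
        + (\<Sum>p\<in>pr. if int p dvd eval_int R x then d * (n / p + 1) else 0) + (real C + real k) * (2 * real d)"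
      if x: "x \<in> cube s n" for x
    proof (cases "x \<in> bad \<or> x \<in> zero")
      case True
      have "card (T x) \<le> card {1..int n}" unfolding T_def by (intro card_mono) auto
      hence "real (card (T x)) \<le> (if x \<in> bad then real n else 0) + (if x \<in> zero then real n else 0)"
        using True by auto
      moreover have "0 \<le> (\<Sum>p\<in>pr. if int p dvd eval_int R x then d * (n / p + 1) else 0)"
        by (intro sum_nonneg) auto
      moreover have "0 \<le> (real C + real k) * (2 * real d)" by simp
      ultimately show ?thesis by linarith
    next
      case False
      \<comment> \<open>\<open>bound\<close> speaks of all coordinates, but x is
        \<open>undefined\<close> from s on; \<open>R\<close> does not see the change.\<close>
      define y where "y = (\<lambda>j. if j < s then x j else 0)"
      have "\<bar>y j\<bar> \<le> int n" for j 
      proof (cases "j < s")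
        case True
        hence "x j \<in> {1..int n}" using PiE_mem[OF x, of j] by simp
        thus ?thesis using True by (simp add: y_def)
      qed (simp add: y_def)
      hence "\<bar>eval_int R y\<bar> \<le> int C * int n ^ k" using n by (intro bound) auto
      moreover have "eval_int R y = eval_int R x"
        by (rule eval_int_cong[OF R(1)]) (simp add: y_def)
      moreover have nz: "eval_int R x \<noteq> 0" using False x by (auto simp: zero_def)
      ultimately have Q: "finite {p. prime p \<and> p > n \<and> int p dvd eval_int R x}"
        "card {p. prime p \<and> p > n \<and> int p dvd eval_int R x} \<le> C + k"
        using card_large_prime_divisors[of "eval_int R x" C n k] n by auto
      define Q1 where "Q1 = {p \<in> pr. int p dvd eval_int R x}"
      define Q2 where "Q2 = {p. prime p \<and> p > n \<and> int p dvd eval_int R x} \<inter> {M<..}"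
      have Q2: "finite Q2" "card Q2 \<le> C + k"
        using Q card_mono[OF Q(1), of Q2] unfolding Q2_def by auto
      have Q1: "finite Q1" using finpr by (simp add: Q1_def)
      have "T x \<subseteq> (\<Union>p\<in>Q1. Z x p) \<union> (\<Union>p\<in>Q2. Z x p)"
      proof
        fix t assume t: "t \<in> T x"
        then obtain p where p: "p > M" "prime p" "\<forall>f\<in>F. int p dvd eval_int f (x(s := t))"
          by (auto simp: T_def)
        hence "int p dvd eval_int R (x(s := t))" by (intro R(3)) auto
        moreover have "eval_int R (x(s := t)) = eval_int R x" by (rule eval_int_cong[OF R(1)]) simp
        ultimately have "p \<in> Q1 \<union> Q2" using p by (auto simp: Q1_def Q2_def pr_def)
        thus "t \<in> (\<Union>p\<in>Q1. Z x p) \<union> (\<Union>p\<in>Q2. Z x p)" using t p by (auto simp: Z_def T_def)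
      qed
      hence "card (T x) \<le> card ((\<Union>p\<in>Q1. Z x p) \<union> (\<Union>p\<in>Q2. Z x p))"
        unfolding Z_def by (intro card_mono finite_UnI finite_UN_I Q1 Q2 finite_interval_filter)
      also have "\<dots> \<le> card (\<Union>p\<in>Q1. Z x p) + card (\<Union>p\<in>Q2. Z x p)" by (rule card_Un_le)
      also have "\<dots> \<le> (\<Sum>p\<in>Q1. card (Z x p)) + (\<Sum>p\<in>Q2. card (Z x p))"
        by (intro add_mono card_UN_le Q1 Q2)
      finally have "real (card (T x)) \<le> (\<Sum>p\<in>Q1. real (card (Z x p))) + (\<Sum>p\<in>Q2. real (card (Z x p)))"
        by (simp flip: of_nat_sum of_nat_add)
      also have "(\<Sum>p\<in>Q1. real (card (Z x p))) \<le> (\<Sum>p\<in>Q1. d * (n / p + 1))"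
        using x False by (intro sum_mono cardZ) (auto simp: Q1_def pr_def)
      also have "(\<Sum>p\<in>Q1. d * (n / p + 1)) = (\<Sum>p\<in>pr. if int p dvd eval_int R x then d * (n / p + 1) else 0)"
        unfolding Q1_def by (rule sum.inter_filter[OF finpr])
      also have "(\<Sum>p\<in>Q2. real (card (Z x p))) \<le> (\<Sum>p\<in>Q2. 2 * real d)"
      proof (rule sum_mono)
        fix p assume p: "p \<in> Q2"
        have "real (card (Z x p)) \<le> d * (n / p + 1)"
          using x False p by (intro cardZ) (auto simp: Q2_def)
        also have "\<dots> \<le> real d * (1 + 1)"
          using p by (intro mult_left_mono add_mono) (auto simp: Q2_def)
        finally show "real (card (Z x p)) \<le> 2 * real d" by simp
      qed
      also have "(\<Sum>p\<in>Q2. 2 * real d) = card Q2 * (2 * real d)" by simp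
      also have "\<dots> \<le> (real C + real k) * (2 * real d)" using Q2 by (intro mult_right_mono) auto
      finally show ?thesis using False by simp
    qed
    have npos: "real n > 0" using n by simp
    have "real (card {x \<in> cube (Suc s) n. \<exists>p>M. prime p \<and> (\<forall>f\<in>F. int p dvd eval_int f x)}) = (\<Sum>x\<in>cube s n. real (card (T x)))"
      unfolding T_def by (subst card_cube_Suc) simp
    also have "\<dots> \<le> (\<Sum>x\<in>cube s n. (if x \<in> bad then real n else 0) + (if x \<in> zero then real n else 0)
        + (\<Sum>p\<in>pr. if int p dvd eval_int R x then d * (n / p + 1) else 0) + (real C + real k) * (2 * real d))"
      by (intro sum_mono cardT)
    also have "\<dots> = (\<Sum>x\<in>cube s n. if x \<in> bad then real n else 0) + (\<Sum>x\<in>cube s n. if x \<in> zero then real n else 0)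
        + (\<Sum>p\<in>pr. \<Sum>x\<in>cube s n. if int p dvd eval_int R x then d * (n / p + 1) else 0)
        + real n ^ s * ((real C + real k) * (2 * real d))"
      by (simp add: sum.distrib card_cube sum.swap[of _ pr])
    also have "(\<Sum>x\<in>cube s n. if x \<in> bad then real n else 0) \<le> \<epsilon> / 4 * real n ^ s * n"
    proof -
      have "(\<Sum>x\<in>cube s n. if x \<in> bad then real n else 0) = card {x \<in> cube s n. x \<in> bad} * real n"
        by (simp add: sum.inter_filter[OF finite_cube, symmetric])
      also have "{x \<in> cube s n. x \<in> bad} = bad" by (auto simp: bad_def)
      finally show ?thesis using IH n npos unfolding bad_def by simp
    qed
    also have "(\<Sum>x\<in>cube s n. if x \<in> zero then real n else 0) \<le> \<epsilon> / 4 * real n ^ s * n"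
    proof -
      \<comment> \<open>Zero is divisible by every prime, so the bound for a single prime counts the
        zeros; beyond n the factor n/p + 1 is at most 2.\<close>
      obtain p where p: "prime p" "p > max n (nat \<bar>a\<bar>)" using bigger_prime by blast
      have "(\<Sum>x\<in>cube s n. if x \<in> zero then real n else 0) = card {x \<in> cube s n. x \<in> zero} * real n"
        by (simp add: sum.inter_filter[OF finite_cube, symmetric])
      also have "\<dots> \<le> card {x \<in> cube s n. int p dvd eval_int R x} * real n"
      proof (intro mult_right_mono of_nat_mono card_mono)
        show "finite {x \<in> cube s n. int p dvd eval_int R x}"
          by (rule finite_subset[OF _ finite_cube]) (rule Collect_restrict)
        show "{x \<in> cube s n. x \<in> zero} \<subseteq> {x \<in> cube s n. int p dvd eval_int R x}"
          unfolding zero_def by (intro Collect_mono) simp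
      qed simp
      also have "\<dots> \<le> D * (n / p + 1) * real n ^ s" using DR[of p n] p by (simp add: mult.commute)
      also have "\<dots> \<le> real D * (1 + 1) * real n ^ s"
        using p by (intro mult_right_mono mult_left_mono add_mono) auto
      also have "\<dots> \<le> (\<epsilon> / 4 * n) * real n ^ s"
        using n(3) Suc.prems(5) by (intro mult_right_mono) (auto simp: field_simps)
      finally show ?thesis by (simp add: mult_ac)
    qed
    also have "(\<Sum>p\<in>pr. \<Sum>x\<in>cube s n. if int p dvd eval_int R x then d * (n / p + 1) else 0) \<le> \<epsilon> / 4 * real n ^ s * n"
    proof -
      have "(\<Sum>x\<in>cube s n. if int p dvd eval_int R x then d * (n / p + 1) else 0)
          \<le> 4 * d * D * real n ^ s * n * (1 / real p ^ 2)" if p: "p \<in> pr" for p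
      proof -
        have p': "prime p" "p > nat \<bar>a\<bar>" "p \<le> n" "real p > 0" using p M prime_gt_0_nat by (auto simp: pr_def)
        let ?c = "real (card {x \<in> cube s n. int p dvd eval_int R x})"
        \<comment> \<open>For p \<le> n the error 1 is absorbed. The density of points with p
          dividing \<open>R\<close> is then at most 2 D / p and that of the last coordinate at most
          2 d / p, whence the summable 1 / p^2.\<close>
        have \<beta>: "n / p + 1 \<le> 2 * (n / p)" using p' by (simp add: field_simps)
        have "real n * ?c \<le> D * (n / p + 1) * real n ^ s" by (rule DR[OF p'(1,2)])
        also have "\<dots> \<le> D * (2 * (n / p)) * real n ^ s" using \<beta> by (intro mult_right_mono mult_left_mono) auto
        also have "\<dots> = real n * (D * (2 / p) * real n ^ s)" by simp
        finally have "?c \<le> D * (2 / p) * real n ^ s" using npos by (simp only: mult_le_cancel_left_pos)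
        have "(\<Sum>x\<in>cube s n. if int p dvd eval_int R x then d * (n / p + 1) else 0) = ?c * (d * (n / p + 1))"
          by (simp add: sum.inter_filter[OF finite_cube, symmetric])
        also have "\<dots> \<le> (D * (2 / p) * real n ^ s) * (d * (2 * (n / p)))"
          using \<beta> \<open>?c \<le> _\<close> by (intro mult_mono mult_left_mono) auto
        also have "\<dots> = 4 * d * D * real n ^ s * n * (1 / real p ^ 2)" using p' by (simp add: field_simps power2_eq_square)
        finally show ?thesis .
      qed
      hence "(\<Sum>p\<in>pr. \<Sum>x\<in>cube s n. if int p dvd eval_int R x then d * (n / p + 1) else 0)
          \<le> (\<Sum>p\<in>pr. 4 * d * D * real n ^ s * n * (1 / real p ^ 2))" by (rule sum_mono)
      also have "\<dots> = 4 * d * D * real n ^ s * n * (\<Sum>p\<in>pr. 1 / real p ^ 2)" by (rule sum_distrib_left[symmetric])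
      also have "\<dots> \<le> 4 * d * D * real n ^ s * n * (\<Sum>p\<in>{M<..n}. 1 / real p ^ 2)"
        by (intro mult_left_mono sum_mono2) (auto simp: pr_def)
      also have "\<dots> \<le> 4 * d * D * real n ^ s * n * (1 / M)"
        by (intro mult_left_mono sum_inverse_squares_tail M) auto
      also have "\<dots> = (4 * d * D / M) * (real n ^ s * n)" by simp
      also have "\<dots> \<le> (\<epsilon> / 4) * (real n ^ s * n)"
        using M(3,4) Suc.prems(5) by (intro mult_right_mono) (auto simp: field_simps)
      finally show ?thesis by (simp add: mult_ac)
    qed
    also have "real n ^ s * ((real C + real k) * (2 * real d)) \<le> \<epsilon> / 4 * real n ^ s * n"
    proof -
      have "(real C + real k) * (2 * real d) \<le> \<epsilon> / 4 * n"
        using n(4) Suc.prems(5) by (simp add: field_simps)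
      hence "real n ^ s * ((real C + real k) * (2 * real d)) \<le> real n ^ s * (\<epsilon> / 4 * n)"
        by (intro mult_left_mono) auto
      thus ?thesis by (simp add: mult_ac)
    qed
    finally show ?thesis by (simp add: mult_ac)
  qed
  thus ?case by blast
qed

section \<open>Evaluation in the profinite integers\<close>

lemma Zhat_component:
  assumes "prime p"
  shows "x \<in> carrier Zhat \<Longrightarrow> x p \<in> carrier (padic_int p)"
    and "(x \<oplus>\<^bsub>Zhat\<^esub> y) p k = (x p k + y p k) mod int p ^ k"
    and "(x \<otimes>\<^bsub>Zhat\<^esub> y) p k = (x p k * y p k) mod int p ^ k"
    and "\<zero>\<^bsub>Zhat\<^esub> p k = 0"
    and "\<one>\<^bsub>Zhat\<^esub> p k = 1 mod int p ^ k"
  using assms by (auto simp: Zhat_def padic_int_def)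

lemma padic_int_residue:
  assumes "x \<in> carrier (padic_int p)"
  shows "0 \<le> x k" "x k < int p ^ k" "x k mod int p ^ k = x k"
proof -
  have "x k \<in> {0..<int p ^ k}" using assms unfolding padic_int_def by (simp only: partial_object.simps) blast
  thus "0 \<le> x k" "x k < int p ^ k" "x k mod int p ^ k = x k" by auto
qed

lemma padic_int_mod:
  assumes "x \<in> carrier (padic_int p)" "k \<le> l"
  shows "x l mod int p ^ k = x k"
  using assms(2)
proof (induction l rule: dec_induct)
  case base
  show ?case by (rule padic_int_residue(3)[OF assms(1)])
next
  case (step l)
  have "x (Suc l) mod int p ^ l = x l"
    using assms(1) unfolding padic_int_def by (simp only: partial_object.simps) blast
  moreover have "int p ^ k dvd int p ^ l" using step by (intro le_imp_power_dvd) auto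
  ultimately show ?case using step.IH by (metis mod_mod_cancel)
qed

text \<open>Component p at level k is a ring homomorphism from \<open>Zhat\<close> to the integers
  modulo p^k. The auxiliary facts keep \<open>mod\<close> on both sides because the integer
  expressions are not reduced; membership in the carrier finally removes it on the left.\<close>

lemma eval_ring_Zhat:
  assumes p: "prime p" and f: "f \<in> int_polys s" and v: "\<And>j. j < s \<Longrightarrow> v j \<in> carrier Zhat"
  shows "eval_ring Zhat f v \<in> carrier Zhat"
    and "eval_ring Zhat f v p k = eval_int f (\<lambda>j. v j p k) mod int p ^ k"
proof -
  interpret Z: cring Zhat by (rule Zhat_cring)
  note comp = Zhat_component[OF p]
  have pow_nat: "(x [^]\<^bsub>Zhat\<^esub> (n::nat)) p k mod int p ^ k = x p k ^ n mod int p ^ k" if "x \<in> carrier Zhat" for x n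
    by (induction n) (auto simp: comp mod_mult_eq mod_simps mult.commute, metis mod_mult_left_eq mult.commute)
  have prod: "(\<Otimes>\<^bsub>Zhat\<^esub>j\<in>J. g j) p k mod int p ^ k = (\<Prod>j\<in>J. g j p k) mod int p ^ k"
    if "finite J" "g \<in> J \<rightarrow> carrier Zhat" for J and g :: "nat \<Rightarrow> nat \<Rightarrow> nat \<Rightarrow> int"
    using that by (induction J rule: finite_induct) (auto simp: comp Pi_iff mod_simps, metis mod_mult_right_eq)
  have smul_nat: "([n] \<cdot>\<^bsub>Zhat\<^esub> x) p k mod int p ^ k = int n * x p k mod int p ^ k" if "x \<in> carrier Zhat" for x and n :: nat
    by (induction n) (auto simp: comp that Z.add.nat_pow_Suc mod_simps algebra_simps, metis mod_add_right_eq)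
  have neg: "(\<ominus>\<^bsub>Zhat\<^esub> x) p k mod int p ^ k = - x p k mod int p ^ k" if "x \<in> carrier Zhat" for x
  proof -
    have "(x p k + (\<ominus>\<^bsub>Zhat\<^esub> x) p k) mod int p ^ k = 0"
      using Z.r_neg[OF that] comp(2,4) by metis
    hence "int p ^ k dvd (\<ominus>\<^bsub>Zhat\<^esub> x) p k - (- x p k)" by (simp add: mod_eq_0_iff_dvd add.commute)
    thus ?thesis by (simp add: mod_eq_dvd_iff)
  qed
  have smul: "([c] \<cdot>\<^bsub>Zhat\<^esub> x) p k mod int p ^ k = c * x p k mod int p ^ k" if x: "x \<in> carrier Zhat" for x and c :: int
  proof (cases "c \<ge> 0")
    case True
    thus ?thesis using smul_nat[OF x, of "nat c"] by (simp add: add_pow_int_ge)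
  next
    case False
    have cl: "[nat (- c)] \<cdot>\<^bsub>Zhat\<^esub> x \<in> carrier Zhat" using x by (rule Z.add.nat_pow_closed)
    have "([c] \<cdot>\<^bsub>Zhat\<^esub> x) p k mod int p ^ k = - (([nat (- c)] \<cdot>\<^bsub>Zhat\<^esub> x) p k) mod int p ^ k"
      using False neg[OF cl] by (simp add: add_pow_int_lt)
    also have "\<dots> = - (int (nat (- c)) * x p k) mod int p ^ k"
      using smul_nat[OF x, of "nat (- c)"] by (metis mod_minus_eq)
    finally show ?thesis using False by simp
  qed
  have sum: "(\<Oplus>\<^bsub>Zhat\<^esub>j\<in>J. g j) p k mod int p ^ k = (\<Sum>j\<in>J. g j p k) mod int p ^ k"
    if "finite J" "g \<in> J \<rightarrow> carrier Zhat" for J and g :: "(nat \<Rightarrow>\<^sub>0 nat) \<Rightarrow> nat \<Rightarrow> nat \<Rightarrow> int"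
    using that by (induction J rule: finite_induct) (auto simp: comp Pi_iff mod_simps, metis mod_add_right_eq)
  define g where "g = (\<lambda>\<alpha>::nat \<Rightarrow>\<^sub>0 nat. \<Otimes>\<^bsub>Zhat\<^esub>j\<in>Poly_Mapping.keys \<alpha>. v j [^]\<^bsub>Zhat\<^esub> Poly_Mapping.lookup \<alpha> j)"
  have vin: "v j \<in> carrier Zhat" if "\<alpha> \<in> Poly_Mapping.keys f" "j \<in> Poly_Mapping.keys \<alpha>" for \<alpha> j
    using f v that by (auto simp: int_polys_def)
  have gin: "g \<alpha> \<in> carrier Zhat" if "\<alpha> \<in> Poly_Mapping.keys f" for \<alpha>
    unfolding g_def using vin[OF that] by (intro Z.finprod_closed) auto
  have tin: "(\<lambda>\<alpha>. [Poly_Mapping.lookup f \<alpha>] \<cdot>\<^bsub>Zhat\<^esub> g \<alpha>) \<in> Poly_Mapping.keys f \<rightarrow> carrier Zhat"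
    using gin by (auto intro: Z.add.int_pow_closed)
  have ev: "eval_ring Zhat f v = (\<Oplus>\<^bsub>Zhat\<^esub>\<alpha>\<in>Poly_Mapping.keys f. [Poly_Mapping.lookup f \<alpha>] \<cdot>\<^bsub>Zhat\<^esub> g \<alpha>)"
    by (simp add: eval_ring_def g_def)
  show in_carrier: "eval_ring Zhat f v \<in> carrier Zhat"
    unfolding ev by (rule Z.finsum_closed[OF tin])
  have gk: "g \<alpha> p k mod int p ^ k = (\<Prod>j\<in>Poly_Mapping.keys \<alpha>. v j p k ^ Poly_Mapping.lookup \<alpha> j) mod int p ^ k"
    if \<alpha>: "\<alpha> \<in> Poly_Mapping.keys f" for \<alpha>
  proof -
    have "g \<alpha> p k mod int p ^ k = (\<Prod>j\<in>Poly_Mapping.keys \<alpha>. (v j [^]\<^bsub>Zhat\<^esub> Poly_Mapping.lookup \<alpha> j) p k) mod int p ^ k"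
      unfolding g_def using vin[OF \<alpha>] by (intro prod) auto
    also have "\<dots> = (\<Prod>j\<in>Poly_Mapping.keys \<alpha>. (v j [^]\<^bsub>Zhat\<^esub> Poly_Mapping.lookup \<alpha> j) p k mod int p ^ k) mod int p ^ k"
      by (rule mod_prod_eq[symmetric])
    also have "\<dots> = (\<Prod>j\<in>Poly_Mapping.keys \<alpha>. v j p k ^ Poly_Mapping.lookup \<alpha> j mod int p ^ k) mod int p ^ k"
      using prod.cong[OF refl pow_nat[OF vin[OF \<alpha>]]] by (rule arg_cong)
    also have "\<dots> = (\<Prod>j\<in>Poly_Mapping.keys \<alpha>. v j p k ^ Poly_Mapping.lookup \<alpha> j) mod int p ^ k"
      by (rule mod_prod_eq)
    finally show ?thesis .
  qed
  have "eval_ring Zhat f v p k = eval_ring Zhat f v p k mod int p ^ k"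
    using padic_int_residue(3)[OF comp(1)[OF in_carrier]] by simp
  also have "\<dots> = (\<Sum>\<alpha>\<in>Poly_Mapping.keys f. ([Poly_Mapping.lookup f \<alpha>] \<cdot>\<^bsub>Zhat\<^esub> g \<alpha>) p k) mod int p ^ k"
    unfolding ev using tin by (intro sum) auto
  also have "\<dots> = (\<Sum>\<alpha>\<in>Poly_Mapping.keys f. ([Poly_Mapping.lookup f \<alpha>] \<cdot>\<^bsub>Zhat\<^esub> g \<alpha>) p k mod int p ^ k) mod int p ^ k"
    by (rule mod_sum_eq[symmetric])
  also have "\<dots> = (\<Sum>\<alpha>\<in>Poly_Mapping.keys f. Poly_Mapping.lookup f \<alpha> *
      (\<Prod>j\<in>Poly_Mapping.keys \<alpha>. v j p k ^ Poly_Mapping.lookup \<alpha> j) mod int p ^ k) mod int p ^ k"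
    by (rule arg_cong[OF sum.cong[OF refl]], rule trans[OF smul[OF gin] mod_mult_cong[OF refl gk]])
  also have "\<dots> = eval_int f (\<lambda>j. v j p k) mod int p ^ k"
    unfolding eval_int_def by (rule mod_sum_eq)
  finally show "eval_ring Zhat f v p k = eval_int f (\<lambda>j. v j p k) mod int p ^ k" .
qed

text \<open>The residue modulo p^k is a sum of nonnegative digit terms, so it vanishes exactly if
  the first k digits do. The infinite valuation of 0 needs no separate case.\<close>

lemma le_lambda_p_iff:
  assumes p: "prime p" and x: "x \<in> carrier Zhat"
  shows "enat k \<le> lambda_p p x \<longleftrightarrow> x p k = 0"
proof -
  have p0: "p > 0" using p prime_gt_0_nat by blast
  have "x p k = (\<Sum>i<k. int (padic_digit p (x p) i) * int p ^ i)"
    using padic_of_digits_bij(2)[OF p0 Zhat_component(1)[OF p x]] by (metis padic_of_digits_def)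
  hence "x p k = 0 \<longleftrightarrow> (\<forall>i<k. padic_digit p (x p) i = 0)"
    using p0 by (simp add: sum_nonneg_eq_0_iff Ball_def)
  also have "\<dots> \<longleftrightarrow> enat k \<le> lambda_p p x"
    unfolding lambda_p_def le_INF_iff by (auto simp: not_less[symmetric])
  finally show ?thesis by simp
qed

text \<open>A residue modulo p^K fixes precisely the first K digits, which turns residue events into
  intersections of independent digit events. The witness x in the proof is \<open>b\<close> itself
  as a p-adic integer.\<close>

lemma digit_sum_eq_iff:
  assumes p: "prime p" and a: "\<And>k. a k < p" and b: "0 \<le> b" "b < int p ^ K"
  shows "padic_of_digits p a K = b \<longleftrightarrow> (\<forall>k<K. a k = nat (b mod int p ^ Suc k div int p ^ k))"
proof -
  have p0: "p > 0" using p prime_gt_0_nat by blast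
  define x where "x = (\<lambda>n. b mod int p ^ n)"
  have x: "x \<in> carrier (padic_int p)"
    using p0 by (auto simp: padic_int_def x_def mod_mod_cancel le_imp_power_dvd simp del: power_Suc)
  have dig: "padic_digit p x k = nat (b mod int p ^ Suc k div int p ^ k)" for k
    by (simp only: padic_digit_def x_def)
  have xK: "padic_of_digits p (padic_digit p x) K = b"
    using padic_of_digits_bij(2)[OF p0 x] b by (simp add: x_def)
  have A: "padic_of_digits p a \<in> carrier (padic_int p)"
    using bij_betwE[OF padic_of_digits_bij(1)[OF p0]] a by blast
  show ?thesis
  proof
    assume eq: "padic_of_digits p a K = b"
    show "\<forall>k<K. a k = nat (b mod int p ^ Suc k div int p ^ k)"
    proof (intro allI impI)
      fix k assume "k < K"
      hence "padic_of_digits p a (Suc k) = b mod int p ^ Suc k"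
        using padic_int_mod[OF A, of "Suc k" K] eq by (simp del: power_Suc)
      moreover have "a k = padic_digit p (padic_of_digits p a) k"
        using padic_of_digits_bij(3)[OF p0, of a] a by simp
      ultimately show "a k = nat (b mod int p ^ Suc k div int p ^ k)"
        by (simp only: padic_digit_def)
    qed
  next
    assume "\<forall>k<K. a k = nat (b mod int p ^ Suc k div int p ^ k)"
    hence "padic_of_digits p a K = padic_of_digits p (padic_digit p x) K"
      unfolding padic_of_digits_def dig by (intro sum.cong) auto
    thus "padic_of_digits p a K = b" using xK by simp
  qed
qed

section \<open>Residues of uniform and of Haar-random points\<close>

lemma tendsto_card_residue_class:
  fixes q :: nat
  assumes "q > 0"
  shows "(\<lambda>n. real (card {t \<in> {1..int n}. int q dvd t - r}) / n) \<longlonglongrightarrow> 1 / q"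
proof (rule LIM_zero_cancel, rule Lim_null_comparison[OF _ lim_inverse_n])
  show "\<forall>\<^sub>F n in sequentially. norm (real (card {t \<in> {1..int n}. int q dvd t - r}) / n - 1 / q) \<le> inverse (real n)"
    using eventually_gt_at_top[of 0]
  proof eventually_elim
    case (elim n)
    have "real (card {t \<in> {1..int n}. int q dvd t - r}) / n - 1 / q =
        (real (card {t \<in> {1..int n}. int q dvd t - r}) - n / q) / n"
      using elim by (simp add: diff_divide_distrib)
    thus ?case using card_residue_class[OF assms, of n r] elim by (simp add: divide_simps)
  qed
qed

text \<open>The Chinese remainder theorem merges the conditions on each coordinate into one class
  modulo the product of the p^K. The limit does not depend on the prescribed residues.\<close>

lemma tendsto_card_cube_residues:
  fixes b :: "nat \<Rightarrow> nat \<Rightarrow> int"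
  assumes T: "finite T" "\<And>p. p \<in> T \<Longrightarrow> prime p"
  shows "(\<lambda>n. real (card {x \<in> cube s n. \<forall>j<s. \<forall>p\<in>T. int p ^ K dvd x j - b j p}) / real n ^ s)
    \<longlonglongrightarrow> 1 / real (\<Prod>p\<in>T. p ^ K) ^ s"
proof -
  define Q where "Q = (\<Prod>p\<in>T. p ^ K)"
  have Q: "Q > 0" unfolding Q_def using T prime_gt_0_nat by (intro prod_pos) auto
  have cop: "coprime (p ^ K) (q ^ K)" if "p \<in> T" "q \<in> T" "p \<noteq> q" for p q
    using T that by (simp add: primes_coprime)
  have "\<exists>r. \<forall>p\<in>T. int p ^ K dvd r - b j p" for j
  proof -
    have "\<exists>r. \<forall>p\<in>T. [r = nat (b j p mod int p ^ K)] (mod p ^ K)"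
      using cop by (intro chinese_remainder_nat[OF T(1)]) blast
    then obtain r where r: "\<forall>p\<in>T. [r = nat (b j p mod int p ^ K)] (mod p ^ K)" by blast
    have "int p ^ K dvd int r - b j p" if p: "p \<in> T" for p
    proof -
      have "int p ^ K > 0" using T p prime_gt_0_nat by simp
      hence "[int r = b j p mod int p ^ K] (mod int p ^ K)"
        using r p cong_int_iff[of r "nat (b j p mod int p ^ K)" "p ^ K"] by simp
      thus ?thesis by (simp add: cong_iff_dvd_diff[symmetric] cong_def)
    qed
    thus ?thesis by blast
  qed
  then obtain r where r: "\<And>j p. p \<in> T \<Longrightarrow> int p ^ K dvd r j - b j p" by metis
  have iff: "(\<forall>p\<in>T. int p ^ K dvd t - b j p) \<longleftrightarrow> int Q dvd t - r j" for t j
  proof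
    assume "\<forall>p\<in>T. int p ^ K dvd t - b j p"
    hence "int p ^ K dvd t - r j" if "p \<in> T" for p
      using dvd_diff[of "int p ^ K" "t - b j p" "r j - b j p"] r that by simp
    hence "(\<Prod>p\<in>T. int p ^ K) dvd t - r j"
      using T cop by (intro prod_dvd_of_pairwise_coprime) (auto simp: simp flip: of_nat_power)
    thus "int Q dvd t - r j" by (simp add: Q_def)
  next
    assume Q: "int Q dvd t - r j"
    show "\<forall>p\<in>T. int p ^ K dvd t - b j p"
    proof
      fix p assume p: "p \<in> T"
      hence "p ^ K dvd Q" unfolding Q_def using T by (intro dvd_prodI) auto
      hence "int p ^ K dvd t - r j" using Q by (metis dvd_trans int_dvd_int_iff of_nat_power)
      thus "int p ^ K dvd t - b j p"
        using dvd_add[of "int p ^ K" "t - r j" "r j - b j p"] r[OF p, of j] by simp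
    qed
  qed
  have card: "card {x \<in> cube s n. \<forall>j<s. \<forall>p\<in>T. int p ^ K dvd x j - b j p}
      = (\<Prod>j<s. card {t \<in> {1..int n}. int Q dvd t - r j})" for n
  proof -
    have "{x \<in> cube s n. \<forall>j<s. \<forall>p\<in>T. int p ^ K dvd x j - b j p} =
        (\<Pi>\<^sub>E j\<in>{..<s}. {t \<in> {1..int n}. int Q dvd t - r j})"
      unfolding iff PiE_def Pi_def by blast
    thus ?thesis by (simp add: card_PiE)
  qed
  have "(\<lambda>n. \<Prod>j<s. real (card {t \<in> {1..int n}. int Q dvd t - r j}) / n) \<longlonglongrightarrow> (\<Prod>j<s. 1 / Q)"
    by (intro tendsto_prod tendsto_card_residue_class Q)
  thus ?thesis unfolding card by (simp add: prod_dividef power_one_over Q_def)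
qed

section \<open>Haar-random points given by independent uniform digits\<close>

locale padic_digits = prob_space M for M :: "'a measure" +
  fixes s :: nat and u :: "nat \<Rightarrow> nat \<Rightarrow> nat \<Rightarrow> 'a \<Rightarrow> nat"
  assumes u_indep: "indep_vars (\<lambda>(j, k, p). count_space {..<p}) (\<lambda>(j, k, p). u j k p)
      ({..<s} \<times> UNIV \<times> {p. prime p})"
    and u_uniform: "\<And>j k p. j < s \<Longrightarrow> prime p \<Longrightarrow>
      distr M (count_space {..<p}) (u j k p) = uniform_count_measure {..<p}"
begin

definition V :: "'a \<Rightarrow> nat \<Rightarrow> nat \<Rightarrow> nat \<Rightarrow> int" where
  "V \<omega> j = Zhat_of_digits (\<lambda>k p. u j k p \<omega>)"

lemma u_measurable: "j < s \<Longrightarrow> prime p \<Longrightarrow> u j k p \<in> M \<rightarrow>\<^sub>M count_space {..<p}"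
  using indep_vars_def[THEN iffD1, OF u_indep] by auto

lemma u_less: "j < s \<Longrightarrow> prime p \<Longrightarrow> \<omega> \<in> space M \<Longrightarrow> u j k p \<omega> < p"
  using measurable_space[OF u_measurable, of j p \<omega> k] by simp

lemma V_component: "prime p \<Longrightarrow> V \<omega> j p = padic_of_digits p (\<lambda>k. u j k p \<omega>)"
  by (simp add: V_def Zhat_of_digits_def)

lemma V_carrier: "j < s \<Longrightarrow> \<omega> \<in> space M \<Longrightarrow> V \<omega> j \<in> carrier Zhat"
  using u_less bij_betwE[OF padic_of_digits_bij(1)] prime_gt_0_nat
  by (auto simp: V_def Zhat_of_digits_def Zhat_def)

lemma V_padic: "j < s \<Longrightarrow> \<omega> \<in> space M \<Longrightarrow> prime p \<Longrightarrow> V \<omega> j p \<in> carrier (padic_int p)"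
  using V_carrier Zhat_component(1) by blast

lemma prob_digit:
  assumes "j < s" "prime p" "a < p"
  shows "prob (u j k p -` {a} \<inter> space M) = 1 / p"
proof -
  have "prob (u j k p -` {a} \<inter> space M) = measure (distr M (count_space {..<p}) (u j k p)) {a}"
    using assms u_measurable by (subst measure_distr) auto
  also have "\<dots> = 1 / p"
    using assms by (subst u_uniform) (auto simp: measure_uniform_count_measure)
  finally show ?thesis .
qed

text \<open>For each of the s coordinates and each p in T, K independent digits are fixed, at a
  factor 1/p each. The result is the limit density of the same residue system in the cube, again
  independent of \<open>b\<close>.\<close>

lemma V_residues:
  assumes T: "finite T" "\<And>p. p \<in> T \<Longrightarrow> prime p"
    and b: "\<And>j p. j < s \<Longrightarrow> p \<in> T \<Longrightarrow> b j p \<in> {0..<int p ^ K}"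
  shows "{\<omega> \<in> space M. \<forall>j<s. \<forall>p\<in>T. V \<omega> j p K = b j p} \<in> events"
    and "prob {\<omega> \<in> space M. \<forall>j<s. \<forall>p\<in>T. V \<omega> j p K = b j p} = 1 / real (\<Prod>p\<in>T. p ^ K) ^ s"
proof -
  define J where "J = {..<s} \<times> {..<K} \<times> T"
  define d where "d = (\<lambda>j k p. nat (b j p mod int p ^ Suc k div int p ^ k))"
  let ?X = "\<lambda>(j, k, p). u j k p"
  let ?A = "\<lambda>(j, k, p). {d j k p}"
  let ?E = "{\<omega> \<in> space M. \<forall>j<s. \<forall>p\<in>T. V \<omega> j p K = b j p}"
  have dlt: "d j k p < p" if "(j, k, p) \<in> J" for j k p
  proof -
    have p: "p > 0" using that T prime_gt_0_nat by (auto simp: J_def)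
    define y where "y = b j p mod int p ^ Suc k"
    have "y < int p * int p ^ k" using p by (simp add: y_def)
    moreover have pk: "int p ^ k > 0" using p by simp
    hence "y div int p ^ k * int p ^ k \<le> y"
      using div_mult_mod_eq[of y "int p ^ k"] pos_mod_sign[OF pk, of y] by linarith
    ultimately have "y div int p ^ k * int p ^ k < int p * int p ^ k" by linarith
    hence "y div int p ^ k < int p" using pk by (simp only: mult_less_cancel_right_pos)
    thus ?thesis using p unfolding d_def y_def[symmetric] by linarith
  qed
  have E: "?E = {\<omega> \<in> space M. \<forall>i\<in>J. \<omega> \<in> ?X i -` ?A i \<inter> space M}"
  proof (rule Collect_cong, rule conj_cong[OF refl])
    fix \<omega> assume \<omega>: "\<omega> \<in> space M"
    have "V \<omega> j p K = b j p \<longleftrightarrow> (\<forall>k<K. u j k p \<omega> = d j k p)" if "j < s" "p \<in> T" for j p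
      using digit_sum_eq_iff[of p "\<lambda>k. u j k p \<omega>" "b j p" K] u_less[OF _ _ \<omega>] b[OF that] T that
      by (simp add: V_component d_def del: power_Suc)
    thus "(\<forall>j<s. \<forall>p\<in>T. V \<omega> j p K = b j p) \<longleftrightarrow> (\<forall>i\<in>J. \<omega> \<in> ?X i -` ?A i \<inter> space M)"
      using \<omega> unfolding J_def by auto
  qed
  have sets: "?X i -` ?A i \<inter> space M \<in> events" if "i \<in> J" for i
  proof -
    obtain j k p where i: "i = (j, k, p)" by (cases i)
    have jkp: "j < s" "prime p" "d j k p < p" using that dlt[of j k p] T(2) unfolding i by (auto simp: J_def)
    hence "u j k p -` {d j k p} \<inter> space M \<in> events"
      by (intro measurable_sets[OF u_measurable]) auto
    thus ?thesis unfolding i prod.case .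
  qed
  have finJ: "finite J" unfolding J_def using T(1) by (intro finite_SigmaI) auto
  \<comment> \<open>Over an empty \<open>J\<close> the intersection would be \<open>UNIV\<close>
    instead of the sample space; this happens if s = 0, K = 0 or T is empty.\<close>
  have E_Int: "?E = (\<Inter>i\<in>J. ?X i -` ?A i \<inter> space M)" if "J \<noteq> {}" unfolding E using that by blast
  have E_space: "?E = space M" if "J = {}" unfolding E using that by simp
  show "?E \<in> events"
  proof (cases "J = {}")
    case True
    show ?thesis unfolding E_space[OF True] by (rule sets.top)
  next
    case False
    show ?thesis unfolding E_Int[OF False] by (rule sets.finite_INT[OF finJ False sets])
  qed
  have "prob ?E = (\<Prod>i\<in>J. 1 / real (snd (snd i)))"
  proof (cases "J = {}")
    case True
    thus ?thesis using E_space prob_space by simp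
  next
    case False
    have "?E = (\<Inter>i\<in>J. ?X i -` ?A i \<inter> space M)" by (rule E_Int[OF False])
    also have "prob \<dots> = (\<Prod>i\<in>J. prob (?X i -` ?A i \<inter> space M))"
      using False T dlt by (intro indep_varsD[OF u_indep]) (auto simp: J_def)
    also have "\<dots> = (\<Prod>i\<in>J. 1 / real (snd (snd i)))"
      using T dlt by (intro prod.cong refl) (auto simp: J_def prob_digit)
    finally show ?thesis .
  qed
  also have "\<dots> = (\<Prod>j<s. \<Prod>k<K. \<Prod>p\<in>T. 1 / real p)"
    unfolding J_def prod.cartesian_product by (intro prod.cong refl) (simp add: case_prod_beta)
  also have "\<dots> = 1 / real (\<Prod>p\<in>T. p ^ K) ^ s"
    by (simp add: prod_dividef power_one_over prod_power_distrib)
  finally show "prob ?E = 1 / real (\<Prod>p\<in>T. p ^ K) ^ s" .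
qed

text \<open>The restriction makes each system of residues a point of a finite extensional product,
  so events can be split over finitely many of them.\<close>

definition residues_of :: "nat set \<Rightarrow> (nat \<Rightarrow> nat \<Rightarrow> int) \<Rightarrow> nat \<times> nat \<Rightarrow> int" where
  "residues_of T z = (\<lambda>(j, p)\<in>{..<s} \<times> T. z j p)"

text \<open>The bridge between both models: a condition \<open>H\<close> on finitely many residues
  splits into finitely many residue systems, each with the same weight c as limit density in the
  cube and as probability. Measurability comes along.\<close>

lemma residue_event_limit:
  assumes T: "finite T" "\<And>p. p \<in> T \<Longrightarrow> prime p"
    and A: "\<And>n x. x \<in> cube s n \<Longrightarrow> A x \<longleftrightarrow> H (residues_of T (\<lambda>j p. x j mod int p ^ K))"
    and B: "\<And>\<omega>. \<omega> \<in> space M \<Longrightarrow> B \<omega> \<longleftrightarrow> H (residues_of T (\<lambda>j p. V \<omega> j p K))"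
  shows "{\<omega> \<in> space M. B \<omega>} \<in> events"
    and "(\<lambda>n. real (card {x \<in> cube s n. A x}) / real n ^ s) \<longlonglongrightarrow> prob {\<omega> \<in> space M. B \<omega>}"
proof -
  define \<Omega> where "\<Omega> = {b \<in> (\<Pi>\<^sub>E (j, p)\<in>{..<s} \<times> T. {0..<int p ^ K}). H b}"
  have fin: "finite \<Omega>"
    unfolding \<Omega>_def by (rule finite_subset[OF Collect_restrict], rule finite_PiE) (auto simp: T)
  define c where "c = 1 / real (\<Prod>p\<in>T. p ^ K) ^ s"
  let ?S = "\<lambda>b n. {x \<in> cube s n. \<forall>j<s. \<forall>p\<in>T. int p ^ K dvd x j - b (j, p)}"
  let ?E = "\<lambda>b. {\<omega> \<in> space M. \<forall>j<s. \<forall>p\<in>T. V \<omega> j p K = b (j, p)}"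
  have \<Omega>D: "b \<in> (\<Pi>\<^sub>E (j, p)\<in>{..<s} \<times> T. {0..<int p ^ K})" "H b" if "b \<in> \<Omega>" for b
    using that unfolding \<Omega>_def by blast+
  have \<Omega>I: "residues_of T z \<in> \<Omega>"
    if "\<And>j p. j < s \<Longrightarrow> p \<in> T \<Longrightarrow> z j p \<in> {0..<int p ^ K}" "H (residues_of T z)" for z
  proof -
    have "residues_of T z \<in> (\<Pi>\<^sub>E (j, p)\<in>{..<s} \<times> T. {0..<int p ^ K})"
      unfolding residues_of_def restrict_PiE_iff
    proof
      fix i assume "i \<in> {..<s} \<times> T"
      then obtain j p where "i = (j, p)" "j < s" "p \<in> T" by blast
      thus "(case i of (j, p) \<Rightarrow> z j p) \<in> (case i of (j, p) \<Rightarrow> {0..<int p ^ K})"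
        using that(1)[of j p] by simp
    qed
    thus ?thesis using that(2) unfolding \<Omega>_def by blast
  qed
  have bnd: "b (j, p) \<in> {0..<int p ^ K}" if "b \<in> \<Omega>" "j < s" "p \<in> T" for b j p
    using PiE_mem[OF \<Omega>D(1)[OF that(1)], of "(j, p)"] that(2,3) by simp
  have eq_residues: "b = residues_of T z"
    if b: "b \<in> \<Omega>" and z: "\<And>j p. j < s \<Longrightarrow> p \<in> T \<Longrightarrow> z j p = b (j, p)" for b z
  proof (rule HOL.ext)
    fix i
    show "b i = residues_of T z i"
    proof (cases "i \<in> {..<s} \<times> T")
      case True
      then obtain j p where "i = (j, p)" "j < s" "p \<in> T" by blast
      thus ?thesis using z by (simp add: residues_of_def)
    next
      case False
      thus ?thesis using PiE_arb[OF \<Omega>D(1)[OF b] False] by (simp only: residues_of_def restrict_apply if_False)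
    qed
  qed
  have EE: "?E b \<in> events" "prob (?E b) = c" if "b \<in> \<Omega>" for b
    unfolding c_def by (rule V_residues[OF T bnd[OF that]]; assumption)+
  have lim: "(\<lambda>n. real (card (?S b n)) / real n ^ s) \<longlonglongrightarrow> c" if "b \<in> \<Omega>" for b
    unfolding c_def by (rule tendsto_card_cube_residues[OF T])
  have cube_eq: "{x \<in> cube s n. A x} = (\<Union>b\<in>\<Omega>. ?S b n)" for n
  proof (intro equalityI subsetI)
    fix x assume x: "x \<in> {x \<in> cube s n. A x}"
    let ?b = "residues_of T (\<lambda>j p. x j mod int p ^ K)"
    have "x j mod int p ^ K \<in> {0..<int p ^ K}" if "p \<in> T" for j p
      using prime_gt_0_nat[OF T(2)[OF that]] by simp
    hence "?b \<in> \<Omega>" using x A[of x n] by (intro \<Omega>I) auto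
    moreover have "x \<in> ?S ?b n" using x by (simp add: residues_of_def)
    ultimately show "x \<in> (\<Union>b\<in>\<Omega>. ?S b n)" by blast
  next
    fix x assume "x \<in> (\<Union>b\<in>\<Omega>. ?S b n)"
    then obtain b where b: "b \<in> \<Omega>" "x \<in> ?S b n" by blast
    have "b = residues_of T (\<lambda>j p. x j mod int p ^ K)"
    proof (rule eq_residues[OF b(1)])
      fix j p assume jp: "j < s" "p \<in> T"
      hence "x j mod int p ^ K = b (j, p) mod int p ^ K" using b(2) unfolding mod_eq_dvd_iff by blast
      thus "x j mod int p ^ K = b (j, p)" using bnd[OF b(1) jp] by simp
    qed
    hence "H (residues_of T (\<lambda>j p. x j mod int p ^ K))" using \<Omega>D(2)[OF b(1)] by simp
    moreover have "x \<in> cube s n" using b(2) by blast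
    ultimately show "x \<in> {x \<in> cube s n. A x}" using A[of x n] by blast
  qed
  have space_eq: "{\<omega> \<in> space M. B \<omega>} = (\<Union>b\<in>\<Omega>. ?E b)"
  proof (intro equalityI subsetI)
    fix \<omega> assume \<omega>: "\<omega> \<in> {\<omega> \<in> space M. B \<omega>}"
    let ?b = "residues_of T (\<lambda>j p. V \<omega> j p K)"
    have "V \<omega> j p K \<in> {0..<int p ^ K}" if "j < s" "p \<in> T" for j p
      using padic_int_residue[OF V_padic[OF that(1) _ T(2)[OF that(2)]], of \<omega> K] \<omega> by simp
    hence "?b \<in> \<Omega>" using \<omega> B[of \<omega>] by (intro \<Omega>I) auto
    moreover have "\<omega> \<in> ?E ?b" using \<omega> by (simp add: residues_of_def)
    ultimately show "\<omega> \<in> (\<Union>b\<in>\<Omega>. ?E b)" by blast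
  next
    fix \<omega> assume "\<omega> \<in> (\<Union>b\<in>\<Omega>. ?E b)"
    then obtain b where b: "b \<in> \<Omega>" "\<omega> \<in> ?E b" by blast
    have "b = residues_of T (\<lambda>j p. V \<omega> j p K)" using b(2) by (intro eq_residues[OF b(1)]) blast
    hence "H (residues_of T (\<lambda>j p. V \<omega> j p K))" using \<Omega>D(2)[OF b(1)] by simp
    moreover have "\<omega> \<in> space M" using b(2) by blast
    ultimately show "\<omega> \<in> {\<omega> \<in> space M. B \<omega>}" using B[of \<omega>] by blast
  qed
  have disjE: "disjoint_family_on ?E \<Omega>"
    unfolding disjoint_family_on_def
  proof (intro ballI impI)
    fix b b' assume bb: "b \<in> \<Omega>" "b' \<in> \<Omega>" "b \<noteq> b'"
    { fix \<omega> assume \<omega>: "\<omega> \<in> ?E b" "\<omega> \<in> ?E b'"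
      have "b = residues_of T (\<lambda>j p. V \<omega> j p K)" using \<omega>(1) by (intro eq_residues[OF bb(1)]) blast
      moreover have "b' = residues_of T (\<lambda>j p. V \<omega> j p K)" using \<omega>(2) by (intro eq_residues[OF bb(2)]) blast
      ultimately have False using bb(3) by simp }
    thus "?E b \<inter> ?E b' = {}" by blast
  qed
  have disjS: "?S b n \<inter> ?S b' n = {}" if bb: "b \<in> \<Omega>" "b' \<in> \<Omega>" "b \<noteq> b'" for b b' n
  proof -
    { fix x assume x: "x \<in> ?S b n" "x \<in> ?S b' n"
      have "b' (j, p) = b (j, p)" if jp: "j < s" "p \<in> T" for j p
      proof -
        have "int p ^ K dvd x j - b (j, p)" "int p ^ K dvd x j - b' (j, p)" using x jp by blast+
        hence "int p ^ K dvd (x j - b (j, p)) - (x j - b' (j, p))" by (rule dvd_diff)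
        hence "b' (j, p) mod int p ^ K = b (j, p) mod int p ^ K" by (simp add: mod_eq_dvd_iff)
        thus ?thesis using bnd[OF bb(1) jp] bnd[OF bb(2) jp] by simp
      qed
      hence "b' = residues_of T (\<lambda>j p. b (j, p))" by (intro eq_residues[OF bb(2)]) simp
      moreover have "b = residues_of T (\<lambda>j p. b (j, p))" by (intro eq_residues[OF bb(1)]) simp
      ultimately have False using bb(3) by simp }
    thus ?thesis by blast
  qed
  show "{\<omega> \<in> space M. B \<omega>} \<in> events" unfolding space_eq by (rule sets.finite_UN[OF fin EE(1)])
  have card_eq: "real (card {x \<in> cube s n. A x}) / real n ^ s = (\<Sum>b\<in>\<Omega>. real (card (?S b n)) / real n ^ s)" for n
  proof -
    have "card (\<Union>b\<in>\<Omega>. ?S b n) = (\<Sum>b\<in>\<Omega>. card (?S b n))"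
      by (intro card_UN_disjoint fin ballI impI finite_subset[OF Collect_restrict finite_cube] disjS)
    thus ?thesis unfolding cube_eq by (simp only: of_nat_sum sum_divide_distrib)
  qed
  have "prob (\<Union>b\<in>\<Omega>. ?E b) = (\<Sum>b\<in>\<Omega>. prob (?E b))"
    by (rule finite_measure_finite_Union[OF fin _ disjE]) (use EE(1) in blast)
  also have "\<dots> = (\<Sum>b\<in>\<Omega>. c)" by (rule sum.cong[OF refl EE(2)])
  finally have "prob {\<omega> \<in> space M. B \<omega>} = (\<Sum>b\<in>\<Omega>. c)" unfolding space_eq .
  moreover have "(\<lambda>n. \<Sum>b\<in>\<Omega>. real (card (?S b n)) / real n ^ s) \<longlonglongrightarrow> (\<Sum>b\<in>\<Omega>. c)"
    by (rule tendsto_sum[OF lim])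
  ultimately show "(\<lambda>n. real (card {x \<in> cube s n. A x}) / real n ^ s) \<longlonglongrightarrow> prob {\<omega> \<in> space M. B \<omega>}"
    by (simp only: card_eq)
qed

end

section \<open>Convergence of the greatest common divisor\<close>

lemma gcd_prime_power_eq:
  assumes "prime p" "l < K" "int p ^ l dvd g" "\<not> int p ^ Suc l dvd g"
  shows "gcd (int p ^ K) g = int p ^ l"
proof (rule zdvd_antisym_nonneg)
  have "gcd (int p ^ K) g dvd int p ^ K" by simp
  then obtain i where i: "i \<le> K" "normalize (gcd (int p ^ K) g) = normalize (int p ^ i)"
    using divides_primepow_weak[of "int p" "gcd (int p ^ K) g" K] assms(1) by auto
  hence eq: "gcd (int p ^ K) g = int p ^ i" by simp
  hence "int p ^ i dvd g" by (metis gcd_dvd2)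
  hence "i \<le> l" using assms(4) power_le_dvd[of "int p" i g "Suc l"] by (meson not_less_eq_eq)
  thus "gcd (int p ^ K) g dvd int p ^ l" unfolding eq by (rule le_imp_power_dvd)
  show "int p ^ l dvd gcd (int p ^ K) g" using assms by (simp add: le_imp_power_dvd)
qed auto

text \<open>Each factor gcd(p^K, g) depends on g modulo p^K only, so under these hypotheses g can be
  read off from finitely many residues.\<close>

lemma eq_prod_gcd_prime_powers:
  fixes g :: int
  assumes g: "g \<ge> 0" and large: "\<And>p. prime p \<Longrightarrow> p > N \<Longrightarrow> \<not> int p dvd g"
    and small: "\<And>p. prime p \<Longrightarrow> p \<le> N \<Longrightarrow> \<not> int p ^ K dvd g"
  shows "g = (\<Prod>p | prime p \<and> p \<le> N. gcd (int p ^ K) g)"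
proof -
  \<comment> \<open>Zero is divisible by every prime, so \<open>large\<close> excludes it.\<close>
  have g0: "g \<noteq> 0" using large bigger_prime[of N] by auto
  define n where "n = nat g"
  have n: "g = int n" "n > 0" using g g0 by (auto simp: n_def)
  have dvd: "int p ^ k dvd g \<longleftrightarrow> p ^ k dvd n" for p k unfolding n by (metis int_dvd_int_iff of_nat_power)
  have "gcd (int p ^ K) g = int p ^ multiplicity p n" if p: "prime p" "p \<le> N" for p
  proof (rule gcd_prime_power_eq[OF p(1)])
    have nu: "\<not> is_unit p" "n \<noteq> 0" using p(1) n by (auto simp: not_prime_unit)
    show "multiplicity p n < K" using small[OF p] nu unfolding dvd by (simp add: power_dvd_iff_le_multiplicity)
    show "int p ^ multiplicity p n dvd g" unfolding dvd by (rule multiplicity_dvd)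
    show "\<not> int p ^ Suc (multiplicity p n) dvd g"
      unfolding dvd using nu by (simp add: power_dvd_iff_le_multiplicity del: power_Suc)
  qed
  hence "(\<Prod>p | prime p \<and> p \<le> N. gcd (int p ^ K) g) = (\<Prod>p | prime p \<and> p \<le> N. int p ^ multiplicity p n)"
    by (intro prod.cong) auto
  also have "\<dots> = (\<Prod>p\<in>prime_factors n. int p ^ multiplicity p n)"
  proof (rule prod.mono_neutral_right)
    show "finite {p. prime p \<and> p \<le> N}" by simp
    show "prime_factors n \<subseteq> {p. prime p \<and> p \<le> N}"
    proof
      fix p assume "p \<in> prime_factors n"
      hence p: "prime p" "p dvd n" by auto
      have "p \<le> N" using large[OF p(1)] dvd[of p 1] p(2) by (cases "p \<le> N") auto
      thus "p \<in> {p. prime p \<and> p \<le> N}" using p by simp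
    qed
    show "\<forall>p\<in>{p. prime p \<and> p \<le> N} - prime_factors n. int p ^ multiplicity p n = 1"
      using n by (auto simp: prime_factors_dvd not_dvd_imp_multiplicity_0)
  qed
  also have "\<dots> = int (\<Prod>p\<in>prime_factors n. p ^ multiplicity p n)" by simp
  also have "\<dots> = g" using n by (simp add: prime_factorization_nat[symmetric])
  finally show ?thesis by simp
qed

text \<open>Reduces measurability of a valuation to that of the events k \<le> N, by a countable
  supremum.\<close>

lemma ereal_of_enat_eq_SUP:
  "ereal_of_enat N = (SUP k. if enat k \<le> N then ereal (real k) else 0)"
proof (cases N)
  case (enat n)
  show ?thesis unfolding enat
  proof (rule antisym)
    show "ereal_of_enat (enat n) \<le> (SUP k. if enat k \<le> enat n then ereal (real k) else 0)"
      by (rule SUP_upper2[of n]) auto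
    show "(SUP k. if enat k \<le> enat n then ereal (real k) else 0) \<le> ereal_of_enat (enat n)"
      by (rule SUP_least) auto
  qed
next
  case infinity
  thus ?thesis using SUP_nat_Infty by simp
qed

section \<open>The greatest common divisor of the values, its truncation and the tail events\<close>

locale polynomial_gcd = padic_digits M s u for M :: "'a measure" and s u +
  fixes m :: nat and f :: "nat \<Rightarrow> int_mpoly"
  assumes m: "m > 0" and f_poly: "\<And>i. i < m \<Longrightarrow> f i \<in> int_polys s"
    and f_nonzero: "\<And>i. i < m \<Longrightarrow> f i \<noteq> 0"
    and f_coprime: "coprime_family s (f ` {..<m})"
begin

definition gcd_at :: "(nat \<Rightarrow> int) \<Rightarrow> int" where
  "gcd_at x = Gcd ((\<lambda>i. eval_int (f i) x) ` {..<m})"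

definition val :: "'a \<Rightarrow> nat \<Rightarrow> enat" where
  "val \<omega> p = (MIN i\<in>{..<m}. lambda_p p (eval_ring Zhat (f i) (V \<omega>)))"

text \<open>The point z may differ from prime to prime: an integer point uses the same x for all p,
  the Haar-random point its residue modulo p^K.\<close>

definition truncated :: "nat \<Rightarrow> nat \<Rightarrow> (nat \<Rightarrow> nat \<Rightarrow> int) \<Rightarrow> int" where
  "truncated N K z = (\<Prod>p | prime p \<and> p \<le> N. gcd (int p ^ K) (gcd_at (\<lambda>j. z j p)))"

text \<open>Outside this set \<open>truncated N K\<close> recovers \<open>gcd_at x\<close> exactly.
  Common zeros of the polynomials are always bad.\<close>

definition bad :: "nat \<Rightarrow> nat \<Rightarrow> (nat \<Rightarrow> int) \<Rightarrow> bool" where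
  "bad N K x \<longleftrightarrow> (\<exists>p>N. prime p \<and> int p dvd gcd_at x) \<or> (\<exists>p\<le>N. prime p \<and> int p ^ K dvd gcd_at x)"

definition bad_limit :: "nat \<Rightarrow> nat \<Rightarrow> 'a \<Rightarrow> bool" where
  "bad_limit N K \<omega> \<longleftrightarrow> (\<exists>p>N. prime p \<and> enat 1 \<le> val \<omega> p) \<or> (\<exists>p\<le>N. prime p \<and> enat K \<le> val \<omega> p)"

lemma dvd_gcd_at_iff: "d dvd gcd_at x \<longleftrightarrow> (\<forall>i<m. d dvd eval_int (f i) x)"
  unfolding gcd_at_def by (auto simp: dvd_Gcd_iff)

lemma gcd_at_nonneg: "gcd_at x \<ge> 0"
  by (simp add: gcd_at_def)

lemma dvd_gcd_at_cong:
  assumes "\<And>j. j < s \<Longrightarrow> x j mod q = y j mod q" "d dvd q"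
  shows "d dvd gcd_at x \<longleftrightarrow> d dvd gcd_at y"
proof -
  have "d dvd eval_int (f i) x \<longleftrightarrow> d dvd eval_int (f i) y" if "i < m" for i
    using eval_int_cong_mod[OF f_poly[OF that], of x q y] assms by (metis dvd_mod_iff)
  thus ?thesis by (simp add: dvd_gcd_at_iff)
qed

lemma gcd_gcd_at_cong:
  assumes "\<And>j. j < s \<Longrightarrow> x j mod q = y j mod q"
  shows "gcd q (gcd_at x) = gcd q (gcd_at y)"
proof -
  have "d dvd gcd q (gcd_at x) \<longleftrightarrow> d dvd gcd q (gcd_at y)" for d
    using dvd_gcd_at_cong[OF assms] by auto
  thus ?thesis by (intro zdvd_antisym_nonneg) auto
qed

text \<open>The level K may exceed k, so a single system of residues modulo p^K decides divisibility
  by p as well as by p^K.\<close>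

lemma le_val_iff:
  assumes \<omega>: "\<omega> \<in> space M" and p: "prime p" and k: "k \<le> K"
  shows "enat k \<le> val \<omega> p \<longleftrightarrow> int p ^ k dvd gcd_at (\<lambda>j. V \<omega> j p K)"
proof -
  have "enat k \<le> val \<omega> p \<longleftrightarrow> (\<forall>i<m. enat k \<le> lambda_p p (eval_ring Zhat (f i) (V \<omega>)))"
    unfolding val_def using m by (subst Min_ge_iff) auto
  also have "\<dots> \<longleftrightarrow> (\<forall>i<m. int p ^ k dvd eval_int (f i) (\<lambda>j. V \<omega> j p k))"
  proof (intro all_cong1 imp_cong refl)
    fix i assume i: "i < m"
    note ev = eval_ring_Zhat[OF p f_poly[OF i], of "V \<omega>"]
    show "enat k \<le> lambda_p p (eval_ring Zhat (f i) (V \<omega>)) \<longleftrightarrow> int p ^ k dvd eval_int (f i) (\<lambda>j. V \<omega> j p k)"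
      using le_lambda_p_iff[OF p ev(1)] ev(2)[of k] V_carrier \<omega> by (simp add: mod_eq_0_iff_dvd)
  qed
  also have "\<dots> \<longleftrightarrow> int p ^ k dvd gcd_at (\<lambda>j. V \<omega> j p k)" by (simp add: dvd_gcd_at_iff)
  also have "\<dots> \<longleftrightarrow> int p ^ k dvd gcd_at (\<lambda>j. V \<omega> j p K)"
  proof (rule dvd_gcd_at_cong)
    fix j assume "j < s"
    thus "V \<omega> j p k mod int p ^ k = V \<omega> j p K mod int p ^ k"
      using padic_int_mod[OF V_padic[OF _ \<omega> p] k] padic_int_residue(3)[OF V_padic[OF _ \<omega> p]] by simp
  qed simp
  finally show ?thesis .
qed

lemma gcd_at_eq_truncated: "\<not> bad N K x \<Longrightarrow> gcd_at x = truncated N K (\<lambda>j p. x j)"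
  unfolding truncated_def bad_def by (intro eq_prod_gcd_prime_powers gcd_at_nonneg) auto

lemma truncated_residues:
  assumes T: "T = {p. prime p \<and> p \<le> N}" and z: "\<And>j p. j < s \<Longrightarrow> p \<in> T \<Longrightarrow> z' j p mod int p ^ K = z j p mod int p ^ K"
  shows "truncated N K z' = truncated N K z"
  unfolding truncated_def using z T by (intro prod.cong refl gcd_gcd_at_cong) auto

lemma truncated_limit:
  shows "{\<omega> \<in> space M. real_of_int (truncated N K (\<lambda>j p. V \<omega> j p K)) \<le> y} \<in> events"
    and "(\<lambda>n. real (card {x \<in> cube s n. real_of_int (truncated N K (\<lambda>j p. x j)) \<le> y}) / real n ^ s)
      \<longlonglongrightarrow> prob {\<omega> \<in> space M. real_of_int (truncated N K (\<lambda>j p. V \<omega> j p K)) \<le> y}"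
proof -
  define T where "T = {p. prime p \<and> p \<le> N}"
  let ?H = "\<lambda>b. real_of_int (truncated N K (\<lambda>j p. b (j, p))) \<le> y"
  have T: "finite T" "\<And>p. p \<in> T \<Longrightarrow> prime p" by (auto simp: T_def)
  have A: "real_of_int (truncated N K (\<lambda>j p. x j)) \<le> y \<longleftrightarrow> ?H (residues_of T (\<lambda>j p. x j mod int p ^ K))" for x
    using truncated_residues[OF T_def, of "\<lambda>j p. residues_of T (\<lambda>j p. x j mod int p ^ K) (j, p)" K "\<lambda>j p. x j"]
    by (simp add: residues_of_def)
  have B: "real_of_int (truncated N K (\<lambda>j p. V \<omega> j p K)) \<le> y \<longleftrightarrow> ?H (residues_of T (\<lambda>j p. V \<omega> j p K))" for \<omega>
    using truncated_residues[OF T_def, of "\<lambda>j p. residues_of T (\<lambda>j p. V \<omega> j p K) (j, p)" K "\<lambda>j p. V \<omega> j p K"]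
    by (simp add: residues_of_def)
  show "{\<omega> \<in> space M. real_of_int (truncated N K (\<lambda>j p. V \<omega> j p K)) \<le> y} \<in> events"
    by (rule residue_event_limit(1)[OF T A B])
  show "(\<lambda>n. real (card {x \<in> cube s n. real_of_int (truncated N K (\<lambda>j p. x j)) \<le> y}) / real n ^ s)
      \<longlonglongrightarrow> prob {\<omega> \<in> space M. real_of_int (truncated N K (\<lambda>j p. V \<omega> j p K)) \<le> y}"
    by (rule residue_event_limit(2)[OF T A B])
qed

text \<open>\<open>bad_limit\<close> involves infinitely many primes; the cut-off \<open>N'\<close>
  leaves an event of finitely many residues, to which \<open>residue_event_limit\<close>
  applies.\<close>

lemma truncated_bad_limit:
  assumes K: "K \<ge> 1"
  shows "{\<omega> \<in> space M. (\<exists>p\<in>{N<..N'}. prime p \<and> enat 1 \<le> val \<omega> p) \<or> (\<exists>p\<le>N. prime p \<and> enat K \<le> val \<omega> p)} \<in> events"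
    and "(\<lambda>n. real (card {x \<in> cube s n. (\<exists>p\<in>{N<..N'}. prime p \<and> int p dvd gcd_at x) \<or>
        (\<exists>p\<le>N. prime p \<and> int p ^ K dvd gcd_at x)}) / real n ^ s) \<longlonglongrightarrow> prob {\<omega> \<in> space M. (\<exists>p\<in>{N<..N'}. prime p \<and> enat 1 \<le> val \<omega> p) \<or> (\<exists>p\<le>N. prime p \<and> enat K \<le> val \<omega> p)}"
proof -
  define T where "T = {p. prime p \<and> p \<le> max N N'}"
  let ?H = "\<lambda>b. (\<exists>p\<in>T. p > N \<and> p \<le> N' \<and> int p ^ 1 dvd gcd_at (\<lambda>j. b (j, p))) \<or>
      (\<exists>p\<in>T. p \<le> N \<and> int p ^ K dvd gcd_at (\<lambda>j. b (j, p)))"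
  have T: "finite T" "\<And>p. p \<in> T \<Longrightarrow> prime p" by (auto simp: T_def)
  have res: "int p ^ k dvd gcd_at (\<lambda>j. residues_of T z (j, p)) \<longleftrightarrow> int p ^ k dvd gcd_at y"
    if "p \<in> T" "\<And>j. j < s \<Longrightarrow> z j p mod int p ^ K = y j mod int p ^ K" "k \<le> K" for p k y z
    using that by (intro dvd_gcd_at_cong[of _ "int p ^ K"]) (auto simp: residues_of_def le_imp_power_dvd)
  have A: "(\<exists>p\<in>{N<..N'}. prime p \<and> int p dvd gcd_at x) \<or> (\<exists>p\<le>N. prime p \<and> int p ^ K dvd gcd_at x)
      \<longleftrightarrow> ?H (residues_of T (\<lambda>j p. x j mod int p ^ K))" for x
  proof -
    have "int p ^ k dvd gcd_at (\<lambda>j. residues_of T (\<lambda>j p. x j mod int p ^ K) (j, p)) \<longleftrightarrow> int p ^ k dvd gcd_at x"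
      if "p \<in> T" "k \<le> K" for p k using that by (intro res) auto
    note * = this[of _ 1] this[of _ K]
    show ?thesis using * K unfolding T_def by (auto simp: max_def)
  qed
  have B: "(\<exists>p\<in>{N<..N'}. prime p \<and> enat 1 \<le> val \<omega> p) \<or> (\<exists>p\<le>N. prime p \<and> enat K \<le> val \<omega> p)
      \<longleftrightarrow> ?H (residues_of T (\<lambda>j p. V \<omega> j p K))" if \<omega>: "\<omega> \<in> space M" for \<omega>
  proof -
    have "int p ^ k dvd gcd_at (\<lambda>j. residues_of T (\<lambda>j p. V \<omega> j p K) (j, p)) \<longleftrightarrow> enat k \<le> val \<omega> p"
      if "p \<in> T" "k \<le> K" for p k
      using res[of p "\<lambda>j p. V \<omega> j p K" "\<lambda>j. V \<omega> j p K" k] le_val_iff[OF \<omega> T(2)] that by simp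
    note * = this[of _ 1] this[of _ K]
    show ?thesis using * K unfolding T_def by (auto simp: max_def)
  qed
  show "{\<omega> \<in> space M. (\<exists>p\<in>{N<..N'}. prime p \<and> enat 1 \<le> val \<omega> p) \<or> (\<exists>p\<le>N. prime p \<and> enat K \<le> val \<omega> p)} \<in> events" by (rule residue_event_limit(1)[OF T A B])
  show "(\<lambda>n. real (card {x \<in> cube s n. (\<exists>p\<in>{N<..N'}. prime p \<and> int p dvd gcd_at x) \<or>
        (\<exists>p\<le>N. prime p \<and> int p ^ K dvd gcd_at x)}) / real n ^ s) \<longlonglongrightarrow> prob {\<omega> \<in> space M. (\<exists>p\<in>{N<..N'}. prime p \<and> enat 1 \<le> val \<omega> p) \<or> (\<exists>p\<le>N. prime p \<and> enat K \<le> val \<omega> p)}"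
    by (rule residue_event_limit(2)[OF T A B])
qed

text \<open>For each cut-off \<open>N'\<close> the probability is a limit of densities that are at
  most \<open>\<epsilon>\<close>; continuity from below removes the cut-off. No Haar measure has to
  be estimated directly.\<close>

lemma bad_limit_small:
  assumes K: "K \<ge> 1" and small: "\<And>n. n \<ge> n0 \<Longrightarrow> real (card {x \<in> cube s n. bad N K x}) / real n ^ s \<le> \<epsilon>"
  shows "{\<omega> \<in> space M. bad_limit N K \<omega>} \<in> events" "prob {\<omega> \<in> space M. bad_limit N K \<omega>} \<le> \<epsilon>"
proof -
  let ?E = "\<lambda>N'. {\<omega> \<in> space M. (\<exists>p\<in>{N<..N'}. prime p \<and> enat 1 \<le> val \<omega> p) \<or> (\<exists>p\<le>N. prime p \<and> enat K \<le> val \<omega> p)}"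
  have eq: "{\<omega> \<in> space M. bad_limit N K \<omega>} = (\<Union>N'. ?E N')"
    unfolding bad_limit_def greaterThanAtMost_iff Bex_def using order_refl by blast
  have ev: "range ?E \<subseteq> events" using truncated_bad_limit(1)[OF K] by blast
  show "{\<omega> \<in> space M. bad_limit N K \<omega>} \<in> events" unfolding eq using ev by blast
  have "prob (?E N') \<le> \<epsilon>" for N'
  proof (rule LIMSEQ_le_const2[OF truncated_bad_limit(2)[OF K]], intro exI[of _ n0] allI impI)
    fix n assume n: "n \<ge> n0"
    have "card {x \<in> cube s n. (\<exists>p\<in>{N<..N'}. prime p \<and> int p dvd gcd_at x) \<or>
        (\<exists>p\<le>N. prime p \<and> int p ^ K dvd gcd_at x)} \<le> card {x \<in> cube s n. bad N K x}"
      unfolding bad_def by (intro card_mono finite_subset[OF Collect_restrict finite_cube] Collect_mono) auto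
    hence "real (card {x \<in> cube s n. (\<exists>p\<in>{N<..N'}. prime p \<and> int p dvd gcd_at x) \<or>
        (\<exists>p\<le>N. prime p \<and> int p ^ K dvd gcd_at x)}) / real n ^ s \<le> real (card {x \<in> cube s n. bad N K x}) / real n ^ s"
      by (intro divide_right_mono) auto
    thus "real (card {x \<in> cube s n. (\<exists>p\<in>{N<..N'}. prime p \<and> int p dvd gcd_at x) \<or>
        (\<exists>p\<le>N. prime p \<and> int p ^ K dvd gcd_at x)}) / real n ^ s \<le> \<epsilon>"
      using small[OF n] by linarith
  qed
  moreover have "incseq ?E" 
    unfolding greaterThanAtMost_iff Bex_def by (intro incseq_SucI Collect_mono) (blast intro: le_SucI)
  hence "(\<lambda>N'. prob (?E N')) \<longlonglongrightarrow> prob (\<Union>N'. ?E N')" by (rule finite_Lim_measure_incseq[OF ev])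
  ultimately show "prob {\<omega> \<in> space M. bad_limit N K \<omega>} \<le> \<epsilon>"
    unfolding eq by (intro LIMSEQ_le_const2) auto
qed

lemma prime_power_divisor_small:
  assumes p: "prime p" and \<epsilon>: "\<epsilon> > 0"
  shows "\<exists>K n0. \<forall>n\<ge>n0. \<forall>K'\<ge>K. real (card {x \<in> cube s n. int p ^ K' dvd gcd_at x}) / real n ^ s \<le> \<epsilon>"
proof -
  from card_zeros_mod_prime_power[OF f_poly[OF m] f_nonzero[OF m]] obtain D a where a: "a \<noteq> 0"
    and D: "\<forall>p K L n. prime p \<longrightarrow> \<not> int p ^ K dvd a \<longrightarrow>
     real n * card {x \<in> cube s n. int p ^ (K + D * L) dvd eval_int (f 0) x} \<le> D * (n / p ^ Suc L + 1) * real n ^ s"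
    by (elim exE conjE)
  \<comment> \<open>Large enough for every prime: p^|a| \<ge> 2^|a| > |a|, so this power cannot
    divide \<open>a\<close>.\<close>
  define K0 where "K0 = nat \<bar>a\<bar>"
  have K0: "\<not> int p ^ K0 dvd a"
  proof
    assume "int p ^ K0 dvd a"
    hence "int p ^ K0 \<le> \<bar>a\<bar>" using a dvd_imp_le_int[of a "int p ^ K0"] by simp
    moreover have "(2::int) ^ K0 \<le> int p ^ K0" using prime_ge_2_nat[OF p] by (intro power_mono) auto
    moreover have "int K0 < 2 ^ K0" by (rule of_nat_less_two_power)
    ultimately show False by (simp add: K0_def)
  qed
  \<comment> \<open>Since p^(L+1) exceeds L, this makes D / p^(L+1) at most
    \<open>\<epsilon> / 2\<close>; the other half is left to D / n.\<close>
  define L where "L = nat \<lceil>2 * D / \<epsilon>\<rceil>"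
  define K where "K = K0 + D * L"
  have "2 * D / \<epsilon> \<le> real p ^ Suc L"
  proof -
    have "L < 2 ^ L" by simp
    also have "(2::nat) ^ L \<le> p ^ L" using prime_ge_2_nat[OF p] by (intro power_mono) auto
    also have "\<dots> \<le> p ^ Suc L" using prime_ge_2_nat[OF p] by simp
    finally have "real L \<le> real (p ^ Suc L)" by linarith
    moreover have "2 * D / \<epsilon> \<le> L" unfolding L_def by linarith
    ultimately show ?thesis by simp
  qed
  moreover have pp: "real p ^ Suc L > 0" using prime_gt_0_nat[OF p] by simp
  ultimately have D1: "D / real p ^ Suc L \<le> \<epsilon> / 2" using \<epsilon> by (simp add: field_simps del: power_Suc)
  define n0 where "n0 = Suc (nat \<lceil>2 * D / \<epsilon>\<rceil>)"
  have "real (card {x \<in> cube s n. int p ^ K' dvd gcd_at x}) / real n ^ s \<le> \<epsilon>" if n: "n \<ge> n0" and K': "K' \<ge> K" for n K'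
  proof -
    have npos: "real n > 0" and "2 * D / \<epsilon> \<le> n" using n unfolding n0_def by linarith+
    hence D2: "D / real n \<le> \<epsilon> / 2" using \<epsilon> by (simp add: field_simps)
    have sub: "{x \<in> cube s n. int p ^ K' dvd gcd_at x} \<subseteq> {x \<in> cube s n. int p ^ K dvd eval_int (f 0) x}"
      using m power_le_dvd[OF _ K'] by (intro Collect_mono) (auto simp: dvd_gcd_at_iff)
    have "real n * card {x \<in> cube s n. int p ^ K' dvd gcd_at x} \<le> real n * card {x \<in> cube s n. int p ^ K dvd eval_int (f 0) x}"
      by (intro mult_left_mono of_nat_mono card_mono finite_subset[OF Collect_restrict finite_cube] sub) simp
    also have "\<dots> \<le> D * (n / p ^ Suc L + 1) * real n ^ s"
      using D[rule_format, OF p K0, of n L] by (simp only: K_def of_nat_power)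
    also have "\<dots> = real n * ((D / real p ^ Suc L + D / real n) * real n ^ s)"
      using npos pp by (simp add: field_simps del: power_Suc)
    also have "\<dots> \<le> real n * (\<epsilon> * real n ^ s)"
      using D1 D2 by (intro mult_left_mono mult_right_mono) (linarith | simp)+
    finally have "card {x \<in> cube s n. int p ^ K' dvd gcd_at x} \<le> \<epsilon> * real n ^ s" using npos by (simp only: mult_le_cancel_left_pos)
    thus ?thesis using npos by (simp add: divide_le_eq)
  qed
  thus ?thesis by blast
qed

lemma bad_small:
  assumes \<epsilon>: "\<epsilon> > 0"
  shows "\<exists>N K n0. K \<ge> 1 \<and> (\<forall>n\<ge>n0. real (card {x \<in> cube s n. bad N K x}) / real n ^ s \<le> \<epsilon>)"
proof -
  have "\<exists>M n0. \<forall>n\<ge>n0. real (card {x \<in> cube s n. \<exists>p>M. prime p \<and> (\<forall>g\<in>f ` {..<m}. int p dvd eval_int g x)})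
     \<le> \<epsilon> / 2 * n ^ s"
    using f_poly f_nonzero f_coprime \<epsilon> m by (intro large_prime_tail) auto
  then obtain N n1 where tail: "\<And>n. n \<ge> n1 \<Longrightarrow>
      real (card {x \<in> cube s n. \<exists>p>N. prime p \<and> (\<forall>g\<in>f ` {..<m}. int p dvd eval_int g x)}) \<le> \<epsilon> / 2 * real n ^ s"
    by auto
  \<comment> \<open>At most N + 1 primes up to N share the other half of
    \<open>\<epsilon>\<close>.\<close>
  define \<delta> where "\<delta> = \<epsilon> / (2 * (real N + 1))"
  have \<delta>: "\<delta> > 0" using \<epsilon> by (simp add: \<delta>_def)
  have "\<forall>p. \<exists>K n0. prime p \<longrightarrow> (\<forall>n\<ge>n0. \<forall>K'\<ge>K. real (card {x \<in> cube s n. int p ^ K' dvd gcd_at x}) / real n ^ s \<le> \<delta>)"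
    using prime_power_divisor_small[OF _ \<delta>] by blast
  then obtain Kf nf where Kn: "\<And>p n K'. prime p \<Longrightarrow> n \<ge> nf p \<Longrightarrow> K' \<ge> Kf p \<Longrightarrow>
      real (card {x \<in> cube s n. int p ^ K' dvd gcd_at x}) / real n ^ s \<le> \<delta>" by metis
  \<comment> \<open>A sum bounds all \<open>Kf p\<close> at once; monotonicity in the exponent was
    built into \<open>prime_power_divisor_small\<close> for this common K.\<close>
  define K where "K = 1 + (\<Sum>p\<le>N. Kf p)"
  define n0 where "n0 = 1 + n1 + (\<Sum>p\<le>N. nf p)"
  have "real (card {x \<in> cube s n. bad N K x}) / real n ^ s \<le> \<epsilon>" if n: "n \<ge> n0" for n
  proof -
    let ?A = "{x \<in> cube s n. \<exists>p>N. prime p \<and> (\<forall>g\<in>f ` {..<m}. int p dvd eval_int g x)}"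
    let ?P = "{p. prime p \<and> p \<le> N}"
    let ?B = "\<lambda>p. {x \<in> cube s n. int p ^ K dvd gcd_at x}"
    have fin: "finite {x \<in> cube s n. Q x}" for Q by (rule finite_subset[OF Collect_restrict finite_cube])
    have npos: "real n > 0" using n by (simp add: n0_def)
    have "{x \<in> cube s n. bad N K x} \<subseteq> ?A \<union> (\<Union>p\<in>?P. ?B p)"
      unfolding bad_def by (auto simp: dvd_gcd_at_iff)
    hence "card {x \<in> cube s n. bad N K x} \<le> card (?A \<union> (\<Union>p\<in>?P. ?B p))"
      by (intro card_mono finite_UnI fin finite_UN_I) auto
    also have "\<dots> \<le> card ?A + card (\<Union>p\<in>?P. ?B p)" by (rule card_Un_le)
    also have "\<dots> \<le> card ?A + (\<Sum>p\<in>?P. card (?B p))" by (intro add_left_mono card_UN_le) simp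
    finally have "real (card {x \<in> cube s n. bad N K x}) \<le> real (card ?A) + (\<Sum>p\<in>?P. real (card (?B p)))"
      by (simp flip: of_nat_sum of_nat_add)
    also have "\<dots> \<le> \<epsilon> / 2 * real n ^ s + (\<Sum>p\<in>?P. \<delta> * real n ^ s)"
    proof (intro add_mono sum_mono)
      show "real (card ?A) \<le> \<epsilon> / 2 * real n ^ s" using n by (intro tail) (simp add: n0_def)
      fix p assume p: "p \<in> ?P"
      have "Kf p \<le> (\<Sum>p\<le>N. Kf p)" "nf p \<le> (\<Sum>p\<le>N. nf p)" using p by (intro member_le_sum; simp)+
      hence "real (card (?B p)) / real n ^ s \<le> \<delta>" using p n by (intro Kn) (auto simp: K_def n0_def)
      thus "real (card (?B p)) \<le> \<delta> * real n ^ s" using npos by (simp add: divide_le_eq)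
    qed
    also have "(\<Sum>p\<in>?P. \<delta> * real n ^ s) \<le> \<epsilon> / 2 * real n ^ s"
    proof -
      have "card ?P \<le> card {..N}" by (intro card_mono) auto
      hence "real (card ?P) \<le> real N + 1" by simp
      hence "real (card ?P) * \<delta> \<le> (real N + 1) * \<delta>" using \<delta> by (intro mult_right_mono) auto
      also have "\<dots> = \<epsilon> / 2" by (simp add: \<delta>_def field_simps)
      finally have "real (card ?P) * \<delta> * real n ^ s \<le> \<epsilon> / 2 * real n ^ s" by (rule mult_right_mono) simp
      thus ?thesis by (simp add: mult_ac)
    qed
    finally show ?thesis using npos by (simp add: divide_le_eq)
  qed
  thus ?thesis by (intro exI[of _ N] exI[of _ K] exI[of _ n0]) (auto simp: K_def)
qed

lemma log_G_term_eq: "log_G_term m f (V \<omega>) p = ereal (ln (real p)) * ereal_of_enat (val \<omega> p)"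
  by (simp add: log_G_term_def val_def)

text \<open>Off the bad event the series has only finitely many nonzero terms, all finite.
  Valuations below K make each gcd with p^K equal to p to the valuation, so the exponential of the
  sum is the truncated product.\<close>

lemma limit_G_eq_truncated:
  assumes \<omega>: "\<omega> \<in> space M" and K: "K \<ge> 1" and nice: "\<not> bad_limit N K \<omega>"
  shows "\<exists>L::real. (log_G_term m f (V \<omega>) has_sum ereal L) {p. prime p}"
    and "limit_G m f (V \<omega>) = real_of_int (truncated N K (\<lambda>j p. V \<omega> j p K))"
    and "truncated N K (\<lambda>j p. V \<omega> j p K) \<ge> 1"
proof -
  let ?T = "{p. prime p \<and> p \<le> N}"
  have "\<exists>l<K. val \<omega> p = enat l" if "p \<in> ?T" for p
  proof -
    have "val \<omega> p < enat K" using that nice by (auto simp: bad_limit_def not_le)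
    thus ?thesis by (cases "val \<omega> p") auto
  qed
  then obtain l where l: "\<And>p. p \<in> ?T \<Longrightarrow> l p < K" "\<And>p. p \<in> ?T \<Longrightarrow> val \<omega> p = enat (l p)" by metis
  have large: "val \<omega> p = 0" if "prime p" "p > N" for p
  proof -
    have "\<not> enat 1 \<le> val \<omega> p" using that nice by (auto simp: bad_limit_def)
    thus ?thesis by (cases "val \<omega> p") (auto simp: zero_enat_def)
  qed
  define S where "S = (\<Sum>p\<in>?T. ln (real p) * real (l p))"
  have sum: "(log_G_term m f (V \<omega>) has_sum ereal S) {p. prime p}"
  proof -
    have "sum (log_G_term m f (V \<omega>)) ?T = ereal S"
      unfolding S_def sum_ereal[symmetric] by (intro sum.cong) (auto simp: log_G_term_eq l(2))
    hence "(log_G_term m f (V \<omega>) has_sum ereal S) ?T"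
      using has_sum_finite[of ?T "log_G_term m f (V \<omega>)"] by simp
    thus ?thesis
      by (rule has_sum_cong_neutral[THEN iffD1, rotated -1]) (auto simp: log_G_term_eq large)
  qed
  thus "\<exists>L::real. (log_G_term m f (V \<omega>) has_sum ereal L) {p. prime p}" by blast
  have "gcd (int p ^ K) (gcd_at (\<lambda>j. V \<omega> j p K)) = int p ^ l p" if p: "p \<in> ?T" for p
  proof (rule gcd_prime_power_eq)
    show "prime p" "l p < K" using p l by auto
    show "int p ^ l p dvd gcd_at (\<lambda>j. V \<omega> j p K)"
      using le_val_iff[OF \<omega>, of p "l p" K] p l[OF p] by simp
    show "\<not> int p ^ Suc (l p) dvd gcd_at (\<lambda>j. V \<omega> j p K)"
      using le_val_iff[OF \<omega>, of p "Suc (l p)" K] p l[OF p] by simp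
  qed
  hence tr: "truncated N K (\<lambda>j p. V \<omega> j p K) = (\<Prod>p\<in>?T. int p ^ l p)"
    unfolding truncated_def by (intro prod.cong) auto
  have "infsum (log_G_term m f (V \<omega>)) {p. prime p} = ereal S" using sum by (rule infsumI)
  hence "limit_G m f (V \<omega>) = exp S" by (simp add: limit_G_def)
  also have "\<dots> = (\<Prod>p\<in>?T. exp (ln (real p) * real (l p)))" unfolding S_def by (rule exp_sum) simp
  also have "\<dots> = (\<Prod>p\<in>?T. real p ^ l p)"
  proof (rule prod.cong[OF refl])
    fix p assume "p \<in> ?T"
    hence "real p > 0" using prime_gt_0_nat by auto
    thus "exp (ln (real p) * real (l p)) = real p ^ l p"
      by (simp add: exp_of_nat2_mult)
  qed
  finally show "limit_G m f (V \<omega>) = real_of_int (truncated N K (\<lambda>j p. V \<omega> j p K))" by (simp add: tr)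
  have "(\<Prod>p\<in>?T. int p ^ l p) > 0" using prime_gt_0_nat by (intro prod_pos) auto
  thus "truncated N K (\<lambda>j p. V \<omega> j p K) \<ge> 1" by (simp add: tr)
qed

text \<open>With nonnegative extended real terms the series is the supremum over the countably many
  finite sets of primes, whether it converges or not. Each event k \<le> \<open>val\<close> is
  measurable because it is decided by residues modulo p^k.\<close>

lemma limit_G_measurable: "(\<lambda>\<omega>. limit_G m f (V \<omega>)) \<in> borel_measurable M"
proof -
  have le: "{\<omega> \<in> space M. enat k \<le> val \<omega> p} \<in> events" if p: "prime p" for k p
  proof (rule residue_event_limit(1)[of "{p}"])
    fix x :: "nat \<Rightarrow> int" and n :: nat
    show "int p ^ k dvd gcd_at x \<longleftrightarrow> int p ^ k dvd gcd_at (\<lambda>j. residues_of {p} (\<lambda>j p. x j mod int p ^ k) (j, p))"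
      by (rule dvd_gcd_at_cong[of _ "int p ^ k"]) (auto simp: residues_of_def)
  next
    fix \<omega> assume \<omega>: "\<omega> \<in> space M"
    have "int p ^ k dvd gcd_at (\<lambda>j. V \<omega> j p k) \<longleftrightarrow> int p ^ k dvd gcd_at (\<lambda>j. residues_of {p} (\<lambda>j p. V \<omega> j p k) (j, p))"
      by (rule dvd_gcd_at_cong[of _ "int p ^ k"]) (auto simp: residues_of_def)
    thus "enat k \<le> val \<omega> p \<longleftrightarrow> int p ^ k dvd gcd_at (\<lambda>j. residues_of {p} (\<lambda>j p. V \<omega> j p k) (j, p))"
      using le_val_iff[OF \<omega> p, of k k] by simp
  qed (use p in auto)
  have term_meas: "(\<lambda>\<omega>. log_G_term m f (V \<omega>) p) \<in> borel_measurable M" if "prime p" for p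
    unfolding log_G_term_eq ereal_of_enat_eq_SUP
    using le[OF that] by (intro borel_measurable_ereal_times borel_measurable_const borel_measurable_SUP measurable_If) auto
  have nonneg: "log_G_term m f (V \<omega>) p \<ge> 0" if "prime p" for \<omega> p
    unfolding log_G_term_eq using prime_ge_1_nat[OF that] by (intro ereal_0_le_mult) auto
  have "infsum (log_G_term m f (V \<omega>)) {p. prime p} =
      (SUP F\<in>{F. finite F \<and> F \<subseteq> {p. prime p}}. sum (log_G_term m f (V \<omega>)) F)" for \<omega>
    using nonneg by (intro nonneg_infsum_complete) auto
  moreover have "(\<lambda>\<omega>. SUP F\<in>{F. finite F \<and> F \<subseteq> {p. prime p}}. sum (log_G_term m f (V \<omega>)) F) \<in> borel_measurable M"
    using term_meas by (intro borel_measurable_SUP borel_measurable_ereal_sum countable_Collect_finite_subset) auto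
  ultimately have "(\<lambda>\<omega>. infsum (log_G_term m f (V \<omega>)) {p. prime p}) \<in> borel_measurable M" by simp
  thus ?thesis unfolding limit_G_def by measurable
qed

text \<open>A point that is bad for all N and K lies in bad events of arbitrarily small probability,
  hence in a null set.\<close>

lemma AE_not_bad_limit: "AE \<omega> in M. \<exists>N K. K \<ge> 1 \<and> \<not> bad_limit N K \<omega>"
proof -
  have "\<forall>i. \<exists>N K. K \<ge> 1 \<and> {\<omega> \<in> space M. bad_limit N K \<omega>} \<in> events \<and>
      prob {\<omega> \<in> space M. bad_limit N K \<omega>} \<le> inverse (real (Suc i))"
  proof
    fix i
    obtain N K n0 where K: "K \<ge> 1"
      and small: "\<And>n. n \<ge> n0 \<Longrightarrow> real (card {x \<in> cube s n. bad N K x}) / real n ^ s \<le> inverse (real (Suc i))"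
      using bad_small[of "inverse (real (Suc i))"] by auto
    have "{\<omega> \<in> space M. bad_limit N K \<omega>} \<in> events"
      "prob {\<omega> \<in> space M. bad_limit N K \<omega>} \<le> inverse (real (Suc i))"
      by (rule bad_limit_small[OF K small], assumption)+
    thus "\<exists>N K. K \<ge> 1 \<and> {\<omega> \<in> space M. bad_limit N K \<omega>} \<in> events \<and>
      prob {\<omega> \<in> space M. bad_limit N K \<omega>} \<le> inverse (real (Suc i))" using K by blast
  qed
  then obtain Nf Kf where "\<forall>i. Kf i \<ge> 1 \<and> {\<omega> \<in> space M. bad_limit (Nf i) (Kf i) \<omega>} \<in> events \<and>
      prob {\<omega> \<in> space M. bad_limit (Nf i) (Kf i) \<omega>} \<le> inverse (real (Suc i))"
    unfolding choice_iff by (elim exE)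
  hence NK: "Kf i \<ge> 1" "{\<omega> \<in> space M. bad_limit (Nf i) (Kf i) \<omega>} \<in> events"
    "prob {\<omega> \<in> space M. bad_limit (Nf i) (Kf i) \<omega>} \<le> inverse (real (Suc i))" for i
    by blast+
  define Z where "Z = (\<Inter>i. {\<omega> \<in> space M. bad_limit (Nf i) (Kf i) \<omega>})"
  have Z: "Z \<in> events" unfolding Z_def using NK(2) by blast
  have "prob Z \<le> inverse (real (Suc i))" for i
    using finite_measure_mono[OF _ NK(2), of Z i] NK(3)[of i] unfolding Z_def by fastforce
  hence "prob Z \<le> 0"
    by (intro LIMSEQ_le_const[OF LIMSEQ_inverse_real_of_nat]) auto
  hence "prob Z = 0" by (simp add: antisym)
  hence "Z \<in> null_sets M" using Z by (simp add: null_sets_def emeasure_eq_measure)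
  thus ?thesis
    by (rule AE_I') (use NK(1) in \<open>auto simp: Z_def\<close>)
qed

text \<open>The truncated distribution functions converge at every y, because each event is decided
  by finitely many residues. On both sides truncation changes the event only inside the bad
  set.\<close>

lemma cdf_limit:
  "(\<lambda>n. real (card {x \<in> cube s n. real_of_int (gcd_at x) \<le> y}) / real n ^ s)
    \<longlonglongrightarrow> prob {\<omega> \<in> space M. limit_G m f (V \<omega>) \<le> y}"
proof (rule LIMSEQ_I)
  fix r :: real assume "r > 0"
  \<comment> \<open>Three errors of size at most \<open>\<epsilon>\<close> occur: truncation in the
    cube, convergence of the truncated counts, and truncation in the limit.\<close>
  define \<epsilon> where "\<epsilon> = r / 4"
  have \<epsilon>: "\<epsilon> > 0" using \<open>r > 0\<close> by (simp add: \<epsilon>_def)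
  obtain N K n0 where K: "K \<ge> 1"
    and small: "\<And>n. n \<ge> n0 \<Longrightarrow> real (card {x \<in> cube s n. bad N K x}) / real n ^ s \<le> \<epsilon>"
    using bad_small[OF \<epsilon>] by blast
  let ?p = "\<lambda>n. real (card {x \<in> cube s n. real_of_int (gcd_at x) \<le> y}) / real n ^ s"
  let ?t = "\<lambda>n. real (card {x \<in> cube s n. real_of_int (truncated N K (\<lambda>j p. x j)) \<le> y}) / real n ^ s"
  let ?G = "{\<omega> \<in> space M. limit_G m f (V \<omega>) \<le> y}"
  let ?Tr = "{\<omega> \<in> space M. real_of_int (truncated N K (\<lambda>j p. V \<omega> j p K)) \<le> y}"
  let ?Bad = "{\<omega> \<in> space M. bad_limit N K \<omega>}"
  have "\<exists>n1. \<forall>n\<ge>n1. norm (?t n - prob ?Tr) < \<epsilon>" by (rule LIMSEQ_D[OF truncated_limit(2) \<epsilon>])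
  then obtain n1 where n1: "\<And>n. n \<ge> n1 \<Longrightarrow> \<bar>?t n - prob ?Tr\<bar> < \<epsilon>" by auto
  have pt: "\<bar>?p n - ?t n\<bar> \<le> \<epsilon>" if n: "n \<ge> n0" for n
  proof -
    let ?B = "{x \<in> cube s n. bad N K x}"
    have le: "real (card {x \<in> cube s n. Q x}) / real n ^ s \<le> real (card {x \<in> cube s n. Q' x}) / real n ^ s + \<epsilon>"
      if "\<And>x. Q x \<Longrightarrow> \<not> bad N K x \<Longrightarrow> Q' x" for Q Q'
    proof -
      have fin: "finite {x \<in> cube s n. R x}" for R by (rule finite_subset[OF Collect_restrict finite_cube])
      have "card {x \<in> cube s n. Q x} \<le> card ({x \<in> cube s n. Q' x} \<union> ?B)"
        using that by (intro card_mono finite_UnI fin) blast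
      also have "\<dots> \<le> card {x \<in> cube s n. Q' x} + card ?B" by (rule card_Un_le)
      finally have "real (card {x \<in> cube s n. Q x}) / real n ^ s \<le> (real (card {x \<in> cube s n. Q' x}) + real (card ?B)) / real n ^ s"
        by (intro divide_right_mono) (auto simp flip: of_nat_add)
      thus ?thesis using small[OF n] by (simp add: add_divide_distrib)
    qed
    have "?p n \<le> ?t n + \<epsilon>" "?t n \<le> ?p n + \<epsilon>"
      by (rule le; simp add: gcd_at_eq_truncated)+
    thus ?thesis by linarith
  qed
  have bl: "?Bad \<in> events" "prob ?Bad \<le> \<epsilon>" by (rule bad_limit_small[OF K small], assumption)+
  have G: "?G \<in> events" using limit_G_measurable by measurable
  have Tr: "?Tr \<in> events" by (rule truncated_limit(1))
  have "prob ?G \<le> prob (?Tr \<union> ?Bad)"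
    using limit_G_eq_truncated(2)[OF _ K] Tr bl by (intro finite_measure_mono) auto
  also have "\<dots> \<le> prob ?Tr + prob ?Bad" using Tr bl by (intro measure_Un_le)
  finally have 1: "prob ?G \<le> prob ?Tr + \<epsilon>" using bl by linarith
  have "prob ?Tr \<le> prob (?G \<union> ?Bad)"
    using limit_G_eq_truncated(2)[OF _ K] G bl by (intro finite_measure_mono) auto
  also have "\<dots> \<le> prob ?G + prob ?Bad" using G bl by (intro measure_Un_le)
  finally have 2: "prob ?Tr \<le> prob ?G + \<epsilon>" using bl by linarith
  have "norm (?p n - prob ?G) < r" if "n \<ge> max n0 n1" for n
    using pt[of n] n1[of n] 1 2 that unfolding \<epsilon>_def by (simp only: real_norm_def) linarith
  thus "\<exists>no. \<forall>n\<ge>no. norm (?p n - prob ?G) < r" by blast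
qed

end

text \<open>\<open>Gcd\<close> is blind to signs and to zeros; if only zeros are present, both sides
  are 0.\<close>

lemma gcd_nonzero_eq_Gcd: "gcd_nonzero A = Gcd (set_mset A)"
proof (rule zdvd_antisym_nonneg)
  show "gcd_nonzero A dvd Gcd (set_mset A)"
  proof (rule Gcd_greatest)
    fix a assume "a \<in># A"
    show "gcd_nonzero A dvd a"
    proof (cases "a = 0")
      case False
      hence "gcd_nonzero A dvd \<bar>a\<bar>" unfolding gcd_nonzero_def using \<open>a \<in># A\<close> by (intro Gcd_dvd) auto
      thus ?thesis by simp
    qed simp
  qed
  show "Gcd (set_mset A) dvd gcd_nonzero A"
    unfolding gcd_nonzero_def by (rule Gcd_greatest) (auto intro: Gcd_dvd)
qed (auto simp: gcd_nonzero_def)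

theorem theorem3p1:
  fixes s m :: nat
    and f :: "nat \<Rightarrow> int_mpoly"
    and M :: "'a measure"
    and u :: "nat \<Rightarrow> nat \<Rightarrow> nat \<Rightarrow> 'a \<Rightarrow> nat"
    and N :: "nat \<Rightarrow> 'b measure"
    and U :: "nat \<Rightarrow> 'b \<Rightarrow> nat \<Rightarrow> int"
    and V :: "'a \<Rightarrow> nat \<Rightarrow> nat \<Rightarrow> nat \<Rightarrow> int"
  assumes s: "s \<ge> 1" and m: "m \<ge> 2"
    and f_poly: "\<And>i. i < m \<Longrightarrow> f i \<in> int_polys s"
    and f_nonzero: "\<And>i. i < m \<Longrightarrow> f i \<noteq> 0"
    and no_common_factor:
      "\<not> (\<exists>h\<in>int_polys s. total_degree h > 0 \<and> (\<forall>i<m. \<exists>g\<in>int_polys s. f i = h * g))"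
    and M: "prob_space M"
    and u_indep: "prob_space.indep_vars M (\<lambda>(j, k, p). count_space {..<p}) (\<lambda>(j, k, p). u j k p)
                    ({..<s} \<times> UNIV \<times> {p. prime p})"
    and u_uniform: "\<And>j k p. j < s \<Longrightarrow> prime p \<Longrightarrow>
                      distr M (count_space {..<p}) (u j k p) = uniform_count_measure {..<p}"
    and V: "\<And>\<omega> j. V \<omega> j = Zhat_of_digits (\<lambda>k p. u j k p \<omega>)"
    and N: "\<And>n. n \<ge> 1 \<Longrightarrow> prob_space (N n)"
    and U_rv: "\<And>n. n \<ge> 1 \<Longrightarrow> U n \<in> N n \<rightarrow>\<^sub>M count_space ({..<s} \<rightarrow>\<^sub>E {1..int n})"
    and U_uniform: "\<And>n. n \<ge> 1 \<Longrightarrow>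
                      distr (N n) (count_space ({..<s} \<rightarrow>\<^sub>E {1..int n})) (U n)
                        = uniform_count_measure ({..<s} \<rightarrow>\<^sub>E {1..int n})"
  shows "(AE \<omega> in M. \<exists>L::real. (log_G_term m f (V \<omega>) has_sum ereal L) {p. prime p})
    \<and> (\<lambda>\<omega>. limit_G m f (V \<omega>)) \<in> borel_measurable M
    \<and> (AE \<omega> in M. \<exists>k::nat. k \<ge> 1 \<and> limit_G m f (V \<omega>) = real k)
    \<and> weak_conv_m
        (\<lambda>n. distr (N n) borel
               (\<lambda>\<omega>. real_of_int (gcd_nonzero (image_mset (\<lambda>i. eval_int (f i) (U n \<omega>)) (mset_set {..<m})))))
        (distr M borel (\<lambda>\<omega>. limit_G m f (V \<omega>)))"
proof -
  interpret P: prob_space M by (rule M)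
  have cop: "coprime_family s (f ` {..<m})"
    using no_common_factor unfolding coprime_family_def dvd_in_def by auto
  interpret polynomial_gcd M s u m f
    using u_indep u_uniform m f_poly f_nonzero cop by unfold_locales auto
  have VV: "V \<omega> = padic_digits.V u \<omega>" for \<omega>
    by (rule ext) (simp add: assms(9) V_def)
  have gcd: "gcd_nonzero (image_mset (\<lambda>i. eval_int (f i) x) (mset_set {..<m})) = gcd_at x" for x
    by (simp add: gcd_nonzero_eq_Gcd gcd_at_def)
  have prob_N: "measure (N n) {\<omega> \<in> space (N n). Q (U n \<omega>)} = real (card {x \<in> cube s n. Q x}) / real n ^ s"
    if n: "n \<ge> 1" for n Q
  proof -
    have "{\<omega> \<in> space (N n). Q (U n \<omega>)} = U n -` {x \<in> cube s n. Q x} \<inter> space (N n)"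
      using measurable_space[OF U_rv[OF n]] by auto
    also have "measure (N n) \<dots> = measure (distr (N n) (count_space (cube s n)) (U n)) {x \<in> cube s n. Q x}"
      using U_rv[OF n] by (subst measure_distr) auto
    also have "\<dots> = real (card {x \<in> cube s n. Q x}) / real n ^ s"
      unfolding U_uniform[OF n] using finite_cube card_cube by (subst measure_uniform_count_measure) auto
    finally show ?thesis .
  qed
  define X where "X = (\<lambda>n \<omega>. real_of_int (gcd_at (U n \<omega>)))"
  have cdf_N: "cdf (distr (N n) borel (X n)) y = real (card {x \<in> cube s n. real_of_int (gcd_at x) \<le> y}) / real n ^ s"
    if n: "n \<ge> 1" for n y
  proof -
    have "X n \<in> borel_measurable (N n)"
      unfolding X_def by (rule measurable_compose[OF U_rv[OF n]]) simp
    hence "cdf (distr (N n) borel (X n)) y = measure (N n) (X n -` {..y} \<inter> space (N n))"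
      unfolding cdf_def by (subst measure_distr) auto
    also have "X n -` {..y} \<inter> space (N n) = {\<omega> \<in> space (N n). real_of_int (gcd_at (U n \<omega>)) \<le> y}"
      by (auto simp: X_def)
    finally show ?thesis using prob_N[OF n, of "\<lambda>x. real_of_int (gcd_at x) \<le> y"] by simp
  qed
  have cdf_M: "cdf (distr M borel (\<lambda>\<omega>. limit_G m f (V \<omega>))) y = measure M {\<omega> \<in> space M. limit_G m f (V \<omega>) \<le> y}" for y
  proof -
    have "cdf (distr M borel (\<lambda>\<omega>. limit_G m f (V \<omega>))) y = measure M ((\<lambda>\<omega>. limit_G m f (V \<omega>)) -` {..y} \<inter> space M)"
      unfolding cdf_def using limit_G_measurable by (subst measure_distr) (auto simp: VV)
    also have "(\<lambda>\<omega>. limit_G m f (V \<omega>)) -` {..y} \<inter> space M = {\<omega> \<in> space M. limit_G m f (V \<omega>) \<le> y}" by auto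
    finally show ?thesis .
  qed
  \<comment> \<open>Convergence also at the jumps of the limit, more than weak convergence demands.
    The passage to counts is eventual, as \<open>N n\<close> and \<open>U n\<close> are constrained
    from n = 1 on.\<close>
  have "(\<lambda>n. cdf (distr (N n) borel (X n)) y) \<longlonglongrightarrow> cdf (distr M borel (\<lambda>\<omega>. limit_G m f (V \<omega>))) y" for y
  proof (rule Lim_transform_eventually)
    show "(\<lambda>n. real (card {x \<in> cube s n. real_of_int (gcd_at x) \<le> y}) / real n ^ s)
        \<longlonglongrightarrow> cdf (distr M borel (\<lambda>\<omega>. limit_G m f (V \<omega>))) y"
      unfolding cdf_M unfolding VV by (rule cdf_limit)
    show "\<forall>\<^sub>F n in sequentially. real (card {x \<in> cube s n. real_of_int (gcd_at x) \<le> y}) / real n ^ s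
        = cdf (distr (N n) borel (X n)) y"
      using eventually_ge_at_top[of 1] by eventually_elim (simp add: cdf_N)
  qed
  hence "weak_conv_m (\<lambda>n. distr (N n) borel (X n)) (distr M borel (\<lambda>\<omega>. limit_G m f (V \<omega>)))"
    by (simp add: weak_conv_m_def weak_conv_def)
  moreover have "AE \<omega> in M. \<exists>L::real. (log_G_term m f (V \<omega>) has_sum ereal L) {p. prime p}"
    using AE_not_bad_limit AE_space by eventually_elim (use limit_G_eq_truncated(1) VV in metis)
  moreover have "AE \<omega> in M. \<exists>k::nat. k \<ge> 1 \<and> limit_G m f (V \<omega>) = real k"
    using AE_not_bad_limit AE_space
  proof eventually_elim
    case (elim \<omega>)
    then obtain B K where "K \<ge> 1" "\<not> bad_limit B K \<omega>" by blast
    note * = limit_G_eq_truncated(2,3)[OF elim(2) this]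
    show ?case
      by (rule exI[of _ "nat (truncated B K (\<lambda>j p. padic_digits.V u \<omega> j p K))"]) (use * in \<open>simp add: VV\<close>)
  qed
  moreover have "(\<lambda>\<omega>. limit_G m f (V \<omega>)) \<in> borel_measurable M"
    unfolding VV by (rule limit_G_measurable)
  ultimately show ?thesis unfolding gcd X_def by blast
qed

end
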